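(* Let $n\ge1$ be an integer and $p>(n-1)/2$ a real number. For the statistical model $\{f_{p,\sigma}(x)\,dx;\ \sigma\in E_+\}$ on $\mathbb{R}^n$, the Jeffreys a priori measure $\sqrt{\det I_p(\sigma)}\,\mathbf 1_{E_+}(\sigma)\,d\sigma$ is given by $$\det I_p(\sigma)=\left(\frac{2p+1}{2(2p+3)}\right)^{n(n+1)/2}\left(1-\frac{n}{2p+1}\right)(\det\sigma)^{-n-1}\qquad(\sigma\in E_+),$$ where $I_p(\sigma)$ is the Fisher information of the model at $\sigma$ and $\det I_p(\sigma)$ is its determinant as an endomorphism of $E$.
   Context: $E$ is the Euclidean space of real symmetric matrices of order $n$ with $\langle u,v\rangle=\operatorname{tr}(uv)$; $E_+\subset E$ is the open cone of positive definite matrices. For $u\in E$, the endomorphisms $u\otimes u$ and $\mathbb{P}(u)$ of $E$ are defined by $(u\otimes u)(v)=u\operatorname{tr}(uv)$ and $\mathbb{P}(u)(v)=uvu$. For $p>(n-1)/2$ and $\sigma\in E_+$, the Wishart distribution $\gamma_{p,\sigma}$ is the probability measure on $E_+$ characterized by $\int_{E_+}e^{-\operatorname{tr}(su)}\gamma_{p,\sigma}(du)=\det(I_n+\sigma s)^{-p}$ for all $s\in E_+$. The density $f_{p,\sigma}$ on $\mathbb{R}^n$ is that of $X$ where $U\sim\gamma_{p,\sigma}$ and $X|U\sim N(0,U^{-1})$: $$f_{p,\sigma}(x)=\frac{1}{(2\pi)^{n/2}}\int_{E_+}e^{-x^tux/2}(\det u)^{1/2}\gamma_{p,\sigma}(du),$$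 and explicitly $$f_{p,\sigma}(x)=\frac{1}{(2\pi)^{n/2}}\frac{\Gamma(p+\frac12)}{\Gamma(p-\frac{n-1}{2})}\frac{(\det\sigma)^{1/2}}{(1+\frac12x^t\sigma x)^{p+\frac12}}.$$ The Fisher information is the endomorphism of $E$ $$I_p(\sigma)=\int_{\mathbb{R}^n}\ell_x'(\sigma)\otimes\ell_x'(\sigma)\,f_{p,\sigma}(x)\,dx,$$ where $\ell_x(\sigma)=\log f_{p,\sigma}(x)$ and $\ell_x'(\sigma)\in E$ is the gradient of $\sigma\mapsto\ell_x(\sigma)$ on $E_+$ with respect to the scalar product of $E$. It is given by $I_p(\sigma)=\frac{1}{2(2p+3)}\big((2p+1)\mathbb{P}(\sigma^{-1})-\sigma^{-1}\otimes\sigma^{-1}\big)$. *)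

theory Defs
  imports "Jordan_Normal_Form.Determinant" "HOL-Probability.Probability"
begin

text \<open>Unqualified \<open>det\<close>, \<open>mat\<close>, \<open>$\<close> and \<open>\<bullet>\<close> are those of
  HOL-Analysis; the matrices with dimensions in \<open>nat\<close> serve only to define the determinant
  of an endomorphism of a subspace.\<close>

hide_const (open) Determinant.det Matrix.mat

no_notation vec_index (infixl \<open>$\<close> 100)
no_notation scalar_prod (infix \<open>\<bullet>\<close> 70)

definition sym_mat :: "(real^'n^'n) set" where
  "sym_mat = {u. transpose u = u}"

definition pos_def :: "(real^'n^'n) set" where
  "pos_def = {u \<in> sym_mat. \<forall>x. x \<noteq> 0 \<longrightarrow> x \<bullet> (u *v x) > 0}"

definition tensor_sq :: "real^'n^'n \<Rightarrow> real^'n^'n \<Rightarrow> real^'n^'n" where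
  "tensor_sq u v = trace (u ** v) *\<^sub>R u"

definition is_basis_list :: "'a::real_vector set \<Rightarrow> 'a list \<Rightarrow> bool" where
  "is_basis_list V bs \<longleftrightarrow> distinct bs \<and> independent (set bs) \<and> span (set bs) = V"

definition matrix_wrt :: "'a::real_vector list \<Rightarrow> ('a \<Rightarrow> 'a) \<Rightarrow> real Matrix.mat" where
  "matrix_wrt bs T = Matrix.mat (length bs) (length bs)
     (\<lambda>(i, j). representation (set bs) (T (bs ! j)) (bs ! i))"

text \<open>The choice of the basis is immaterial when \<open>T\<close> is linear on \<open>V\<close> and maps \<open>V\<close> to itself.\<close>

definition endo_det :: "'a::real_vector set \<Rightarrow> ('a \<Rightarrow> 'a) \<Rightarrow> real" where
  "endo_det V T = Determinant.det (matrix_wrt (SOME bs. is_basis_list V bs) T)"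

definition is_wishart :: "real \<Rightarrow> real^'n^'n \<Rightarrow> (real^'n^'n) measure \<Rightarrow> bool" where
  "is_wishart p \<sigma> M \<longleftrightarrow>
     prob_space M \<and> sets M = sets (restrict_space borel pos_def) \<and>
     (\<forall>s\<in>pos_def. (\<integral>u. exp (- trace (s ** u)) \<partial>M) = det (mat 1 + \<sigma> ** s) powr (- p))"

definition wishart :: "real \<Rightarrow> real^'n^'n \<Rightarrow> (real^'n^'n) measure" where
  "wishart p \<sigma> = (THE M. is_wishart p \<sigma> M)"

definition model_density :: "real \<Rightarrow> real^'n^'n \<Rightarrow> real^'n \<Rightarrow> real" where
  "model_density p \<sigma> x =
     1 / (2 * pi) powr (real CARD('n) / 2) *
     (\<integral>u. exp (- (x \<bullet> (u *v x)) / 2) * sqrt (det u) \<partial>(wishart p \<sigma>))"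

text \<open>The gradient on \<open>pos_def\<close>, an open subset of \<open>sym_mat\<close>, with respect to the scalar product
  \<open>trace (u ** v)\<close>. The derivative is taken within \<open>pos_def\<close>, so only symmetric increments
  count; the condition \<open>g \<in> sym_mat\<close> makes \<open>g\<close> unique.\<close>

definition sym_gradient :: "(real^'n^'n \<Rightarrow> real) \<Rightarrow> real^'n^'n \<Rightarrow> real^'n^'n" where
  "sym_gradient F \<sigma> = (THE g. g \<in> sym_mat \<and>
     (F has_derivative (\<lambda>h. trace (g ** h))) (at \<sigma> within pos_def))"

definition score :: "real \<Rightarrow> real^'n \<Rightarrow> real^'n^'n \<Rightarrow> real^'n^'n" where
  "score p x \<sigma> = sym_gradient (\<lambda>s. ln (model_density p s x)) \<sigma>"

text \<open>The endomorphism-valued integral, evaluated at \<open>v\<close>.\<close>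

definition fisher_information :: "real \<Rightarrow> real^'n^'n \<Rightarrow> real^'n^'n \<Rightarrow> real^'n^'n" where
  "fisher_information p \<sigma> v =
     (\<integral>x. model_density p \<sigma> x *\<^sub>R tensor_sq (score p x \<sigma>) v \<partial>lborel)"

text \<open>Lebesgue measure of a subspace, as a Borel measure on the ambient space. For \<open>sym_mat\<close> the
  inherited inner product is \<open>trace (u ** v)\<close>.\<close>

definition subspace_lborel :: "'a::euclidean_space set \<Rightarrow> 'a measure" where
  "subspace_lborel V =
     (let B = (SOME B. pairwise orthogonal B \<and> (\<forall>b\<in>B. norm b = 1) \<and> span B = V)
      in distr (\<Pi>\<^sub>M b\<in>B. lborel) borel (\<lambda>c. \<Sum>b\<in>B. c b *\<^sub>R b))"

definition jeffreys_measure :: "real \<Rightarrow> (real^'n^'n) measure" where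
  "jeffreys_measure p = density (subspace_lborel sym_mat)
     (\<lambda>\<sigma>. ennreal (sqrt (endo_det sym_mat (fisher_information p \<sigma>)) * indicator pos_def \<sigma>))"

end

theory Submission
  imports Defs
begin

text \<open>
  For \<open>n \<times> n\<close> matrices \<open>x\<close> put \<open>W q t = \<integral> |det x| powr (2q - n) exp (- tr (x t x\<^sup>T)) dx\<close>. The substitution
  \<open>x \<mapsto> x \<surd>t\<close> gives \<open>W q t = (det t) powr (- q) W q 1\<close>, so the law of \<open>x\<^sup>T x\<close> under the normalised
  integrand with \<open>t = \<sigma>\<inverse>\<close> has the Laplace transform of the Wishart distribution. Its uniqueness
  follows from the Stone-Weierstrass theorem. Integrating \<open>exp (- |x y|\<^sup>2/2)\<close> over \<open>y\<close> relates \<open>W q 1\<close> to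
  \<open>W (q + 1/2) 1\<close>, which gives finiteness for all \<open>q > (n - 1)/2\<close> and the normalising constant of the
  density \<open>\<surd>(det \<sigma>) (1 + x\<^sup>T \<sigma> x/2) powr (- p - 1/2)\<close>.

  With \<open>c = \<sigma> powr (- 1/2)\<close> and \<open>x = c y\<close> the score becomes \<open>c (1 - (p + 1/2) y y\<^sup>T/(1 + |y|\<^sup>2/2)) c/2\<close>. The second
  and fourth moments of \<open>y\<close>, computed by a Gamma mixture of Gaussians, show that the Fisher information
  is \<open>P(c) \<circ> S \<circ> P(c)\<close>, where \<open>P(c) v = c v c\<close> has determinant \<open>(det c)\<close> to the power \<open>n + 1\<close> and
  \<open>S w = a w - b (tr w) 1\<close> has eigenvalue \<open>a - n b\<close> on the identity and \<open>a\<close> on its orthogonal complement.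
\<close>

section \<open>Spectral theorem for symmetric matrices\<close>

text \<open>Both \<open>wishart\<close> and \<open>sym_gradient\<close> are defined by
  \<open>THE\<close>, so every computation rests on existence and uniqueness. Working with square
  matrices \<open>x\<close> instead of the cone avoids the Jacobian of
  \<open>x \<mapsto> transpose x ** x\<close> and the multivariate Gamma function: only Lebesgue
  measure on full vector and matrix spaces occurs, and linear substitutions are reduced to positive
  definite matrices, which the spectral theorem splits into two isometries and a scaling of
  coordinates. The constants W q 1 are never evaluated. Only the ratio of two of them enters the
  density, and the recursion in q expresses it by the mass of a Student distribution. The Laplace
  transform is prescribed only at positive definite arguments and the cone is not compact; hence
  Stone-Weierstrass is applied in coordinates that are themselves exponentials. The bound p > (n -
  1)/2 enters as r > n/2 for the Student exponent r = p + 1/2. It also suffices for the second and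
  fourth moments, because each factor 1/(1 + |y|^2/2) of the score compensates for two powers of
  |y|.\<close>

lemma self_adjoint_eigenvector:
  fixes f :: "'a::euclidean_space \<Rightarrow> 'a"
  assumes f: "linear f" and sa: "\<And>x y. f x \<bullet> y = x \<bullet> f y"
    and S: "subspace S" "S \<noteq> {0}" and inv: "f ` S \<subseteq> S"
  obtains v l where "v \<in> S" "norm v = 1" "f v = l *\<^sub>R v"
proof -
  let ?K = "S \<inter> sphere 0 1"
  obtain x where x: "x \<in> S" "x \<noteq> 0"
    using S subspace_0 by blast
  then have "(1 / norm x) *\<^sub>R x \<in> ?K"
    using S by (simp add: subspace_scale)
  then have "?K \<noteq> {}" by blast
  moreover have "compact ?K"
    by (rule closed_Int_compact) (use S closed_subspace in auto)
  moreover have "continuous_on ?K (\<lambda>x. x \<bullet> f x)"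
    using f by (intro continuous_on_inner continuous_on_id linear_continuous_on)
      (simp add: linear_conv_bounded_linear)
  \<comment> \<open>A maximiser of the Rayleigh quotient; its value \<open>l\<close> turns out to be
    the eigenvalue.\<close>
  ultimately obtain v where v: "v \<in> ?K" and vmax: "\<And>y. y \<in> ?K \<Longrightarrow> y \<bullet> f y \<le> v \<bullet> f v"
    using continuous_attains_sup by (metis (no_types, lifting))
  define l where "l = v \<bullet> f v"
  have vv: "v \<bullet> v = 1" using v by (simp add: dot_square_norm)
  have nonneg: "0 \<le> l * (y \<bullet> y) - y \<bullet> f y" if "y \<in> S" for y
  proof (cases "y = 0")
    case False
    have "(1 / norm y) *\<^sub>R y \<in> ?K" using that S False by (simp add: subspace_scale)
    from vmax[OF this] have "(y \<bullet> f y) / (norm y * norm y) \<le> l"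
      by (simp add: l_def linear_scale[OF f])
    then show ?thesis using False
      by (simp add: field_simps dot_square_norm power2_eq_square)
  qed (simp add: linear_0[OF f])
  have "w \<bullet> (l *\<^sub>R v - f v) = 0" if w: "w \<in> S" for w
  proof (rule ccontr)
    define b where "b = w \<bullet> (l *\<^sub>R v - f v)"
    define c where "c = l * (w \<bullet> w) - w \<bullet> f w"
    assume "w \<bullet> (l *\<^sub>R v - f v) \<noteq> 0"
    then have b: "b \<noteq> 0" by (simp add: b_def)
    have c: "c \<ge> 0" using nonneg[OF w] by (simp add: c_def)
    have vfw: "v \<bullet> f w = w \<bullet> f v" using sa[of v w] by (simp add: inner_commute)
    \<comment> \<open>The form l |y|^2 - y . f y is nonnegative on \<open>S\<close> and vanishes at
      \<open>v\<close>, so along \<open>v + t w\<close> it is a quadratic in \<open>t\<close>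
      without constant term. Staying nonnegative forces its linear coefficient to be 0.\<close>
    have q: "0 \<le> 2 * t * b + t\<^sup>2 * c" for t
    proof -
      have "v + t *\<^sub>R w \<in> S" using v w S by (simp add: subspace_add subspace_scale)
      from nonneg[OF this] show ?thesis
        by (simp add: linear_add[OF f] linear_scale[OF f] inner_add_left inner_add_right b_def c_def
            inner_diff_right vfw vv l_def[symmetric] inner_commute[of v w]
            power2_eq_square algebra_simps)
    qed
    \<comment> \<open>The denominator is \<open>c + 1\<close> instead of \<open>c\<close>, the
      choice for the exact minimiser, because \<open>c\<close> may be 0.\<close>
    have "2 * (- b / (c + 1)) * b + (- b / (c + 1))\<^sup>2 * c = - (b\<^sup>2 * (c + 2)) / (c + 1)\<^sup>2"
      using c by (simp add: power2_eq_square divide_simps) (simp add: algebra_simps)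
    moreover have "b\<^sup>2 * (c + 2) / (c + 1)\<^sup>2 > 0" using b c by simp
    ultimately show False using q[of "- b / (c + 1)"] by simp
  qed
  moreover have "l *\<^sub>R v - f v \<in> S"
    using v inv S by (auto intro!: subspace_diff subspace_scale)
  ultimately have "f v = l *\<^sub>R v" by (metis eq_iff_diff_eq_0 inner_eq_zero_iff)
  with v show ?thesis using that by auto
qed

text \<open>Induction on the dimension: by self-adjointness the part of \<open>S\<close> orthogonal
  to an eigenvector is again invariant. Invariant subspaces appear in the statement because the
  induction leaves the full space.\<close>

lemma self_adjoint_orthonormal_eigenbasis:
  fixes f :: "'a::euclidean_space \<Rightarrow> 'a"
  assumes f: "linear f" and sa: "\<And>x y. f x \<bullet> y = x \<bullet> f y"
    and S: "subspace S" and inv: "f ` S \<subseteq> S"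
  shows "\<exists>B. pairwise orthogonal B \<and> (\<forall>b\<in>B. norm b = 1 \<and> (\<exists>l. f b = l *\<^sub>R b)) \<and> span B = S"
  using S inv
proof (induction "dim S" arbitrary: S rule: less_induct)
  case less
  show ?case
  proof (cases "S = {0}")
    case True
    then show ?thesis by (intro exI[of _ "{}"]) auto
  next
    case False
    then obtain v l where v: "v \<in> S" "norm v = 1" "f v = l *\<^sub>R v"
      using self_adjoint_eigenvector[OF f sa less.prems(1) _ less.prems(2)] by blast
    have vv: "v \<bullet> v = 1" using v by (simp add: dot_square_norm)
    define S' where "S' = {x \<in> S. v \<bullet> x = 0}"
    have S': "subspace S'"
      using less.prems(1) by (auto simp: S'_def subspace_def inner_add_right)
    have "v \<notin> S'" using vv by (simp add: S'_def)
    moreover have "S' \<subseteq> S" by (auto simp: S'_def)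
    ultimately have "S' \<subset> S" using v by blast
    then have "dim S' < dim S"
      using S' less.prems(1) dim_psubset[of S' S] span_eq_iff by metis
    moreover have "f ` S' \<subseteq> S'"
      using less.prems(2) v(3) by (auto simp: S'_def simp flip: sa)
    ultimately obtain B where B: "pairwise orthogonal B" "span B = S'"
      "\<forall>b\<in>B. norm b = 1 \<and> (\<exists>l. f b = l *\<^sub>R b)"
      using less.hyps S' by blast
    have BS: "B \<subseteq> S'" using B(2) span_superset by blast
    have "pairwise orthogonal (insert v B)"
      using B(1) BS by (auto simp: pairwise_insert S'_def orthogonal_def inner_commute)
    moreover have "span (insert v B) = S"
    proof
      show "span (insert v B) \<subseteq> S"
        using v BS less.prems(1) by (intro span_minimal) (auto simp: S'_def)
      show "S \<subseteq> span (insert v B)"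
      proof
        fix x assume x: "x \<in> S"
        have "x - (v \<bullet> x) *\<^sub>R v \<in> S'"
          using x v vv less.prems(1)
          by (auto simp: S'_def inner_diff_right intro!: subspace_diff subspace_scale)
        then show "x \<in> span (insert v B)"
          using B(2) by (auto simp: span_insert)
      qed
    qed
    ultimately show ?thesis using B(3) v by (intro exI[of _ "insert v B"]) auto
  qed
qed

section \<open>Diagonal matrices and orthogonal diagonalisation\<close>

definition diagonal :: "('n \<Rightarrow> real) \<Rightarrow> real^'n^'n" where
  "diagonal d = (\<chi> i j. if i = j then d i else 0)"

lemma diagonal_1: "diagonal (\<lambda>i. 1) = mat 1"
  by (simp add: diagonal_def mat_def)

lemma transpose_diagonal: "transpose (diagonal d) = diagonal d"
  by (auto simp: diagonal_def transpose_def vec_eq_iff)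

lemma det_diagonal_prod: "det (diagonal d) = prod d UNIV"
  by (subst det_diagonal) (auto simp: diagonal_def)

lemma diagonal_matrix_mult: "(diagonal d ** A) $ i $ j = d i * A $ i $ j"
  by (simp add: diagonal_def matrix_matrix_mult_def mult_delta_left sum.delta)

lemma matrix_diagonal_mult: "(A ** diagonal d) $ i $ j = A $ i $ j * d j"
  by (simp add: diagonal_def matrix_matrix_mult_def mult_delta_right sum.delta')

lemma diagonal_mult: "diagonal d ** diagonal e = diagonal (\<lambda>i. d i * e i)"
  by (simp add: vec_eq_iff diagonal_matrix_mult) (simp add: diagonal_def)

lemma diagonal_vector_mult: "(diagonal d *v x) $ i = d i * x $ i"
  by (simp add: diagonal_def matrix_vector_mult_def mult_delta_left sum.delta)

lemma inner_matrix_transpose: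
  fixes A :: "real^'n^'m"
  shows "x \<bullet> (A *v y) = (transpose A *v x) \<bullet> y"
  by (simp add: dot_lmul_matrix)

lemma inner_conjugate:
  fixes k m :: "real^'n^'n"
  shows "x \<bullet> ((transpose k ** m ** k) *v x) = (k *v x) \<bullet> (m *v (k *v x))"
proof -
  have "(transpose k ** m ** k) *v x = transpose k *v (m *v (k *v x))"
    by (simp only: matrix_vector_mul_assoc matrix_mul_assoc)
  then show ?thesis by (simp only: inner_matrix_transpose transpose_transpose)
qed

lemma sym_mat_spectral:
  assumes "s \<in> (sym_mat :: (real^'n^'n) set)"
  obtains k d where "orthogonal_matrix k" "s = transpose k ** diagonal d ** k"
proof -
  have ts: "transpose s = s" using assms by (simp add: sym_mat_def)
  have "(s *v x) \<bullet> y = x \<bullet> (s *v y)" for x y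
    by (simp add: inner_matrix_transpose ts)
  then obtain B where B: "pairwise orthogonal B" "span B = UNIV"
    "\<forall>b\<in>B. norm b = 1 \<and> (\<exists>l. s *v b = l *\<^sub>R b)"
    using self_adjoint_orthonormal_eigenbasis[of "(*v) s" UNIV] by auto
  have "0 \<notin> B" using B(3) by auto
  then have ind: "independent B" using B(1) pairwise_orthogonal_independent by blast
  then have "card B = CARD('n)"
    using B(2) by (metis dim_UNIV dim_eq_card_independent dim_span DIM_cart DIM_real mult.right_neutral)
  moreover have "finite B" using ind independent_imp_finite by blast
  ultimately obtain e where e: "bij_betw e (UNIV :: 'n set) B"
    using finite_same_card_bij[of "UNIV :: 'n set" B] by auto
  then have eB: "e i \<in> B" for i by (auto simp: bij_betw_def)
  then have "\<forall>i. \<exists>l. s *v e i = l *\<^sub>R e i" using B(3) by blast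
  then obtain d where d: "\<And>i. s *v e i = d i *\<^sub>R e i" by metis
  \<comment> \<open>The eigenvectors are the rows of \<open>k\<close>, which gives
    \<open>k ** s = diagonal d ** k\<close> and puts the transpose on the left in the
    decomposition.\<close>
  define k where "k = (\<chi> i. e i)"
  have rk: "Finite_Cartesian_Product.row i k = e i" for i
    by (simp add: k_def Finite_Cartesian_Product.row_def vec_eq_iff)
  have "orthogonal_matrix k"
    unfolding orthogonal_matrix_orthonormal_rows rk
    using B(1,3) eB e unfolding bij_betw_def pairwise_def inj_on_def by blast
  moreover have "k ** s = diagonal d ** k"
  proof -
    have "(k ** s) $ i $ j = (s *v e i) $ j" for i j
      using ts unfolding transpose_def
      by (simp add: k_def matrix_matrix_mult_def matrix_vector_mult_def vec_eq_iff mult.commute)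
    then show ?thesis by (simp add: vec_eq_iff diagonal_matrix_mult d) (simp add: k_def)
  qed
  then have "transpose k ** diagonal d ** k = s" if "transpose k ** k = mat 1"
    using that by (metis matrix_mul_assoc matrix_mul_lid)
  ultimately show ?thesis using that orthogonal_matrix by metis
qed

lemma orthogonal_conjugate_pos_def:
  assumes k: "orthogonal_matrix (k :: real^'n^'n)" and d: "\<And>i. d i > 0"
  shows "transpose k ** diagonal d ** k \<in> pos_def"
proof -
  have "x \<bullet> ((transpose k ** diagonal d ** k) *v x) > 0" if "x \<noteq> 0" for x
  proof -
    define y where "y = k *v x"
    have "y \<noteq> 0"
      using k that unfolding y_def orthogonal_matrix
      by (metis matrix_vector_mul_assoc matrix_vector_mul_lid matrix_vector_mult_0_right)
    then obtain i where "y $ i \<noteq> 0" by (auto simp: vec_eq_iff)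
    then have "(\<Sum>i\<in>UNIV. d i * (y $ i)\<^sup>2) > 0"
      using d by (intro sum_pos2[of _ i]) (auto intro!: mult_nonneg_nonneg less_imp_le[OF d])
    moreover have "x \<bullet> ((transpose k ** diagonal d ** k) *v x) = y \<bullet> (diagonal d *v y)"
      by (simp only: y_def inner_conjugate)
    ultimately show ?thesis
      by (simp add: inner_vec_def diagonal_vector_mult power2_eq_square algebra_simps)
  qed
  then show ?thesis
    by (simp add: pos_def_def sym_mat_def matrix_transpose_mul transpose_diagonal matrix_mul_assoc)
qed

lemma pos_def_spectral:
  assumes "s \<in> (pos_def :: (real^'n^'n) set)"
  obtains k d where "orthogonal_matrix k" "\<And>i. d i > 0" "s = transpose k ** diagonal d ** k"
proof -
  obtain k d where k: "orthogonal_matrix k" and s: "s = transpose k ** diagonal d ** k"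
    using assms sym_mat_spectral unfolding pos_def_def by blast
  have "d i > 0" for i
  proof -
    \<comment> \<open>The eigenvector belonging to \<open>d i\<close>, where the quadratic form
      takes the value \<open>d i\<close>.\<close>
    define x where "x = transpose k *v axis i 1"
    have kx: "k *v x = axis i 1"
      using k by (simp add: x_def matrix_vector_mul_assoc orthogonal_matrix_def
          del: transpose_matrix_vector)
    then have "x \<noteq> 0" by auto
    then have "0 < x \<bullet> (s *v x)" using assms by (simp add: pos_def_def)
    also have "x \<bullet> (s *v x) = (k *v x) \<bullet> (diagonal d *v (k *v x))"
      by (simp only: s inner_conjugate)
    also have "\<dots> = d i" by (simp add: kx inner_axis' diagonal_vector_mult)
    finally show ?thesis .
  qed
  with k s that show ?thesis by blast
qed

lemma det_orthogonal_conjugate: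
  assumes "orthogonal_matrix (k :: real^'n^'n)"
  shows "det (transpose k ** diagonal d ** k) = prod d UNIV"
  using det_orthogonal_matrix[OF assms] by (auto simp: det_mul det_diagonal_prod)

lemma pos_def_det_pos:
  assumes "s \<in> pos_def"
  shows "det s > 0"
proof -
  obtain k d where "orthogonal_matrix k" "\<And>i. d i > 0" "s = transpose k ** diagonal d ** k"
    using pos_def_spectral[OF assms] by blast
  then show ?thesis by (simp add: det_orthogonal_conjugate prod_pos)
qed

lemma orthogonal_conjugate_mult:
  assumes k: "orthogonal_matrix (k :: real^'n^'n)"
  shows "(transpose k ** diagonal d ** k) ** (transpose k ** diagonal e ** k)
    = transpose k ** diagonal (\<lambda>i. d i * e i) ** k"
proof -
  have "(transpose k ** diagonal d ** k) ** (transpose k ** diagonal e ** k)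
    = transpose k ** diagonal d ** (k ** transpose k) ** diagonal e ** k"
    by (simp add: matrix_mul_assoc)
  also have "\<dots> = transpose k ** (diagonal d ** diagonal e) ** k"
    using k by (simp add: matrix_mul_assoc orthogonal_matrix_def)
  finally show ?thesis by (simp add: diagonal_mult)
qed

text \<open>One diagonalisation yields the square root and its inverse together. Later arguments
  carry this pair, with its two product equations, in place of a matrix inverse.\<close>

lemma pos_def_root:
  assumes "s \<in> (pos_def :: (real^'n^'n) set)"
  obtains r c where "r \<in> pos_def" "c \<in> pos_def" "r ** r = s" "r ** c = mat 1" "c ** r = mat 1"
proof -
  obtain k d where k: "orthogonal_matrix k" and d: "\<And>i. d i > 0"
    and s: "s = transpose k ** diagonal d ** k"
    using pos_def_spectral[OF assms] by blast
  define r where "r = transpose k ** diagonal (\<lambda>i. sqrt (d i)) ** k"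
  define c where "c = transpose k ** diagonal (\<lambda>i. 1 / sqrt (d i)) ** k"
  have dn: "d i \<noteq> 0" "d i \<ge> 0" for i using d[of i] by auto
  have "r \<in> pos_def" "c \<in> pos_def"
    unfolding r_def c_def using d by (auto intro!: orthogonal_conjugate_pos_def k)
  moreover have "r ** r = s" "r ** c = mat 1" "c ** r = mat 1"
    using k unfolding r_def c_def s orthogonal_conjugate_mult[OF k]
    by (simp_all add: dn diagonal_1 orthogonal_matrix)
  ultimately show ?thesis using that by blast
qed

section \<open>Determinants of endomorphisms of a subspace\<close>

text \<open>Generalises \<open>matrix_wrt\<close> to different bases for source and target, so that
  a change of basis is the matrix of the identity and composition is matrix multiplication.\<close>

definition rep_mat :: "'a::real_vector list \<Rightarrow> 'a list \<Rightarrow> ('a \<Rightarrow> 'a) \<Rightarrow> real Matrix.mat" where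
  "rep_mat bs cs T = Matrix.mat (length bs) (length cs)
     (\<lambda>(i, j). representation (set bs) (T (cs ! j)) (bs ! i))"

lemma matrix_wrt_rep_mat: "matrix_wrt bs T = rep_mat bs bs T"
  by (simp add: matrix_wrt_def rep_mat_def)

lemma rep_mat_carrier: "rep_mat bs cs T \<in> carrier_mat (length bs) (length cs)"
  by (simp add: rep_mat_def)

lemma is_basis_list_length: "is_basis_list V bs \<Longrightarrow> length bs = dim V"
  unfolding is_basis_list_def by (metis dim_eq_card_independent dim_span distinct_card)

lemma is_basis_list_nth: "is_basis_list V bs \<Longrightarrow> i < length bs \<Longrightarrow> bs ! i \<in> V"
  unfolding is_basis_list_def by (metis nth_mem span_base)

lemma is_basis_list_expand:
  assumes "is_basis_list V cs" "x \<in> V"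
  shows "x = (\<Sum>k<length cs. representation (set cs) x (cs ! k) *\<^sub>R cs ! k)"
proof -
  have "x = (\<Sum>c\<in>set cs. representation (set cs) x c *\<^sub>R c)"
    using assms by (subst sum_representation_eq[where B = "set cs"]) (auto simp: is_basis_list_def)
  also have "\<dots> = (\<Sum>k<length cs. representation (set cs) x (cs ! k) *\<^sub>R cs ! k)"
    using assms by (subst sum.reindex_bij_betw[symmetric, OF bij_betw_nth[of cs "{..<length cs}"]])
      (auto simp: is_basis_list_def)
  finally show ?thesis .
qed

lemma rep_mat_compose:
  assumes bs: "is_basis_list V bs" and cs: "is_basis_list V cs"
    and S: "linear S" "S ` V \<subseteq> V" and T: "\<And>x. x \<in> set ds \<Longrightarrow> T x \<in> V"
  shows "rep_mat bs ds (S \<circ> T) = rep_mat bs cs S * rep_mat cs ds T"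
proof (rule eq_matI)
  fix i j assume "i < dim_row (rep_mat bs cs S * rep_mat cs ds T)"
    and "j < dim_col (rep_mat bs cs S * rep_mat cs ds T)"
  then have i: "i < length bs" and j: "j < length ds" by (auto simp: rep_mat_def)
  let ?x = "T (ds ! j)"
  let ?r = "\<lambda>k. representation (set cs) ?x (cs ! k)"
  have ind: "independent (set bs)" and sp: "span (set bs) = V"
    using bs by (auto simp: is_basis_list_def)
  have x: "?x \<in> V" using T j by simp
  have SV: "S (cs ! k) \<in> span (set bs)" if "k < length cs" for k
    using S(2) is_basis_list_nth[OF cs that] sp by blast
  have "S ?x = (\<Sum>k<length cs. ?r k *\<^sub>R S (cs ! k))"
    by (subst is_basis_list_expand[OF cs x]) (simp add: linear_sum[OF S(1)] linear_scale[OF S(1)])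
  moreover have "representation (set bs) (\<Sum>k<length cs. ?r k *\<^sub>R S (cs ! k)) (bs ! i) =
      (\<Sum>k<length cs. representation (set bs) (?r k *\<^sub>R S (cs ! k)) (bs ! i))"
    using SV by (subst representation_sum[OF ind]) (auto intro: span_scale)
  moreover have "\<dots> = (\<Sum>k<length cs. ?r k * representation (set bs) (S (cs ! k)) (bs ! i))"
    using SV by (intro sum.cong) (simp_all add: representation_scale[OF ind])
  ultimately have "representation (set bs) (S ?x) (bs ! i) =
      (\<Sum>k<length cs. ?r k * representation (set bs) (S (cs ! k)) (bs ! i))"
    by simp
  then show "rep_mat bs ds (S \<circ> T) $$ (i, j) = (rep_mat bs cs S * rep_mat cs ds T) $$ (i, j)"
    using i j
    by (auto simp: rep_mat_def scalar_prod_def atLeast0LessThan mult.commute intro!: sum.cong)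
qed (simp_all add: rep_mat_def)

lemma rep_mat_id:
  assumes "is_basis_list V bs"
  shows "rep_mat bs bs id = 1\<^sub>m (length bs)"
  using assms
  by (intro eq_matI)
     (auto simp: rep_mat_def is_basis_list_def representation_basis nth_eq_iff_index_eq)

text \<open>The matrices of the identity between \<open>bs\<close> and the basis picked by
  \<open>SOME\<close> are inverse to each other, so the two matrices of \<open>T\<close> are
  similar.\<close>

lemma endo_det_basis:
  assumes bs: "is_basis_list V bs" and T: "linear T" "T ` V \<subseteq> V"
  shows "endo_det V T = Determinant.det (matrix_wrt bs T)"
proof -
  define cs where "cs = (SOME bs. is_basis_list V bs)"
  have cs: "is_basis_list V cs" unfolding cs_def using bs by (rule someI)
  define n where "n = dim V"
  have len: "length bs = n" "length cs = n"
    using bs cs by (simp_all add: n_def is_basis_list_length)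
  have TV: "T x \<in> V" if "is_basis_list V ds" "x \<in> set ds" for x ds
    using T that by (auto simp: is_basis_list_def intro: span_base)
  have V: "x \<in> V" if "is_basis_list V ds" "x \<in> set ds" for x ds
    using that by (auto simp: is_basis_list_def intro: span_base)
  have "similar_mat (matrix_wrt cs T) (matrix_wrt bs T)"
  proof (rule similar_matI)
    show "{matrix_wrt cs T, matrix_wrt bs T, rep_mat cs bs id, rep_mat bs cs id} \<subseteq> carrier_mat n n"
      using rep_mat_carrier[of cs cs T] rep_mat_carrier[of bs bs T] rep_mat_carrier[of cs bs id]
        rep_mat_carrier[of bs cs id] len by (simp add: matrix_wrt_rep_mat)
    have "rep_mat cs cs id = rep_mat cs bs id * rep_mat bs cs id"
      using rep_mat_compose[OF cs bs, of id cs id] V[OF cs] by (simp add: linear_id)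
    then show "rep_mat cs bs id * rep_mat bs cs id = 1\<^sub>m n"
      using rep_mat_id[OF cs] len by simp
    have "rep_mat bs bs id = rep_mat bs cs id * rep_mat cs bs id"
      using rep_mat_compose[OF bs cs, of id bs id] V[OF bs] by (simp add: linear_id)
    then show "rep_mat bs cs id * rep_mat cs bs id = 1\<^sub>m n"
      using rep_mat_id[OF bs] len by simp
    have "rep_mat cs cs T = rep_mat cs bs id * rep_mat bs cs T"
      using rep_mat_compose[OF cs bs, of id cs T] TV[OF cs] by (simp add: linear_id)
    also have "rep_mat bs cs T = rep_mat bs bs T * rep_mat bs cs id"
      using rep_mat_compose[OF bs bs T, of cs id] V[OF cs] by simp
    also have "rep_mat cs bs id * (rep_mat bs bs T * rep_mat bs cs id)
        = rep_mat cs bs id * rep_mat bs bs T * rep_mat bs cs id"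
      using rep_mat_carrier len by (metis assoc_mult_mat)
    finally show "matrix_wrt cs T = rep_mat cs bs id * matrix_wrt bs T * rep_mat bs cs id"
      by (simp add: matrix_wrt_rep_mat)
  qed
  then show ?thesis
    unfolding endo_det_def cs_def[symmetric] by (rule det_similar)
qed

text \<open>Both determinants are read off in the same chosen basis, whose vectors lie in
  \<open>V\<close>. This lets the Fisher information be replaced by a formula that is established on
  symmetric arguments.\<close>

lemma endo_det_cong:
  assumes bs: "is_basis_list V bs" and eq: "\<And>x. x \<in> V \<Longrightarrow> S x = T x"
  shows "endo_det V S = endo_det V T"
proof -
  define cs where "cs = (SOME bs. is_basis_list V bs)"
  have cs: "is_basis_list V cs" unfolding cs_def using bs by (rule someI)
  have "matrix_wrt cs S = matrix_wrt cs T"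
    unfolding matrix_wrt_def by (rule cong_mat) (auto simp: eq is_basis_list_nth[OF cs])
  then show ?thesis unfolding endo_det_def cs_def[symmetric] by simp
qed

lemma endo_det_compose:
  assumes bs: "is_basis_list V bs" and S: "linear S" "S ` V \<subseteq> V" and T: "linear T" "T ` V \<subseteq> V"
  shows "endo_det V (S \<circ> T) = endo_det V S * endo_det V T"
proof -
  have "T x \<in> V" if "x \<in> set bs" for x
    using T bs that by (auto simp: is_basis_list_def intro: span_base)
  then have "matrix_wrt bs (S \<circ> T) = matrix_wrt bs S * matrix_wrt bs T"
    using rep_mat_compose[OF bs bs S] by (simp add: matrix_wrt_rep_mat)
  moreover have "linear (S \<circ> T)" "(S \<circ> T) ` V \<subseteq> V"
    using S T by (auto simp: linear_compose)
  ultimately show ?thesis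
    using S T by (simp add: endo_det_basis[OF bs] matrix_wrt_rep_mat
        det_mult[OF rep_mat_carrier rep_mat_carrier])
qed

lemma endo_det_eigenbasis:
  fixes V :: "'a::real_vector set"
  assumes B: "finite B" "independent B" "span B = V"
    and T: "linear T" and eig: "\<And>b. b \<in> B \<Longrightarrow> T b = l b *\<^sub>R b"
  shows "endo_det V T = prod l B"
proof -
  obtain bs where bs: "distinct bs" "set bs = B" using B finite_distinct_list by blast
  then have basis: "is_basis_list V bs" using B by (simp add: is_basis_list_def)
  have "T ` span B = span (T ` B)" by (rule linear_span_image[OF T, symmetric])
  also have "\<dots> \<subseteq> V"
    using B eig by (intro span_minimal) (auto simp: span_scale span_base)
  finally have TV: "T ` V \<subseteq> V" using B by simp
  have rep: "representation B (T b) = (\<lambda>v. l b * (if v = b then 1 else 0))" if "b \<in> B" for b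
    using that by (simp only: eig representation_scale[OF B(2) span_base] representation_basis[OF B(2)])
  have M: "matrix_wrt bs T = Matrix.mat (length bs) (length bs) (\<lambda>(i, j). if i = j then l (bs ! i) else 0)"
    unfolding matrix_wrt_def bs(2)
    by (rule cong_mat) (use bs(1) rep[folded bs(2)] in \<open>auto simp: bs(2)[symmetric] nth_eq_iff_index_eq\<close>)
  have "Determinant.det (matrix_wrt bs T) = prod_list (diag_mat (matrix_wrt bs T))"
    by (rule det_upper_triangular[where n = "length bs"]) (auto simp: M)
  also have "\<dots> = (\<Prod>i<length bs. l (bs ! i))"
    by (simp add: prod_list_diag_prod M atLeast0LessThan)
  also have "\<dots> = prod l B"
    using bs bij_betw_nth[of bs "{..<length bs}" B] by (subst prod.reindex_bij_betw) auto
  finally show ?thesis using endo_det_basis[OF basis T TV] by simp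
qed

lemma endo_det_indexed_eigenbasis:
  fixes V :: "'a::real_vector set"
  assumes I: "finite I" "inj_on b I" "independent (b ` I)" "span (b ` I) = V"
    and T: "linear T" and eig: "\<And>i. i \<in> I \<Longrightarrow> T (b i) = l i *\<^sub>R b i"
  shows "endo_det V T = prod l I"
proof -
  have "endo_det V T = prod (l \<circ> inv_into I b) (b ` I)"
    using I T eig by (intro endo_det_eigenbasis) auto
  also have "\<dots> = prod l I"
    using I by (subst prod.reindex) (auto intro: prod.cong)
  finally show ?thesis .
qed

section \<open>Determinants on the space of symmetric matrices\<close>

lemma subspace_sym_mat: "subspace sym_mat"
  by (auto simp: subspace_def sym_mat_def transpose_def vec_eq_iff)

text \<open>E_ij + E_ji off the diagonal and E_ii on it. These are common eigenvectors of all maps v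
  \<mapsto> D v D with D diagonal.\<close>

definition sym_unit :: "'n \<times> 'n \<Rightarrow> real^'n^'n" where
  "sym_unit = (\<lambda>(i, j). \<chi> a b. if (a, b) = (i, j) \<or> (a, b) = (j, i) then 1 else 0)"

lemma sym_unit_nth: "sym_unit (i, j) $ a $ b = (if a = i \<and> b = j \<or> a = j \<and> b = i then 1 else 0)"
  by (simp add: sym_unit_def)

text \<open>The injection \<open>h\<close> stands in for a linear order on the index type, and
  \<open>K\<close> keeps one ordered pair for each unordered one. Distinct basis elements have
  disjoint supports, hence are orthogonal and independent.\<close>

lemma sym_unit_basis:
  fixes h :: "'n::finite \<Rightarrow> nat"
  assumes h: "inj h"
  defines "K \<equiv> {(i, j). h i \<le> h j}"
  shows "inj_on sym_unit K" "independent (sym_unit ` K)" "span (sym_unit ` K) = sym_mat"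
proof -
  have K: "(a, b) \<in> K \<or> (b, a) \<in> K" for a b by (auto simp: K_def)
  have uniq: "x = y" if "x \<in> K" "y \<in> K" "x = (a, b) \<or> x = (b, a)" "y = (a, b) \<or> y = (b, a)" for x y a b
    using that h by (auto simp: K_def inj_eq dest: le_antisym)
  have disj: "x = y" if "x \<in> K" "y \<in> K" "sym_unit x $ a $ b \<noteq> 0" "sym_unit y $ a $ b \<noteq> 0" for x y a b
    using uniq[OF that(1,2), of a b] that(3,4) by (cases x; cases y) (auto simp: sym_unit_nth split: if_splits)
  have nz: "\<exists>a b. sym_unit x $ a $ b \<noteq> 0" for x :: "'n \<times> 'n"
    by (cases x) (auto simp: sym_unit_nth)
  show inj: "inj_on sym_unit K"
    using disj nz by (metis inj_onI)
  have "orthogonal (sym_unit x) (sym_unit y)" if "x \<in> K" "y \<in> K" "x \<noteq> y" for x y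
    using disj[OF that(1,2)] that(3) unfolding orthogonal_def inner_vec_def
    by (intro sum.neutral ballI) (metis inner_real_def mult_eq_0_iff)
  then have "pairwise orthogonal (sym_unit ` K)" by (auto simp: pairwise_def)
  moreover have "0 \<notin> sym_unit ` K" using nz by (metis imageE zero_index)
  ultimately show "independent (sym_unit ` K)" using pairwise_orthogonal_independent by blast
  show "span (sym_unit ` K) = sym_mat"
  proof
    have "sym_unit x \<in> sym_mat" for x :: "'n \<times> 'n"
      by (cases x) (auto simp: sym_mat_def transpose_def vec_eq_iff sym_unit_nth)
    then show "span (sym_unit ` K) \<subseteq> sym_mat"
      by (intro span_minimal subspace_sym_mat) auto
    show "sym_mat \<subseteq> span (sym_unit ` K)"
    proof
      fix v :: "real^'n^'n" assume v: "v \<in> sym_mat"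
      have sv: "v $ a $ b = v $ b $ a" for a b
        using v unfolding sym_mat_def transpose_def by (auto simp: vec_eq_iff)
      have "(\<Sum>x\<in>K. v $ fst x $ snd x *\<^sub>R sym_unit x) $ a $ b = v $ a $ b" for a b
      proof -
        obtain y where y: "y \<in> K" "y = (a, b) \<or> y = (b, a)" using K by blast
        have "(\<Sum>x\<in>K. v $ fst x $ snd x *\<^sub>R sym_unit x) $ a $ b
            = (\<Sum>x\<in>K. if x = y then v $ a $ b else 0)"
          unfolding sum_component
        proof (rule sum.cong)
          fix x assume "x \<in> K"
          then show "(v $ fst x $ snd x *\<^sub>R sym_unit x) $ a $ b = (if x = y then v $ a $ b else 0)"
            using uniq[of x y a b] y sv by (cases x) (auto simp: sym_unit_nth)
        qed simp
        also have "\<dots> = v $ a $ b" using y by simp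
        finally show ?thesis .
      qed
      then have "v = (\<Sum>x\<in>K. v $ fst x $ snd x *\<^sub>R sym_unit x)" by (simp add: vec_eq_iff)
      also have "\<dots> \<in> span (sym_unit ` K)" by (intro span_sum span_scale span_base) auto
      finally show "v \<in> span (sym_unit ` K)" .
    qed
  qed
qed

text \<open>An index i occurs once as first entry for every j above it and once as second entry for
  every j below it. The pair (i, i) counts twice, which makes n + 1 occurrences; this is the origin
  of the exponent of the determinant of \<open>\<sigma>\<close>.\<close>

lemma prod_ordered_pairs:
  fixes h :: "'n::finite \<Rightarrow> nat" and d :: "'n \<Rightarrow> 'a::comm_semiring_1"
  assumes h: "inj h"
  shows "(\<Prod>x\<in>{(i, j). h i \<le> h j}. d (fst x) * d (snd x)) = prod d UNIV ^ (CARD('n) + 1)"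
proof -
  let ?K = "{(i, j). h i \<le> h j}"
  have "(\<Prod>x\<in>?K. d (fst x)) = (\<Prod>x\<in>Sigma UNIV (\<lambda>i. {j. h i \<le> h j}). d (fst x))"
    by (rule prod.cong) auto
  also have "\<dots> = (\<Prod>i\<in>UNIV. d i ^ card {j. h i \<le> h j})"
    by (subst prod.Sigma[symmetric, where g = "\<lambda>i j. d i", simplified split_def]) auto
  finally have 1: "(\<Prod>x\<in>?K. d (fst x)) = (\<Prod>i\<in>UNIV. d i ^ card {j. h i \<le> h j})" .
  have "(\<Prod>x\<in>?K. d (snd x)) = (\<Prod>x\<in>Sigma UNIV (\<lambda>i. {j. h j \<le> h i}). d (fst x))"
    by (rule prod.reindex_bij_witness[of _ prod.swap prod.swap]) auto
  also have "\<dots> = (\<Prod>i\<in>UNIV. d i ^ card {j. h j \<le> h i})"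
    by (subst prod.Sigma[symmetric, where g = "\<lambda>i j. d i", simplified split_def]) auto
  finally have 2: "(\<Prod>x\<in>?K. d (snd x)) = (\<Prod>i\<in>UNIV. d i ^ card {j. h j \<le> h i})" .
  have "card {j. h i \<le> h j} + card {j. h j \<le> h i} = CARD('n) + 1" for i
  proof -
    have "{j. h i \<le> h j} \<union> {j. h j \<le> h i} = UNIV" by auto
    moreover have "{j. h i \<le> h j} \<inter> {j. h j \<le> h i} = {i}"
      using h by (auto simp: inj_eq dest: le_antisym)
    ultimately show ?thesis using card_Un_Int[of "{j. h i \<le> h j}" "{j. h j \<le> h i}"] by simp
  qed
  then have "(\<Prod>i\<in>UNIV. d i ^ card {j. h i \<le> h j}) * (\<Prod>i\<in>UNIV. d i ^ card {j. h j \<le> h i})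
      = (\<Prod>i\<in>UNIV. d i ^ (CARD('n) + 1))"
    by (simp only: prod.distrib[symmetric] power_add[symmetric])
  then show ?thesis by (simp only: prod.distrib 1 2 prod_power_distrib)
qed

text \<open>Taking all factors equal to 2 in the preceding product and comparing exponents counts
  the pairs.\<close>

lemma card_ordered_pairs:
  fixes h :: "'n::finite \<Rightarrow> nat"
  assumes "inj h"
  shows "card {(i, j). h i \<le> h j} = CARD('n) * (CARD('n) + 1) div 2"
proof -
  have "(2::nat) ^ (2 * card {(i, j). h i \<le> h j}) = 2 ^ (CARD('n) * (CARD('n) + 1))"
    using prod_ordered_pairs[OF assms, of "\<lambda>_. 2::nat"]
    by (simp only: prod_constant power_mult power2_eq_square)
  then show ?thesis by (subst (asm) power_inject_exp) auto
qed

lemma sym_mat_basis_list: "\<exists>bs. is_basis_list (sym_mat :: (real^'n^'n) set) bs"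
proof -
  obtain h :: "'n \<Rightarrow> nat" where h: "inj h"
    using finite_imp_inj_to_nat_seg[of "UNIV :: 'n set"] by auto
  have "finite (sym_unit ` {(i, j). h i \<le> h j})" by simp
  then obtain bs where "set bs = sym_unit ` {(i, j). h i \<le> h j}" "distinct bs"
    using finite_distinct_list by metis
  then show ?thesis
    using sym_unit_basis[OF h] by (auto simp: is_basis_list_def)
qed

lemma dim_sym_mat: "dim (sym_mat :: (real^'n^'n) set) = CARD('n) * (CARD('n) + 1) div 2"
proof -
  obtain h :: "'n \<Rightarrow> nat" where h: "inj h"
    using finite_imp_inj_to_nat_seg[of "UNIV :: 'n set"] by auto
  show ?thesis
    using sym_unit_basis[OF h] card_ordered_pairs[OF h]
    by (metis (no_types, lifting) card_image dim_eq_card_independent dim_span)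
qed

lemma linear_congruence: "linear (\<lambda>v :: real^'n^'n. a ** v ** b)"
  by (rule linearI) (simp_all add: vec_eq_iff matrix_matrix_mult_def algebra_simps sum.distrib
      sum_distrib_left sum_distrib_right)

lemma congruence_sym_mat: "(\<lambda>v. transpose k ** v ** k) ` sym_mat \<subseteq> sym_mat"
  by (auto simp: sym_mat_def matrix_transpose_mul matrix_mul_assoc)

text \<open>Conjugation by the orthogonal \<open>k\<close> reduces the map to v \<mapsto> D v D with
  D diagonal, whose eigenvalues are the products \<open>d i * d j\<close>. The two conjugating maps
  are inverse to each other, so their determinants cancel.\<close>

lemma endo_det_congruence:
  assumes c: "c \<in> (pos_def :: (real^'n^'n) set)"
  shows "endo_det sym_mat (\<lambda>v. c ** v ** c) = det c ^ (CARD('n) + 1)"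
proof -
  obtain k d where k: "orthogonal_matrix k" and c: "c = transpose k ** diagonal d ** k"
    using pos_def_spectral[OF c] by metis
  obtain bs where bs: "is_basis_list (sym_mat :: (real^'n^'n) set) bs"
    using sym_mat_basis_list by blast
  obtain h :: "'n \<Rightarrow> nat" where h: "inj h"
    using finite_imp_inj_to_nat_seg[of "UNIV :: 'n set"] by auto
  let ?K = "{(i, j). h i \<le> h j}"
  define L where "L v = transpose k ** v ** k" for v
  define L' where "L' v = k ** v ** transpose k" for v
  define P where "P v = diagonal d ** v ** diagonal d" for v
  have lin: "linear L" "linear L'" "linear P"
    by (simp_all add: L_def[abs_def] L'_def[abs_def] P_def[abs_def] linear_congruence)
  have sub: "L ` sym_mat \<subseteq> sym_mat" "L' ` sym_mat \<subseteq> sym_mat" "P ` sym_mat \<subseteq> sym_mat"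
    using congruence_sym_mat[of k] congruence_sym_mat[of "transpose k"] congruence_sym_mat[of "diagonal d"]
    by (simp_all add: L_def[abs_def] L'_def[abs_def] P_def[abs_def] transpose_diagonal)
  have LL: "L \<circ> L' = id"
    using k by (auto simp: fun_eq_iff L_def L'_def orthogonal_matrix matrix_mul_assoc)
      (metis matrix_mul_assoc matrix_mul_rid)
  have "endo_det (sym_mat :: (real^'n^'n) set) id = prod (\<lambda>_. 1) ?K"
    using sym_unit_basis[OF h] by (intro endo_det_indexed_eigenbasis[where b = sym_unit]) (auto simp: linear_id)
  then have 1: "endo_det sym_mat L * endo_det sym_mat L' = 1"
    using endo_det_compose[OF bs lin(1) sub(1) lin(2) sub(2)] by (simp add: LL)
  have "P (sym_unit x) = (d (fst x) * d (snd x)) *\<^sub>R sym_unit x" for x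
    by (cases x) (auto simp: P_def vec_eq_iff matrix_diagonal_mult diagonal_matrix_mult sym_unit_nth)
  then have "endo_det sym_mat P = (\<Prod>x\<in>?K. d (fst x) * d (snd x))"
    using sym_unit_basis[OF h] lin(3) by (intro endo_det_indexed_eigenbasis) auto
  also have "\<dots> = det c ^ (CARD('n) + 1)"
    by (simp add: prod_ordered_pairs[OF h] c det_orthogonal_conjugate[OF k])
  finally have 2: "endo_det sym_mat P = det c ^ (CARD('n) + 1)" .
  have "(\<lambda>v. c ** v ** c) = L \<circ> (P \<circ> L')"
    by (simp add: fun_eq_iff c L_def L'_def P_def matrix_mul_assoc)
  moreover have "linear (P \<circ> L')" "(P \<circ> L') ` sym_mat \<subseteq> sym_mat"
    using lin sub by (auto intro: linear_compose)
  ultimately have "endo_det sym_mat (\<lambda>v. c ** v ** c)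
      = endo_det sym_mat L * (endo_det sym_mat P * endo_det sym_mat L')"
    using endo_det_compose[OF bs lin(1) sub(1), of "P \<circ> L'"]
      endo_det_compose[OF bs lin(3) sub(3) lin(2) sub(2)] by simp
  then show ?thesis using 1 2 by (simp add: algebra_simps)
qed

lemma trace_inner: "trace (transpose u ** v) = u \<bullet> (v :: real^'n^'n)"
  unfolding trace_def matrix_matrix_mult_def transpose_def inner_vec_def
  by simp (rule sum.swap)

lemma trace_scaleR: "trace (a *\<^sub>R v :: real^'n^'n) = a * trace v"
  by (simp add: trace_def sum_distrib_left)

lemma linear_trace_shift: "linear (\<lambda>v :: real^'n^'n. a *\<^sub>R v - (b * trace v) *\<^sub>R mat 1)"
  by (rule linearI) (simp_all add: trace_add trace_scaleR algebra_simps)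

lemma mat_1_sym_mat: "mat 1 \<in> sym_mat"
  by (simp add: sym_mat_def)

lemma endo_det_trace_shift:
  fixes a b :: real
  shows "endo_det (sym_mat :: (real^'n^'n) set) (\<lambda>v. a *\<^sub>R v - (b * trace v) *\<^sub>R mat 1)
    = a ^ (CARD('n) * (CARD('n) + 1) div 2 - 1) * (a - real CARD('n) * b)"
proof -
  define T where "T v = a *\<^sub>R v - (b * trace v) *\<^sub>R mat 1" for v :: "real^'n^'n"
  \<comment> \<open>For the inner product at hand, orthogonality to the identity means trace zero,
    so any orthogonal completion of \<open>mat 1\<close> within the symmetric matrices diagonalises
    \<open>T\<close>.\<close>
  obtain U where U: "U \<inter> insert 0 {mat 1} = {}" "pairwise orthogonal ({mat 1} \<union> U)"
    "span ({mat 1} \<union> U) = span ({mat 1} \<union> (sym_mat :: (real^'n^'n) set))"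
    using orthogonal_extension_strong[of "{mat 1}"] by (metis pairwise_singleton)
  let ?B = "insert (mat 1) U"
  have I: "(mat 1 :: real^'n^'n) \<noteq> 0" by (simp add: vec_eq_iff mat_def)
  have ind: "independent ?B"
    using U I by (intro pairwise_orthogonal_independent) auto
  have "{mat 1} \<union> sym_mat = (sym_mat :: (real^'n^'n) set)" using mat_1_sym_mat by blast
  moreover have "span (sym_mat :: (real^'n^'n) set) = sym_mat"
    using subspace_sym_mat by (simp only: span_eq_iff)
  ultimately have sp: "span ?B = sym_mat" using U(3) by simp
  have fin: "finite ?B" using ind by (rule independent_imp_finite)
  have "card ?B = dim (sym_mat :: (real^'n^'n) set)"
    using dim_eq_card_independent[OF ind] dim_span[of ?B] sp by simp
  then have card: "card U = CARD('n) * (CARD('n) + 1) div 2 - 1"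
    using U(1) fin dim_sym_mat[where 'n = 'n] by simp
  have "linear T"
    unfolding T_def by (rule linear_trace_shift)
  moreover have "T u = a *\<^sub>R u" if "u \<in> U" for u
  proof -
    have "mat 1 \<noteq> u" using that U(1) by blast
    then have "mat 1 \<bullet> u = 0"
      using U(2) that by (auto simp: pairwise_insert orthogonal_def)
    then have "trace u = 0" using trace_inner[of "mat 1" u] by simp
    then show ?thesis by (simp add: T_def)
  qed
  moreover have "T (mat 1) = (a - real CARD('n) * b) *\<^sub>R mat 1"
    by (simp add: T_def trace_I algebra_simps)
  ultimately have "endo_det sym_mat T
      = prod (\<lambda>v. if v = mat 1 then a - real CARD('n) * b else a) ?B"
    using U(1) by (intro endo_det_eigenbasis fin ind sp) auto
  also have "\<dots> = (a - real CARD('n) * b) * prod (\<lambda>v. if v = mat 1 then a - real CARD('n) * b else a) U"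
    using U(1) fin by (subst prod.insert) auto
  also have "prod (\<lambda>v. if v = mat 1 then a - real CARD('n) * b else a) U = prod (\<lambda>v. a) U"
    using U(1) by (intro prod.cong) auto
  finally show ?thesis by (simp add: card T_def[abs_def])
qed

section \<open>Linear substitutions in Lebesgue integrals\<close>

lemma borel_measurable_matrix_vector_mult[measurable (raw)]:
  fixes f :: "'a \<Rightarrow> real^'n^'m"
  assumes "f \<in> borel_measurable M" "g \<in> borel_measurable M"
  shows "(\<lambda>x. f x *v g x) \<in> borel_measurable M"
proof -
  have "continuous_on UNIV (\<lambda>z :: (real^'n^'m) \<times> (real^'n). fst z *v snd z)"
    unfolding matrix_vector_mult_def by (intro continuous_intros)
  then show ?thesis
    using borel_measurable_continuous_Pair[OF assms] by blast
qed

lemma borel_measurable_matrix_mult_right[measurable]: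
  "(\<lambda>x :: real^'n^'m. x ** (a :: real^'k^'n)) \<in> borel_measurable borel"
  by (intro borel_measurable_continuous_onI) (simp add: matrix_matrix_mult_def continuous_intros)

lemma nn_integral_exp_half_square: "(\<integral>\<^sup>+x. ennreal (exp (- x\<^sup>2 / 2)) \<partial>lborel) = ennreal (sqrt (2 * pi))"
proof -
  have "has_bochner_integral lborel (\<lambda>x. sqrt (2 * pi) * (std_normal_density x * x ^ (2 * 0))) (sqrt (2 * pi) * 1)"
    using std_normal_moment_even[of 0] by (intro has_bochner_integral_mult_right) simp
  then have "has_bochner_integral lborel (\<lambda>x::real. exp (- x\<^sup>2 / 2)) (sqrt (2 * pi))"
    by (simp add: std_normal_density_def)
  then show ?thesis
    by (subst nn_integral_eq_integral) (auto simp: has_bochner_integral_iff)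
qed

lemma exp_half_norm_square_prod:
  fixes x :: "'a::euclidean_space"
  shows "exp (- (norm x)\<^sup>2 / 2) = (\<Prod>b\<in>Basis. exp (- (x \<bullet> b)\<^sup>2 / 2))"
proof -
  have "(norm x)\<^sup>2 = (\<Sum>b\<in>Basis. (x \<bullet> b)\<^sup>2)"
    unfolding power2_norm_eq_inner by (subst euclidean_inner) (simp add: power2_eq_square)
  then show ?thesis
    by (simp add: exp_sum[symmetric] sum_negf sum_divide_distrib)
qed

lemma nn_integral_gaussian:
  "(\<integral>\<^sup>+x. ennreal (exp (- (norm (x::'a::euclidean_space))\<^sup>2 / 2)) \<partial>lborel) = ennreal (sqrt (2 * pi) ^ DIM('a))"
proof -
  have "ennreal (exp (- (norm (x::'a))\<^sup>2 / 2)) = (\<Prod>b\<in>Basis. ennreal (exp (- (x \<bullet> b)\<^sup>2 / 2)))" for x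
    unfolding exp_half_norm_square_prod by (rule prod_ennreal[symmetric]) simp
  then have "(\<integral>\<^sup>+x. ennreal (exp (- (norm (x::'a))\<^sup>2 / 2)) \<partial>lborel)
      = (\<Prod>b\<in>(Basis :: 'a set). \<integral>\<^sup>+x. ennreal (exp (- x\<^sup>2 / 2)) \<partial>lborel)"
    by (simp only:) (rule nn_integral_lborel_prod, simp_all)
  then show ?thesis by (simp only: nn_integral_exp_half_square prod_constant) (simp add: ennreal_power)
qed

lemma nn_integral_lborel_reflect:
  fixes a :: "'a::euclidean_space"
  assumes [measurable]: "f \<in> borel_measurable borel"
  shows "(\<integral>\<^sup>+x. f (a - x) \<partial>lborel) = (\<integral>\<^sup>+x. f x \<partial>lborel)"
proof -
  have "(\<integral>\<^sup>+x. f x \<partial>lborel) = (\<integral>\<^sup>+x. f x \<partial>density (distr lborel borel (\<lambda>x. a + (-1) *\<^sub>R x)) (\<lambda>_. \<bar>- 1 :: real\<bar> ^ DIM('a)))"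
    by (subst lborel_affine[of "-1" a]) simp_all
  also have "\<dots> = (\<integral>\<^sup>+x. f (a - x) \<partial>lborel)"
    by (subst nn_integral_density) (simp_all add: nn_integral_distr)
  finally show ?thesis by simp
qed

text \<open>Tonelli, applied to the convolution of \<open>g\<close> with a Gaussian, which the isometry leaves invariant.\<close>

lemma nn_integral_lborel_isometry:
  fixes T :: "'a::euclidean_space \<Rightarrow> 'a"
  assumes T: "linear T" and iso: "\<And>x. norm (T x) = norm x"
    and g [measurable]: "g \<in> borel_measurable borel"
  shows "(\<integral>\<^sup>+x. g (T x) \<partial>lborel) = (\<integral>\<^sup>+x. g x \<partial>lborel)"
proof -
  have [measurable]: "T \<in> borel_measurable borel"
    using T by (intro borel_measurable_continuous_onI linear_continuous_on)
      (simp add: linear_conv_bounded_linear)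
  define h where "h x = ennreal (exp (- (norm (x::'a))\<^sup>2 / 2))" for x
  have h [measurable]: "h \<in> borel_measurable borel" unfolding h_def by measurable
  define H where "H = (\<integral>\<^sup>+x. h x \<partial>lborel)"
  have "H = ennreal (sqrt (2 * pi) ^ DIM('a))" by (simp only: H_def h_def nn_integral_gaussian)
  \<comment> \<open>Being finite and nonzero, \<open>H\<close> can be cancelled at the end of the
    computation in [0, \<infinity>].\<close>
  then have H: "H \<noteq> 0" "H \<noteq> \<infinity>" by simp_all
  have hT: "h (T x) = h x" for x by (simp add: h_def iso)
  have "inj T" using T iso by (metis linear_injective_0 norm_eq_zero)
  then have "surj T" using T linear_injective_imp_surjective by blast
  have "(\<integral>\<^sup>+y. g (T y) \<partial>lborel) * H = (\<integral>\<^sup>+y. g (T y) * H \<partial>lborel)"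
    by (simp add: nn_integral_multc)
  also have "\<dots> = (\<integral>\<^sup>+y. (\<integral>\<^sup>+x. g (T y) * h (x - T y) \<partial>lborel) \<partial>lborel)"
  proof (rule nn_integral_cong)
    fix y
    have "H = (\<integral>\<^sup>+x. h (T y - x) \<partial>lborel)"
      unfolding H_def by (subst nn_integral_lborel_reflect) simp_all
    also have "\<dots> = (\<integral>\<^sup>+x. h (x - T y) \<partial>lborel)"
      by (simp add: h_def norm_minus_commute)
    finally show "g (T y) * H = (\<integral>\<^sup>+x. g (T y) * h (x - T y) \<partial>lborel)"
      by (simp add: nn_integral_cmult)
  qed
  also have "\<dots> = (\<integral>\<^sup>+x. (\<integral>\<^sup>+y. g (T y) * h (x - T y) \<partial>lborel) \<partial>lborel)"
    by (rule lborel_pair.Fubini') simp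
  also have "\<dots> = (\<integral>\<^sup>+x. (\<integral>\<^sup>+y. g (x - T y) * h (T y) \<partial>lborel) \<partial>lborel)"
  proof (rule nn_integral_cong)
    fix x
    \<comment> \<open>Since \<open>x - T y = T (a - y)\<close>, the reflection y \<mapsto> a - y
      exchanges the arguments of \<open>g\<close> and \<open>h\<close>.\<close>
    obtain a where a: "x = T a" using \<open>surj T\<close> by blast
    show "(\<integral>\<^sup>+y. g (T y) * h (x - T y) \<partial>lborel) = (\<integral>\<^sup>+y. g (x - T y) * h (T y) \<partial>lborel)"
      by (subst nn_integral_lborel_reflect[of _ a, symmetric]) (simp_all add: a linear_diff[OF T])
  qed
  also have "\<dots> = (\<integral>\<^sup>+y. (\<integral>\<^sup>+x. g (x - T y) * h (T y) \<partial>lborel) \<partial>lborel)"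
    by (rule lborel_pair.Fubini'[symmetric]) simp
  also have "\<dots> = (\<integral>\<^sup>+y. (\<integral>\<^sup>+x. g x \<partial>lborel) * h y \<partial>lborel)"
  proof (rule nn_integral_cong)
    fix y
    \<comment> \<open>A translation is the composition of two reflections, so invariance under
      reflections suffices.\<close>
    have "(\<integral>\<^sup>+x. g (x - T y) \<partial>lborel) = (\<integral>\<^sup>+x. g (0 - x - T y) \<partial>lborel)"
      by (rule nn_integral_lborel_reflect[symmetric]) simp
    also have "\<dots> = (\<integral>\<^sup>+x. g (0 - (T y + x)) \<partial>lborel)" by (simp add: algebra_simps)
    also have "\<dots> = (\<integral>\<^sup>+x. g (0 - (T y + (- T y - x))) \<partial>lborel)"
      by (rule nn_integral_lborel_reflect[symmetric]) simp
    finally have "(\<integral>\<^sup>+x. g (x - T y) \<partial>lborel) = (\<integral>\<^sup>+x. g x \<partial>lborel)" by simp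
    then show "(\<integral>\<^sup>+x. g (x - T y) * h (T y) \<partial>lborel) = (\<integral>\<^sup>+x. g x \<partial>lborel) * h y"
      by (simp add: nn_integral_multc hT)
  qed
  also have "\<dots> = (\<integral>\<^sup>+x. g x \<partial>lborel) * H"
    by (simp add: nn_integral_cmult H_def)
  finally show ?thesis using H by (metis mult_divide_eq_ennreal infinity_ennreal_def)
qed

lemma prod_Basis_vec: "prod f (Basis :: ('a::euclidean_space^'n) set) = (\<Prod>i\<in>UNIV. \<Prod>b\<in>Basis. f (axis i b))"
proof -
  have "Basis = (\<lambda>(i, b). axis i b) ` (UNIV \<times> (Basis :: 'a set))"
    by (auto simp: Basis_vec_def)
  moreover have "inj_on (\<lambda>(i :: 'n, b :: 'a). axis i b) (UNIV \<times> Basis)"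
    by (auto simp: inj_on_def axis_eq_axis)
  ultimately have "prod f (Basis :: ('a^'n) set) = prod (f \<circ> (\<lambda>(i, b). axis i b)) (UNIV \<times> Basis)"
    by (metis prod.reindex)
  then show ?thesis by (simp add: prod.cartesian_product split_def comp_def)
qed

text \<open>The scaling factors are packed into \<open>w\<close>, so that one statement serves
  vectors as well as matrices whose columns are scaled.\<close>

lemma nn_integral_lborel_coordinate_scale:
  fixes w :: "'a::euclidean_space"
  assumes w: "\<And>b. b \<in> Basis \<Longrightarrow> w \<bullet> b > 0" and T: "\<And>x b. b \<in> Basis \<Longrightarrow> T x \<bullet> b = (w \<bullet> b) * (x \<bullet> b)"
    and [measurable]: "g \<in> borel_measurable borel"
  shows "(\<integral>\<^sup>+x. g x \<partial>lborel) = ennreal (\<Prod>b\<in>Basis. w \<bullet> b) * (\<integral>\<^sup>+x. g (T x) \<partial>lborel)"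
proof -
  have Teq: "T = (\<lambda>x. 0 + (\<Sum>b\<in>Basis. ((w \<bullet> b) * (x \<bullet> b)) *\<^sub>R b))"
    by (rule ext, rule euclidean_eqI) (simp add: T)
  have "lborel = density (distr lborel borel T) (\<lambda>_. ennreal (\<Prod>b\<in>Basis. \<bar>w \<bullet> b\<bar>))"
    unfolding Teq using w by (intro lborel_affine_euclidean) force
  also have "(\<Prod>b\<in>Basis. \<bar>w \<bullet> b\<bar>) = (\<Prod>b\<in>Basis. w \<bullet> b)"
    using w by (intro prod.cong) (auto simp: less_imp_le)
  finally have "(\<integral>\<^sup>+x. g x \<partial>lborel) = (\<integral>\<^sup>+x. g x \<partial>density (distr lborel borel T) (\<lambda>_. ennreal (\<Prod>b\<in>Basis. w \<bullet> b)))"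
    by simp
  also have "\<dots> = ennreal (\<Prod>b\<in>Basis. w \<bullet> b) * (\<integral>\<^sup>+x. g (T x) \<partial>lborel)"
    by (simp add: Teq nn_integral_density nn_integral_distr nn_integral_cmult)
  finally show ?thesis .
qed

lemma norm_orthogonal_matrix: "orthogonal_matrix k \<Longrightarrow> norm (k *v x) = norm (x :: real^'n)"
  using orthogonal_transformation_matrix[of "(*v) k"] orthogonal_transformation_norm by fastforce

lemma norm_matrix_mult_orthogonal:
  assumes "orthogonal_matrix (k :: real^'n^'n)"
  shows "norm (x ** k) = norm (x :: real^'n^'m)"
proof -
  have "(x ** k) $ i = transpose k *v (x $ i)" for i
    by (simp add: vec_eq_iff matrix_matrix_mult_def matrix_vector_mult_def transpose_def mult.commute)
  moreover have "orthogonal_matrix (transpose k)" using assms by simp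
  ultimately show ?thesis
    unfolding norm_vec_def[of "x ** k"] norm_vec_def[of x]
    using norm_orthogonal_matrix by (metis (no_types, lifting))
qed

text \<open>Diagonalisation makes the substitution an isometry, a scaling of coordinates and an
  isometry. Only the scaling changes the measure, by the product of the eigenvalues.\<close>

lemma nn_integral_lborel_matrix_vector:
  fixes c :: "real^'n^'n"
  assumes c: "c \<in> pos_def" and [measurable]: "g \<in> borel_measurable borel"
  shows "(\<integral>\<^sup>+x. g x \<partial>lborel) = ennreal (det c) * (\<integral>\<^sup>+x. g (c *v x) \<partial>lborel)"
proof -
  obtain k d where k: "orthogonal_matrix k" and d: "\<And>i. d i > 0" and ceq: "c = transpose k ** diagonal d ** k"
    using pos_def_spectral[OF c] by metis
  have k': "orthogonal_matrix (transpose k)" using k by simp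
  have "(\<integral>\<^sup>+x. g x \<partial>lborel) = (\<integral>\<^sup>+x. g (transpose k *v x) \<partial>lborel)"
    using norm_orthogonal_matrix[OF k'] by (intro nn_integral_lborel_isometry[symmetric])
      (simp_all del: transpose_matrix_vector)
  also have "\<dots> = ennreal (\<Prod>b\<in>Basis. (\<chi> i. d i) \<bullet> b) * (\<integral>\<^sup>+x. g (transpose k *v (diagonal d *v x)) \<partial>lborel)"
    using d by (intro nn_integral_lborel_coordinate_scale)
      (auto simp: Basis_vec_def inner_axis diagonal_vector_mult simp del: transpose_matrix_vector)
  also have "(\<Prod>b\<in>Basis. (\<chi> i. d i) \<bullet> b) = det c"
    by (simp add: prod_Basis_vec inner_axis ceq det_orthogonal_conjugate[OF k])
  also have "(\<integral>\<^sup>+x. g (transpose k *v (diagonal d *v x)) \<partial>lborel)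
      = (\<integral>\<^sup>+x. g (transpose k *v (diagonal d *v (k *v x))) \<partial>lborel)"
    using norm_orthogonal_matrix[OF k] by (intro nn_integral_lborel_isometry[symmetric])
      (simp_all del: transpose_matrix_vector)
  finally show ?thesis by (simp only: ceq matrix_vector_mul_assoc matrix_mul_assoc)
qed

text \<open>Right multiplication acts separately on the \<open>CARD('m)\<close> rows of
  \<open>x\<close>, each of which contributes a factor \<open>det c\<close>.\<close>

lemma nn_integral_lborel_matrix_mult:
  fixes c :: "real^'n^'n" and g :: "real^'n^'m \<Rightarrow> ennreal"
  assumes c: "c \<in> pos_def" and [measurable]: "g \<in> borel_measurable borel"
  shows "(\<integral>\<^sup>+x. g x \<partial>lborel) = ennreal (det c ^ CARD('m)) * (\<integral>\<^sup>+x. g (x ** c) \<partial>lborel)"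
proof -
  obtain k d where k: "orthogonal_matrix k" and d: "\<And>i. d i > 0" and ceq: "c = transpose k ** diagonal d ** k"
    using pos_def_spectral[OF c] by metis
  have k': "orthogonal_matrix (transpose k)" using k by simp
  have lin: "linear (\<lambda>x :: real^'n^'m. x ** (a :: real^'n^'n))" for a
    by (rule linearI) (simp_all add: vec_eq_iff matrix_matrix_mult_def algebra_simps sum.distrib sum_distrib_left)
  have "(\<integral>\<^sup>+x. g x \<partial>lborel) = (\<integral>\<^sup>+x. g (x ** k) \<partial>lborel)"
    using norm_matrix_mult_orthogonal[OF k] by (intro nn_integral_lborel_isometry[symmetric] lin) simp_all
  also have "\<dots> = ennreal (\<Prod>b\<in>Basis. ((\<chi> i j. d j) :: real^'n^'m) \<bullet> b) * (\<integral>\<^sup>+x. g (x ** diagonal d ** k) \<partial>lborel)"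
    using d by (intro nn_integral_lborel_coordinate_scale[where T = "\<lambda>x. x ** diagonal d"
          and g = "\<lambda>x. g (x ** k)" and w = "\<chi> i j. d j"])
      (auto simp: Basis_vec_def inner_axis matrix_diagonal_mult)
  also have "(\<Prod>b\<in>Basis. ((\<chi> i j. d j) :: real^'n^'m) \<bullet> b) = det c ^ CARD('m)"
    by (simp add: prod_Basis_vec inner_axis ceq det_orthogonal_conjugate[OF k])
  also have "(\<integral>\<^sup>+x. g (x ** diagonal d ** k) \<partial>lborel)
      = (\<integral>\<^sup>+x. g (x ** transpose k ** diagonal d ** k) \<partial>lborel)"
    using norm_matrix_mult_orthogonal[OF k'] by (intro nn_integral_lborel_isometry[symmetric] lin) simp_all
  finally show ?thesis by (simp add: ceq matrix_mul_assoc)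
qed

text \<open>The substitution as an equation of measures, the form in which it applies to the
  matrix-valued Bochner integral of the Fisher information.\<close>

lemma lborel_matrix_vector:
  fixes c :: "real^'n^'n"
  assumes c: "c \<in> pos_def"
  shows "lborel = density (distr lborel borel ((*v) c)) (\<lambda>_. ennreal (det c))"
proof (rule measure_eqI)
  fix A :: "(real^'n) set" assume "A \<in> sets lborel"
  then have [measurable]: "A \<in> sets borel" by simp
  have "emeasure lborel A = ennreal (det c) * (\<integral>\<^sup>+x. indicator A (c *v x) \<partial>lborel)"
    using nn_integral_lborel_matrix_vector[OF c, of "indicator A"] by simp
  also have "\<dots> = emeasure (density (distr lborel borel ((*v) c)) (\<lambda>_. ennreal (det c))) A"
    by (simp add: emeasure_density nn_integral_distr nn_integral_cmult del: nn_integral_indicator)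
  finally show "emeasure lborel A = \<dots>" .
qed simp

section \<open>Moments of the Student distribution\<close>

lemma has_bochner_integral_Gamma:
  fixes q a :: real
  assumes q: "q > 0" and a: "a > 0"
  shows "has_bochner_integral lborel (\<lambda>t. indicator {0<..} t * t powr (q - 1) * exp (- (a * t)))
    (Gamma q * a powr (- q))"
proof -
  let ?f = "\<lambda>t::real. indicator {0<..} t * t powr (q - 1) * exp (- (a * t))"
  have "ennreal (Gamma q) = (\<integral>\<^sup>+t. ennreal (indicator {0..} t * t powr (q - 1) / exp t) \<partial>lborel)"
    using q by (rule Gamma_conv_nn_integral_real)
  also have "\<dots> = ennreal \<bar>a\<bar> * (\<integral>\<^sup>+t. ennreal (indicator {0..} (0 + a * t) * (0 + a * t) powr (q - 1) / exp (0 + a * t)) \<partial>lborel)"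
    using a by (intro nn_integral_real_affine) auto
  also have "(\<lambda>t. ennreal (indicator {0..} (0 + a * t) * (0 + a * t) powr (q - 1) / exp (0 + a * t)))
      = (\<lambda>t. ennreal (a powr (q - 1)) * ennreal (?f t))"
  proof
    fix t :: real
    have "indicator {0..} (0 + a * t) * (0 + a * t) powr (q - 1) / exp (0 + a * t) = a powr (q - 1) * ?f t"
      using a by (auto simp: indicator_def powr_mult exp_minus field_simps zero_le_mult_iff)
    then show "ennreal (indicator {0..} (0 + a * t) * (0 + a * t) powr (q - 1) / exp (0 + a * t))
      = ennreal (a powr (q - 1)) * ennreal (?f t)"
      by (simp add: ennreal_mult')
  qed
  also have "(\<integral>\<^sup>+t. ennreal (a powr (q - 1)) * ennreal (?f t) \<partial>lborel)
      = ennreal (a powr (q - 1)) * (\<integral>\<^sup>+t. ennreal (?f t) \<partial>lborel)"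
    by (intro nn_integral_cmult) simp
  finally have "ennreal (Gamma q) = ennreal (a powr q) * (\<integral>\<^sup>+t. ennreal (?f t) \<partial>lborel)"
    using a by (simp add: powr_mult_base mult.assoc[symmetric] flip: ennreal_mult)
  then have "ennreal (a powr (- q)) * ennreal (Gamma q)
      = ennreal (a powr (- q)) * ennreal (a powr q) * (\<integral>\<^sup>+t. ennreal (?f t) \<partial>lborel)"
    by (simp add: mult.assoc)
  also have "ennreal (a powr (- q)) * ennreal (a powr q) = 1"
    using a by (simp add: powr_minus flip: ennreal_mult)
  finally have "(\<integral>\<^sup>+t. ennreal (?f t) \<partial>lborel) = ennreal (Gamma q * a powr (- q))"
    using Gamma_real_pos[OF q] by (simp add: mult.commute flip: ennreal_mult)
  then show ?thesis
    using Gamma_real_pos[OF q] by (intro has_bochner_integral_nn_integral) auto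
qed

lemma has_bochner_integral_gaussian_scale:
  fixes F :: "'a::euclidean_space \<Rightarrow> real"
  assumes [measurable]: "F \<in> borel_measurable borel"
    and hom: "\<And>s y. s > 0 \<Longrightarrow> F (s *\<^sub>R y) = s ^ k * F y"
    and F: "has_bochner_integral lborel (\<lambda>y. F y * exp (- (norm y)\<^sup>2 / 2)) m" and t: "t > 0"
  shows "has_bochner_integral lborel (\<lambda>y. F y * exp (- t * (norm y)\<^sup>2 / 2)) (t powr (- (real (DIM('a) + k) / 2)) * m)"
proof -
  let ?G = "\<lambda>y. F y * exp (- t * (norm y)\<^sup>2 / 2)"
  define c where "c = 1 / sqrt t"
  have c: "c > 0" "c\<^sup>2 = 1 / t" using t by (simp_all add: c_def power_divide)
  have G: "?G (0 + c *\<^sub>R y) = c ^ k * (F y * exp (- (norm y)\<^sup>2 / 2))" for y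
    using c t by (simp add: hom power_mult_distrib)
  have "has_bochner_integral lborel (\<lambda>y. \<bar>c\<bar> ^ DIM('a) *\<^sub>R ?G (0 + c *\<^sub>R y)) (c ^ DIM('a) * (c ^ k * m))"
    unfolding G using c(1) by (simp only: abs_of_pos real_scaleR_def) (intro has_bochner_integral_mult_right F)
  then have "has_bochner_integral (distr lborel borel (\<lambda>y. 0 + c *\<^sub>R y)) (\<lambda>y. \<bar>c\<bar> ^ DIM('a) *\<^sub>R ?G y) (c ^ DIM('a) * (c ^ k * m))"
    by (intro has_bochner_integral_distr) simp_all
  then have "has_bochner_integral (density (distr lborel borel (\<lambda>y. 0 + c *\<^sub>R y)) (\<lambda>_. ennreal (\<bar>c\<bar> ^ DIM('a)))) ?G
      (c ^ DIM('a) * (c ^ k * m))"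
    by (intro has_bochner_integral_density) simp_all
  then have "has_bochner_integral lborel ?G (c ^ DIM('a) * (c ^ k * m))"
    using lborel_affine[of c "0::'a"] c(1) by simp
  moreover have "c ^ DIM('a) * (c ^ k * m) = t powr (- (real (DIM('a) + k) / 2)) * m"
  proof -
    have "c ^ DIM('a) * c ^ k = c powr real (DIM('a) + k)"
      using c(1) by (simp only: powr_realpow power_add)
    moreover have "c = t powr (- (1/2))"
      using powr_half_sqrt[of t] t by (simp only: c_def powr_minus_divide less_imp_le)
    then have "c powr real (DIM('a) + k) = t powr (- (real (DIM('a) + k) / 2))"
      by (simp only: powr_powr) simp
    ultimately show ?thesis by (simp only: mult.assoc[symmetric])
  qed
  ultimately show ?thesis by simp
qed

text \<open>Writing \<open>(1 + |y|\<^sup>2/2) powr - q\<close> as a Gamma mixture of Gaussians reduces the moments of the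
  Student distribution to Gaussian ones.\<close>

lemma has_bochner_integral_student:
  fixes F :: "'a::euclidean_space \<Rightarrow> real"
  assumes [measurable]: "F \<in> borel_measurable borel"
    and hom: "\<And>s y. s > 0 \<Longrightarrow> F (s *\<^sub>R y) = s ^ k * F y"
    and F: "has_bochner_integral lborel (\<lambda>y. F y * exp (- (norm y)\<^sup>2 / 2)) m"
    and q: "q > real (DIM('a) + k) / 2"
  shows "has_bochner_integral lborel (\<lambda>y. F y * (1 + (norm y)\<^sup>2 / 2) powr (- q))
    (m * Gamma (q - real (DIM('a) + k) / 2) / Gamma q)"
proof -
  define e where "e = real (DIM('a) + k) / 2"
  have e: "0 \<le> e" "e < q" "0 < q" using q by (auto simp: e_def intro: le_less_trans[rotated])
  have Gq: "Gamma q > 0" using e by (intro Gamma_real_pos)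
  \<comment> \<open>The unnormalised Gamma density with rate \<open>a\<close> and shape
    \<open>b\<close>. The mixture starts with shape \<open>q\<close>, and integrating out the
    Gaussian lowers it to \<open>q - e\<close>, which has to stay positive.\<close>
  define g where "g a b t = indicator {0<..} t * t powr (b - 1) * exp (- (a * t))" for a b t :: real
  define f where "f t y = g 1 q t * (F y * exp (- t * (norm y)\<^sup>2 / 2))" for t y
  have [measurable]: "case_prod f \<in> borel_measurable (lborel \<Otimes>\<^sub>M lborel)"
    unfolding f_def g_def by measurable
  \<comment> \<open>Stated for a general \<open>H\<close> because it is applied both to
    \<open>F\<close> and to its absolute value, the latter for the integrability that Fubini
    demands.\<close>
  have scale: "has_bochner_integral lborel (\<lambda>y. g 1 q t * (H y * exp (- t * (norm y)\<^sup>2 / 2))) (m' * g 1 (q - e) t)"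
    if [measurable]: "H \<in> borel_measurable borel" and hH: "\<And>s y. s > 0 \<Longrightarrow> H (s *\<^sub>R y) = s ^ k * H y"
      and H: "has_bochner_integral lborel (\<lambda>y. H y * exp (- (norm y)\<^sup>2 / 2)) m'" for H :: "'a \<Rightarrow> real" and m' t
  proof (cases "t > 0")
    case True
    have "g 1 q t * (t powr - e * m') = m' * g 1 (q - e) t"
      using True by (simp add: g_def mult_ac flip: powr_add) (simp add: algebra_simps)
    moreover have "has_bochner_integral lborel (\<lambda>y. g 1 q t * (H y * exp (- t * (norm y)\<^sup>2 / 2))) (g 1 q t * (t powr - e * m'))"
      unfolding e_def using has_bochner_integral_gaussian_scale[OF that True] by (intro has_bochner_integral_mult_right)
    ultimately show ?thesis by (simp only:)
  next
    case False
    then show ?thesis by (simp add: g_def has_bochner_integral_zero)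
  qed
  have Fs: "has_bochner_integral lborel (f t) (m * g 1 (q - e) t)" for t
    unfolding f_def using hom F by (intro scale) simp_all
  have F': "has_bochner_integral lborel (\<lambda>y. \<bar>F y\<bar> * exp (- (norm y)\<^sup>2 / 2)) (\<integral>y. \<bar>F y\<bar> * exp (- (norm y)\<^sup>2 / 2) \<partial>lborel)"
  proof -
    have "integrable lborel (\<lambda>y. \<bar>F y * exp (- (norm y)\<^sup>2 / 2)\<bar>)"
      using F by (intro integrable_abs) (simp add: has_bochner_integral_iff)
    then show ?thesis by (simp add: has_bochner_integral_iff abs_mult)
  qed
  have "has_bochner_integral lborel (\<lambda>y. g 1 q t * (\<bar>F y\<bar> * exp (- t * (norm y)\<^sup>2 / 2)))
      ((\<integral>y. \<bar>F y\<bar> * exp (- (norm y)\<^sup>2 / 2) \<partial>lborel) * g 1 (q - e) t)" for t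
    using F' by (intro scale) (simp_all add: hom abs_mult)
  moreover have "norm (f t y) = g 1 q t * (\<bar>F y\<bar> * exp (- t * (norm y)\<^sup>2 / 2))" for t y
    by (simp add: f_def abs_mult g_def)
  ultimately have norm: "(\<integral>y. norm (f t y) \<partial>lborel) = (\<integral>y. \<bar>F y\<bar> * exp (- (norm y)\<^sup>2 / 2) \<partial>lborel) * g 1 (q - e) t" for t
    by (simp add: has_bochner_integral_iff)
  have G: "has_bochner_integral lborel (g a b) (Gamma b * a powr (- b))" if "a > 0" "b > 0" for a b
    unfolding g_def using has_bochner_integral_Gamma[OF that(2,1)] .
  have int: "integrable (lborel \<Otimes>\<^sub>M lborel) (case_prod f)"
  proof (rule lborel_pair.Fubini_integrable)
    show "integrable lborel (\<lambda>t. \<integral>y. norm (case_prod f (t, y)) \<partial>lborel)"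
      using G[of 1 "q - e"] e unfolding prod.case norm by (simp add: has_bochner_integral_iff)
    show "AE t in lborel. integrable lborel (\<lambda>y. case_prod f (t, y))"
      using Fs by (simp add: has_bochner_integral_iff)
  qed simp
  have inner: "(\<integral>t. f t y \<partial>lborel) = Gamma q * (F y * (1 + (norm y)\<^sup>2 / 2) powr (- q))" for y
  proof -
    have "1 + (norm y)\<^sup>2 / 2 > 0" by (simp add: add_pos_nonneg)
    then have "has_bochner_integral lborel (\<lambda>t. F y * g (1 + (norm y)\<^sup>2 / 2) q t)
        (F y * (Gamma q * (1 + (norm y)\<^sup>2 / 2) powr (- q)))"
      using e by (intro has_bochner_integral_mult_right G) auto
    moreover have "F y * g (1 + (norm y)\<^sup>2 / 2) q t = f t y" for t
      by (simp add: f_def g_def exp_add[symmetric] algebra_simps)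
    ultimately show ?thesis by (simp add: has_bochner_integral_iff)
  qed
  have "integrable lborel (\<lambda>y. \<integral>t. f t y \<partial>lborel)"
    by (rule lborel_pair.integrable_snd[OF int])
  then have i: "integrable lborel (\<lambda>y. F y * (1 + (norm y)\<^sup>2 / 2) powr (- q))"
    using Gq by (simp add: inner)
  have "(\<integral>y. \<integral>t. f t y \<partial>lborel \<partial>lborel) = (\<integral>t. \<integral>y. f t y \<partial>lborel \<partial>lborel)"
    by (rule lborel_pair.Fubini_integral[OF int])
  also have "\<dots> = (\<integral>t. m * g 1 (q - e) t \<partial>lborel)"
    using Fs by (simp add: has_bochner_integral_iff)
  also have "\<dots> = m * Gamma (q - e)"
    using G[of 1 "q - e"] e by (simp add: has_bochner_integral_iff)
  finally have "Gamma q * (\<integral>y. F y * (1 + (norm y)\<^sup>2 / 2) powr (- q) \<partial>lborel) = m * Gamma (q - e)"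
    by (simp add: inner)
  then have "(\<integral>y. F y * (1 + (norm y)\<^sup>2 / 2) powr (- q) \<partial>lborel) = m * Gamma (q - e) / Gamma q"
    using Gq by (metis nonzero_mult_div_cancel_left less_irrefl)
  with i show ?thesis by (simp add: has_bochner_integral_iff e_def)
qed

lemma has_bochner_integral_lborel_prod:
  fixes f :: "'a::euclidean_space \<Rightarrow> real \<Rightarrow> real"
  assumes f: "\<And>b. b \<in> Basis \<Longrightarrow> has_bochner_integral lborel (f b) (c b)"
  shows "has_bochner_integral lborel (\<lambda>x. \<Prod>b\<in>Basis. f b (x \<bullet> b)) (\<Prod>b\<in>Basis. c b)"
proof -
  interpret product_sigma_finite "\<lambda>_ :: 'a. lborel :: real measure" by unfold_locales
  have i: "\<And>b. b \<in> Basis \<Longrightarrow> integrable lborel (f b)" using f by (simp add: has_bochner_integral_iff)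
  then have [measurable]: "\<And>b. b \<in> Basis \<Longrightarrow> f b \<in> borel_measurable borel"
    using borel_measurable_integrable by fastforce
  have "integrable (\<Pi>\<^sub>M b\<in>Basis. lborel) (\<lambda>x. \<Prod>b\<in>Basis. f b (x b))"
    "(\<integral>x. (\<Prod>b\<in>Basis. f b (x b)) \<partial>(\<Pi>\<^sub>M b\<in>Basis. lborel)) = (\<Prod>b\<in>Basis. \<integral>x. f b x \<partial>lborel)"
    using i by (simp_all add: product_integrable_prod product_integral_prod)
  then have "has_bochner_integral (\<Pi>\<^sub>M b\<in>Basis. lborel) (\<lambda>x. \<Prod>b\<in>Basis. f b ((\<Sum>b\<in>Basis. x b *\<^sub>R b) \<bullet> b)) (\<Prod>b\<in>Basis. c b)"
    using f by (simp add: has_bochner_integral_iff cong: prod.cong)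
  then show ?thesis
    by (subst lborel_eq) (intro has_bochner_integral_distr, simp_all)
qed

section \<open>Gaussian and Student moments of degree at most four\<close>

definition normal_moment :: "nat \<Rightarrow> real" where
  "normal_moment k = (\<integral>x. std_normal_density x * x ^ k \<partial>lborel)"

lemma normal_moment_values:
  "normal_moment 0 = 1" "normal_moment 1 = 0" "normal_moment 2 = 1" "normal_moment 3 = 0" "normal_moment 4 = 3"
  using integral_std_normal_moment_even[of 0] integral_std_normal_moment_odd[of 0]
    integral_std_normal_moment_even[of 1] integral_std_normal_moment_odd[of 1]
    integral_std_normal_moment_even[of 2]
  by (simp_all add: normal_moment_def fact_numeral eval_nat_numeral)

lemma has_bochner_integral_gaussian_monomial:
  fixes e :: "'n::finite \<Rightarrow> nat"
  shows "has_bochner_integral lborel (\<lambda>x::real^'n. (\<Prod>i\<in>UNIV. x $ i ^ e i) * exp (- (norm x)\<^sup>2 / 2))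
    (sqrt (2 * pi) ^ CARD('n) * (\<Prod>i\<in>UNIV. normal_moment (e i)))"
proof -
  define f where "f b x = x ^ e (axis_index b) * exp (- x\<^sup>2 / 2)" for b :: "real^'n" and x :: real
  have "has_bochner_integral lborel (\<lambda>x. sqrt (2 * pi) * (std_normal_density x * x ^ k))
      (sqrt (2 * pi) * normal_moment k)" for k
    by (intro has_bochner_integral_mult_right)
       (simp add: has_bochner_integral_iff integrable_std_normal_moment normal_moment_def)
  then have "has_bochner_integral lborel (f b) (sqrt (2 * pi) * normal_moment (e (axis_index b)))" for b
    by (simp add: f_def[abs_def] std_normal_density_def mult_ac)
  then have "has_bochner_integral lborel (\<lambda>x::real^'n. \<Prod>b\<in>Basis. f b (x \<bullet> b))
      (\<Prod>b\<in>Basis. sqrt (2 * pi) * normal_moment (e (axis_index (b :: real^'n))))"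
    by (intro has_bochner_integral_lborel_prod)
  moreover have "(\<Prod>b\<in>Basis. f b (x \<bullet> b)) = (\<Prod>i\<in>UNIV. x $ i ^ e i) * exp (- (norm x)\<^sup>2 / 2)" for x :: "real^'n"
    by (simp only: exp_half_norm_square_prod f_def prod.distrib)
       (simp add: prod_Basis_vec inner_axis)
  moreover have "(\<Prod>b\<in>Basis. sqrt (2 * pi) * normal_moment (e (axis_index (b :: real^'n))))
      = sqrt (2 * pi) ^ CARD('n) * (\<Prod>i\<in>UNIV. normal_moment (e i))"
    by (simp add: prod_Basis_vec prod.distrib)
  ultimately show ?thesis by simp
qed

lemma prod_power_of_bool: "(\<Prod>m\<in>UNIV. x m ^ of_bool (m = i)) = (x (i :: 'n::finite) :: real)"
  by (subst prod.remove[of _ i]) (auto intro: prod.neutral)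

lemma gaussian_moment2:
  fixes i j :: "'n::finite"
  shows "has_bochner_integral lborel (\<lambda>x::real^'n. x $ i * x $ j * exp (- (norm x)\<^sup>2 / 2))
    (sqrt (2 * pi) ^ CARD('n) * of_bool (i = j))"
proof -
  define e :: "'n \<Rightarrow> nat" where "e m = of_bool (m = i) + of_bool (m = j)" for m
  have "(\<Prod>m\<in>UNIV. normal_moment (e m)) = (\<Prod>m\<in>{i, j}. normal_moment (e m))"
    by (rule prod.mono_neutral_right) (auto simp: e_def normal_moment_values)
  also have "\<dots> = of_bool (i = j)"
    using normal_moment_values by (cases "i = j") (auto simp: e_def prod.insert_if numeral_2_eq_2)
  finally have "(\<Prod>m\<in>UNIV. normal_moment (e m)) = of_bool (i = j)" .
  moreover have "(\<Prod>m\<in>UNIV. x $ m ^ e m) = x $ i * x $ j" for x :: "real^'n"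
    by (simp only: e_def power_add prod.distrib prod_power_of_bool)
  ultimately show ?thesis using has_bochner_integral_gaussian_monomial[of e] by simp
qed

text \<open>Isserlis' formula: one term for each pairing of the four indices. In the proof
  \<open>e m\<close> counts how often \<open>m\<close> occurs among them; an odd count makes the
  moment vanish, and four equal indices give 3, the number of pairings.\<close>

lemma gaussian_moment4:
  fixes i j k l :: "'n::finite"
  shows "has_bochner_integral lborel (\<lambda>x::real^'n. x $ i * x $ j * x $ k * x $ l * exp (- (norm x)\<^sup>2 / 2))
    (sqrt (2 * pi) ^ CARD('n) *
     (of_bool (i = j \<and> k = l) + of_bool (i = k \<and> j = l) + of_bool (i = l \<and> j = k)))"
proof -
  define e :: "'n \<Rightarrow> nat" where "e m = of_bool (m = i) + of_bool (m = j) + of_bool (m = k) + of_bool (m = l)" for m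
  have vals: "normal_moment 0 = 1" "normal_moment (Suc 0) = 0" "normal_moment (Suc (Suc 0)) = 1"
    "normal_moment (Suc (Suc (Suc 0))) = 0" "normal_moment (Suc (Suc (Suc (Suc 0)))) = 3"
    using normal_moment_values by (simp_all add: eval_nat_numeral)
  have "(\<Prod>m\<in>UNIV. normal_moment (e m)) = (\<Prod>m\<in>{i, j, k, l}. normal_moment (e m))"
    by (rule prod.mono_neutral_right) (auto simp: e_def vals)
  also have "\<dots> = of_bool (i = j \<and> k = l) + of_bool (i = k \<and> j = l) + of_bool (i = l \<and> j = k)"
    by (cases "i = j"; cases "i = k"; cases "i = l"; cases "j = k"; cases "j = l"; cases "k = l")
       (simp_all add: e_def prod.insert_if vals eval_nat_numeral)
  finally have "(\<Prod>m\<in>UNIV. normal_moment (e m))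
    = of_bool (i = j \<and> k = l) + of_bool (i = k \<and> j = l) + of_bool (i = l \<and> j = k)" .
  moreover have "(\<Prod>m\<in>UNIV. x $ m ^ e m) = x $ i * x $ j * x $ k * x $ l" for x :: "real^'n"
    by (simp only: e_def power_add prod.distrib prod_power_of_bool)
  ultimately show ?thesis using has_bochner_integral_gaussian_monomial[of e] by simp
qed

text \<open>The Lebesgue integral of \<open>(1 + (norm y)\<^sup>2 / 2) powr (- r)\<close>, valid for
  r > n/2. The type argument carries the dimension.\<close>

definition student_mass :: "real \<Rightarrow> 'n::finite itself \<Rightarrow> real" where
  "student_mass r _ = sqrt (2 * pi) ^ CARD('n) * Gamma (r - real CARD('n) / 2) / Gamma r"

lemma student_mass_pos: "r > real CARD('n) / 2 \<Longrightarrow> student_mass r TYPE('n::finite) > 0"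
proof -
  assume r: "r > real CARD('n) / 2"
  then have "r > 0" using le_less_trans[of 0 "real CARD('n) / 2" r] by simp
  with r show ?thesis by (simp add: student_mass_def Gamma_real_pos)
qed

lemma student_moment0:
  assumes r: "r > real CARD('n) / 2"
  shows "has_bochner_integral lborel (\<lambda>y::real^'n. (1 + (norm y)\<^sup>2 / 2) powr (- r)) (student_mass r TYPE('n))"
proof -
  have "has_bochner_integral lborel (\<lambda>x::real^'n. 1 * exp (- (norm x)\<^sup>2 / 2)) (sqrt (2 * pi) ^ CARD('n))"
    using has_bochner_integral_gaussian_monomial[of "\<lambda>_::'n. 0"] by (simp add: normal_moment_values(1))
  then have "has_bochner_integral lborel (\<lambda>y::real^'n. 1 * (1 + (norm y)\<^sup>2 / 2) powr (- r))
      (sqrt (2 * pi) ^ CARD('n) * Gamma (r - real (DIM(real^'n) + 0) / 2) / Gamma r)"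
    using r by (intro has_bochner_integral_student) auto
  then show ?thesis by (simp add: student_mass_def)
qed

text \<open>The exponent exceeds \<open>r\<close> by half the degree, so r + 1 - (n + 2)/2 is again
  r - n/2: the moment converges under the same bound and is a rational multiple of the mass. In
  degree four \<open>r + 2\<close> plays the same part.\<close>

lemma student_moment2:
  fixes i j :: "'n::finite"
  assumes r: "r > real CARD('n) / 2"
  shows "has_bochner_integral lborel (\<lambda>y::real^'n. y $ i * y $ j * (1 + (norm y)\<^sup>2 / 2) powr (- (r + 1)))
    (student_mass r TYPE('n) / r * of_bool (i = j))"
proof -
  have r0: "r > 0" using r le_less_trans[of 0 "real CARD('n) / 2" r] by simp
  have "has_bochner_integral lborel (\<lambda>y::real^'n. y $ i * y $ j * (1 + (norm y)\<^sup>2 / 2) powr (- (r + 1)))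
    (sqrt (2 * pi) ^ CARD('n) * of_bool (i = j) * Gamma (r + 1 - real (DIM(real^'n) + 2) / 2) / Gamma (r + 1))"
    using r by (intro has_bochner_integral_student[OF _ _ gaussian_moment2]) (auto simp: power2_eq_square)
  moreover have "r + 1 - real (DIM(real^'n) + 2) / 2 = r - real CARD('n) / 2" by (simp add: field_simps)
  moreover have "Gamma (r + 1) = r * Gamma r"
    using r0 by (intro Gamma_plus1) (auto elim: nonpos_Ints_cases)
  moreover have "sqrt (2 * pi) ^ CARD('n) * of_bool (i = j) * Gamma (r - real CARD('n) / 2) / (r * Gamma r)
      = student_mass r TYPE('n) / r * of_bool (i = j)"
    by (simp add: student_mass_def)
  ultimately show ?thesis by (simp only:)
qed

lemma student_moment4:
  fixes i j k l :: "'n::finite"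
  assumes r: "r > real CARD('n) / 2"
  shows "has_bochner_integral lborel
    (\<lambda>y::real^'n. y $ i * y $ j * y $ k * y $ l * (1 + (norm y)\<^sup>2 / 2) powr (- (r + 2)))
    (student_mass r TYPE('n) / (r * (r + 1)) *
     (of_bool (i = j \<and> k = l) + of_bool (i = k \<and> j = l) + of_bool (i = l \<and> j = k)))"
proof -
  have r0: "r > 0" using r le_less_trans[of 0 "real CARD('n) / 2" r] by simp
  have "has_bochner_integral lborel
    (\<lambda>y::real^'n. y $ i * y $ j * y $ k * y $ l * (1 + (norm y)\<^sup>2 / 2) powr (- (r + 2)))
    (sqrt (2 * pi) ^ CARD('n) * (of_bool (i = j \<and> k = l) + of_bool (i = k \<and> j = l) + of_bool (i = l \<and> j = k))
      * Gamma (r + 2 - real (DIM(real^'n) + 4) / 2) / Gamma (r + 2))"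
    using r by (intro has_bochner_integral_student[OF _ _ gaussian_moment4])
      (auto simp: eval_nat_numeral mult_ac)
  moreover have "r + 2 - real (DIM(real^'n) + 4) / 2 = r - real CARD('n) / 2" by (simp add: field_simps)
  moreover have "Gamma (r + 2) = r * (r + 1) * Gamma r"
  proof -
    have "r \<notin> \<int>\<^sub>\<le>\<^sub>0" "r + 1 \<notin> \<int>\<^sub>\<le>\<^sub>0" using r0 by (auto elim!: nonpos_Ints_cases)
    then show ?thesis using Gamma_plus1[of "r + 1"] Gamma_plus1[of r] by (simp add: add.assoc)
  qed
  moreover have "sqrt (2 * pi) ^ CARD('n) * (of_bool (i = j \<and> k = l) + of_bool (i = k \<and> j = l) + of_bool (i = l \<and> j = k))
      * Gamma (r - real CARD('n) / 2) / (r * (r + 1) * Gamma r)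
      = student_mass r TYPE('n) / (r * (r + 1)) *
        (of_bool (i = j \<and> k = l) + of_bool (i = k \<and> j = l) + of_bool (i = l \<and> j = k))"
    by (simp only: student_mass_def) (simp add: divide_simps)
  ultimately show ?thesis by (simp only:)
qed

section \<open>Existence of the Wishart distribution\<close>

lemma borel_measurable_det[measurable]: "(det :: real^'n^'n \<Rightarrow> real) \<in> borel_measurable borel"
  unfolding det_def by (intro borel_measurable_continuous_onI continuous_intros)

definition outer :: "real^'n \<Rightarrow> real^'n^'n" where
  "outer y = (\<chi> i j. y $ i * y $ j)"

lemma trace_mult_outer: "trace (m ** outer y) = y \<bullet> (m *v y)"
  by (simp add: trace_def outer_def matrix_matrix_mult_def matrix_vector_mult_def inner_vec_def
      sum_distrib_left mult_ac)

lemma inner_outer: "x \<bullet> (outer y *v x) = (x \<bullet> y)\<^sup>2"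
proof -
  have "outer y *v x = (x \<bullet> y) *\<^sub>R y"
    by (simp add: vec_eq_iff outer_def matrix_vector_mult_def inner_vec_def sum_distrib_left sum_distrib_right mult_ac)
  then show ?thesis by (simp add: power2_eq_square)
qed

lemma pos_def_add_outer:
  assumes "t \<in> pos_def" "a \<ge> 0"
  shows "t + a *\<^sub>R outer y \<in> pos_def"
proof -
  have "transpose (t + a *\<^sub>R outer y) = t + a *\<^sub>R outer y"
    using assms by (auto simp: pos_def_def sym_mat_def transpose_def vec_eq_iff outer_def)
  moreover have "x \<bullet> ((t + a *\<^sub>R outer y) *v x) > 0" if "x \<noteq> 0" for x
    using assms that unfolding pos_def_def
    by (simp add: matrix_vector_mult_add_rdistrib inner_add_right inner_outer add_pos_nonneg
        scaleR_matrix_vector_assoc[symmetric])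
  ultimately show ?thesis by (simp add: pos_def_def sym_mat_def)
qed

lemma pos_def_mat_1: "mat 1 \<in> pos_def"
  by (simp add: pos_def_def sym_mat_def)

lemma det_mat_1_add_outer: "det (mat 1 + a *\<^sub>R outer y) = 1 + a * (norm y)\<^sup>2" for y :: "real^'n"
proof (cases "y = 0")
  case True
  then have "outer y = 0" by (simp add: outer_def vec_eq_iff)
  then show ?thesis using True by simp
next
  case False
  fix i :: 'n
  \<comment> \<open>With the normalised \<open>y\<close> as column \<open>i\<close> of an orthogonal
    matrix, \<open>outer y\<close> becomes diagonal with |y|^2 as its only nonzero entry.\<close>
  obtain k where k: "orthogonal_matrix k" "k *v axis i 1 = y /\<^sub>R norm y"
    using False orthogonal_matrix_exists_basis[of "y /\<^sub>R norm y" i] by auto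
  have yk: "y $ m = norm y * k $ m $ i" for m
  proof -
    have "k $ m $ i = (k *v axis i 1) $ m"
      by (simp add: matrix_vector_mult_def axis_def if_distrib[of "\<lambda>x. _ * x"] cong: if_cong)
    then show ?thesis using k(2) False by simp
  qed
  define d where "d m = 1 + (if m = i then a * (norm y)\<^sup>2 else 0)" for m
  have "transpose (transpose k) ** diagonal d ** transpose k = mat 1 + a *\<^sub>R outer y"
  proof -
    have kk: "(\<Sum>m\<in>UNIV. k $ u $ m * k $ v $ m) = (mat 1 :: real^'n^'n) $ u $ v" for u v
    proof -
      have "(k ** transpose k) $ u $ v = (mat 1 :: real^'n^'n) $ u $ v"
        using k(1) by (simp add: orthogonal_matrix_def)
      then show ?thesis by (simp add: matrix_matrix_mult_def transpose_def)
    qed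
    have "(transpose (transpose k) ** diagonal d ** transpose k) $ u $ v
        = (\<Sum>m\<in>UNIV. k $ u $ m * k $ v $ m + (if m = i then a * (norm y)\<^sup>2 * k $ u $ m * k $ v $ m else 0))" for u v
      unfolding transpose_transpose matrix_matrix_mult_def[of "k ** diagonal d"]
      by (auto simp: matrix_diagonal_mult transpose_def d_def algebra_simps intro!: sum.cong)
    then show ?thesis
      by (simp add: vec_eq_iff sum.distrib kk outer_def yk power2_eq_square mult_ac)
  qed
  then have "det (mat 1 + a *\<^sub>R outer y) = prod d UNIV"
    using det_orthogonal_conjugate[of "transpose k" d] k(1) by simp
  also have "\<dots> = 1 + a * (norm y)\<^sup>2"
    by (subst prod.remove[of _ i]) (auto simp: d_def)
  finally show ?thesis .
qed

section \<open>The matrix integral: scaling, recursion, finiteness, positivity\<close>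

definition wishart_integrand :: "real \<Rightarrow> real^'n^'n \<Rightarrow> real^'n^'n \<Rightarrow> real" where
  "wishart_integrand q t x = \<bar>det x\<bar> powr (2 * q - real CARD('n)) * exp (- trace (x ** t ** transpose x))"

text \<open>Under u = x^T x, Lebesgue measure becomes a multiple of (det u)^(-1/2) du, so the
  integrand corresponds to the classical Wishart form (det u)^(q - (n + 1)/2) exp (- tr (t u)).
  Values in \<open>ennreal\<close> permit Tonelli before finiteness is known.\<close>

definition wishart_integral :: "real \<Rightarrow> real^'n^'n \<Rightarrow> ennreal" where
  "wishart_integral q t = (\<integral>\<^sup>+x. ennreal (wishart_integrand q t x) \<partial>lborel)"

lemma borel_measurable_wishart_integrand[measurable]: "wishart_integrand q t \<in> borel_measurable borel"
proof -
  have "(\<lambda>x. trace (x ** t ** transpose x)) \<in> borel_measurable borel"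
    unfolding trace_def matrix_matrix_mult_def transpose_def
    by (intro borel_measurable_continuous_onI) (simp add: continuous_intros)
  then show ?thesis unfolding wishart_integrand_def[abs_def] by measurable
qed

lemma wishart_integrand_nonneg: "wishart_integrand q t x \<ge> 0"
  by (simp add: wishart_integrand_def)

text \<open>The substitution \<open>x \<mapsto> x ** sqrt t\<close>.\<close>

lemma wishart_integral_pos_def:
  fixes t :: "real^'n^'n"
  assumes t: "t \<in> pos_def"
  shows "wishart_integral q t = ennreal (det t powr (- q)) * wishart_integral q (mat 1 :: real^'n^'n)"
proof -
  obtain r where r: "r \<in> pos_def" and rr: "r ** r = t" using pos_def_root[OF t] by metis
  have dr: "det r > 0" using pos_def_det_pos[OF r] .
  have dt: "det t = det r * det r" using rr by (metis det_mul)
  have tr: "transpose r = r" using r by (simp add: pos_def_def sym_mat_def)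
  have "wishart_integrand q (mat 1) (x ** r) = det r powr (2 * q - real CARD('n)) * wishart_integrand q t x" for x
  proof -
    have "x ** r ** mat 1 ** transpose (x ** r) = x ** t ** transpose x"
      by (simp add: matrix_transpose_mul tr matrix_mul_assoc flip: rr)
    then show ?thesis
      using dr by (simp add: wishart_integrand_def det_mul abs_mult powr_mult mult_ac)
  qed
  then have "wishart_integral q (mat 1 :: real^'n^'n)
      = ennreal (det r ^ CARD('n)) * (\<integral>\<^sup>+x. ennreal (det r powr (2 * q - real CARD('n))) * ennreal (wishart_integrand q t x) \<partial>lborel)"
    unfolding wishart_integral_def
    by (subst nn_integral_lborel_matrix_mult[OF r]) (simp_all add: ennreal_mult' wishart_integrand_nonneg)
  also have "\<dots> = ennreal (det r ^ CARD('n) * det r powr (2 * q - real CARD('n))) * wishart_integral q t"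
    using dr by (simp add: nn_integral_cmult wishart_integral_def ennreal_mult mult.assoc)
  also have "det r ^ CARD('n) * det r powr (2 * q - real CARD('n)) = det t powr q"
    using dr by (simp add: powr_realpow[symmetric] dt powr_mult flip: powr_add)
  finally have "ennreal (det t powr (- q)) * wishart_integral q (mat 1 :: real^'n^'n)
      = ennreal (det t powr (- q)) * ennreal (det t powr q) * wishart_integral q t"
    by (simp add: mult.assoc)
  also have "ennreal (det t powr (- q)) * ennreal (det t powr q) = 1"
    using dt dr by (simp add: powr_minus flip: ennreal_mult)
  finally show ?thesis by simp
qed

text \<open>The maximum of s^(a/2) exp (- s/2) is attained at s = a; the bound drops the factor exp
  (- a/2) from its value there.\<close>

lemma powr_le_exp_half:
  fixes s a :: real
  assumes s: "s \<ge> 0" and a: "a > 0"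
  shows "s powr (a / 2) \<le> a powr (a / 2) * exp (s / 2)"
proof (cases "s = 0")
  case False
  with s have s: "s > 0" by simp
  have "ln (s / a) \<le> s / a" using s a ln_le_minus_one[of "s / a"] by simp
  then have "a / 2 * ln s \<le> a / 2 * ln a + s / 2"
    using s a by (simp add: ln_div field_simps)
  then have "exp (a / 2 * ln s) \<le> exp (a / 2 * ln a) * exp (s / 2)"
    by (simp flip: exp_add)
  then show ?thesis using s a by (simp add: powr_def)
qed simp

lemma abs_det_le: "\<exists>c>0. \<forall>x :: real^'n^'n. \<bar>det x\<bar> \<le> c * norm x ^ CARD('n)"
proof -
  let ?P = "{p. p permutes (UNIV :: 'n set)}"
  have entry: "\<bar>x $ i $ j\<bar> \<le> norm x" for x :: "real^'n^'n" and i j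
    using component_le_norm_cart[of "x $ i" j] Finite_Cartesian_Product.norm_nth_le[of x i] by linarith
  have "\<bar>det x\<bar> \<le> real (card ?P + 1) * norm x ^ CARD('n)" for x :: "real^'n^'n"
  proof -
    have "\<bar>det x\<bar> \<le> (\<Sum>p\<in>?P. \<bar>of_int (sign p) * (\<Prod>i\<in>UNIV. x $ i $ p i)\<bar>)"
      unfolding det_def by (rule sum_abs)
    also have "\<dots> \<le> (\<Sum>p\<in>?P. norm x ^ CARD('n))"
    proof (rule sum_mono)
      fix p
      have "(\<Prod>i\<in>UNIV. \<bar>x $ i $ p i\<bar>) \<le> (\<Prod>i\<in>(UNIV :: 'n set). norm x)"
        by (intro prod_mono) (simp add: entry)
      then show "\<bar>of_int (sign p) * (\<Prod>i\<in>UNIV. x $ i $ p i)\<bar> \<le> norm x ^ CARD('n)"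
        by (simp add: abs_mult sign_def abs_prod)
    qed
    also have "\<dots> \<le> real (card ?P + 1) * norm x ^ CARD('n)"
      by (simp add: algebra_simps)
    finally show ?thesis .
  qed
  then show ?thesis by (intro exI[of _ "real (card ?P + 1)"]) auto
qed

lemma trace_mult_transpose: "trace (x ** transpose x) = (norm (x :: real^'n^'n))\<^sup>2"
  using trace_inner[of "transpose x" "transpose x"]
  by (simp add: power2_norm_eq_inner) (simp add: inner_vec_def transpose_def, rule sum.swap)

lemma matrix_mult_scaleR: "a ** (c *\<^sub>R b) = c *\<^sub>R (a ** (b :: real^'n^'m))"
  by (simp add: vec_eq_iff matrix_matrix_mult_def sum_distrib_left mult_ac)

text \<open>Here the exponent of the determinant is positive, so nothing blows up at singular
  matrices, and half of the Gaussian factor absorbs the polynomial growth.\<close>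

lemma wishart_integral_finite_large:
  assumes q: "q > real CARD('n) / 2"
  shows "wishart_integral q (mat 1 :: real^'n^'n) < \<infinity>"
proof -
  define b where "b = 2 * q - real CARD('n)"
  have b: "b > 0" using q by (simp add: b_def)
  define a where "a = real CARD('n) * b"
  have a: "a > 0" using b by (simp add: a_def)
  obtain c where c: "c > 0" "\<And>x :: real^'n^'n. \<bar>det x\<bar> \<le> c * norm x ^ CARD('n)"
    using abs_det_le by blast
  define K where "K = c powr b * a powr (a / 2)"
  have "wishart_integrand q (mat 1) x \<le> K * exp (- (norm x)\<^sup>2 / 2)" for x :: "real^'n^'n"
  proof -
    have "\<bar>det x\<bar> powr b \<le> (c * norm x ^ CARD('n)) powr b"
      using c b by (intro powr_mono2) auto
    also have "\<dots> = c powr b * ((norm x)\<^sup>2) powr (a / 2)"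
    proof (cases "x = 0")
      case True
      then show ?thesis using b a by simp
    next
      case False
      then have "norm x ^ CARD('n) = norm x powr real CARD('n)" "(norm x)\<^sup>2 = norm x powr 2"
        by (simp_all add: powr_realpow)
      then show ?thesis
        using c(1) by (simp only: powr_mult powr_powr a_def) simp
    qed
    also have "\<dots> \<le> c powr b * (a powr (a / 2) * exp ((norm x)\<^sup>2 / 2))"
      using a by (intro mult_left_mono powr_le_exp_half) auto
    finally have "\<bar>det x\<bar> powr b * exp (- (norm x)\<^sup>2) \<le> K * exp ((norm x)\<^sup>2 / 2) * exp (- (norm x)\<^sup>2)"
      by (intro mult_right_mono) (simp_all add: K_def mult_ac)
    also have "\<dots> = K * exp (- (norm x)\<^sup>2 / 2)"
      by (simp add: mult.assoc flip: exp_add)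
    finally show ?thesis
      by (simp add: wishart_integrand_def b_def trace_mult_transpose)
  qed
  then have "wishart_integral q (mat 1 :: real^'n^'n) \<le> (\<integral>\<^sup>+x. ennreal (K * exp (- (norm (x :: real^'n^'n))\<^sup>2 / 2)) \<partial>lborel)"
    unfolding wishart_integral_def by (intro nn_integral_mono ennreal_leI)
  also have "\<dots> = ennreal K * (\<integral>\<^sup>+x. ennreal (exp (- (norm (x :: real^'n^'n))\<^sup>2 / 2)) \<partial>lborel)"
    by (subst nn_integral_cmult[symmetric]) (auto simp: ennreal_mult' K_def)
  also have "\<dots> < \<infinity>"
    unfolding nn_integral_gaussian by (simp add: ennreal_mult_less_top)
  finally show ?thesis .
qed

lemma pos_def_transpose_mult:
  fixes x :: "real^'n^'n"
  assumes "det x \<noteq> 0"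
  shows "transpose x ** x \<in> pos_def"
proof -
  obtain x' where inv: "x' ** x = mat 1"
    using assms invertible_det_nz[of x] unfolding invertible_def by blast
  have "y \<bullet> ((transpose x ** x) *v y) > 0" if "y \<noteq> 0" for y
  proof -
    have "x *v y \<noteq> 0"
      using assms that inv by (metis matrix_vector_mul_assoc matrix_vector_mul_lid matrix_vector_mult_0_right)
    moreover have "y \<bullet> ((transpose x ** x) *v y) = (x *v y) \<bullet> (x *v y)"
      using inner_conjugate[of y x "mat 1"] by simp
    ultimately show ?thesis by simp
  qed
  then show ?thesis by (simp add: pos_def_def sym_mat_def matrix_transpose_mul)
qed

text \<open>Polar decomposition reduces a general \<open>x\<close> to the positive definite root
  \<open>r\<close> of x^T x: it satisfies |r y| = |x y| and det r = |det x|.\<close>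

lemma nn_integral_gaussian_matrix:
  fixes x :: "real^'n^'n"
  assumes x: "det x \<noteq> 0"
  shows "ennreal \<bar>det x\<bar> * (\<integral>\<^sup>+y. ennreal (exp (- (norm (x *v y))\<^sup>2 / 2)) \<partial>lborel) = ennreal (sqrt (2 * pi) ^ CARD('n))"
proof -
  obtain r where r: "r \<in> pos_def" and rr: "r ** r = transpose x ** x"
    using pos_def_root[OF pos_def_transpose_mult[OF x]] by metis
  have "(det r)\<^sup>2 = (det x)\<^sup>2" using arg_cong[OF rr, of det] by (simp add: det_mul power2_eq_square)
  then have "det r = \<bar>det x\<bar>"
    using pos_def_det_pos[OF r] unfolding power2_eq_iff by linarith
  moreover have "norm (r *v y) = norm (x *v y)" for y
  proof -
    have "transpose r = r" using r by (simp add: pos_def_def sym_mat_def)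
    then have "(r *v y) \<bullet> (r *v y) = (x *v y) \<bullet> (x *v y)"
      using inner_conjugate[of y r "mat 1"] inner_conjugate[of y x "mat 1"] rr by simp
    then show ?thesis by (simp add: norm_eq_sqrt_inner)
  qed
  ultimately show ?thesis
    using nn_integral_lborel_matrix_vector[OF r, of "\<lambda>y. ennreal (exp (- (norm y)\<^sup>2 / 2))"]
    unfolding nn_integral_gaussian by simp
qed

text \<open>Tonelli for the exponent \<open>q + 1/2\<close> with an extra Gaussian factor, whose integral restores
  the missing power of the determinant.\<close>

lemma wishart_integral_recursion:
  assumes q: "q > (real CARD('n) - 1) / 2"
  shows "ennreal (sqrt (2 * pi) ^ CARD('n)) * wishart_integral q (mat 1 :: real^'n^'n)
    = ennreal (student_mass (q + 1/2) TYPE('n)) * wishart_integral (q + 1/2) (mat 1 :: real^'n^'n)"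
proof -
  let ?r = "q + 1/2"
  have r: "?r > real CARD('n) / 2" using q by (simp add: field_simps)
  let ?I = "mat 1 :: real^'n^'n"
  have tr: "trace (x ** (?I + (1/2) *\<^sub>R outer y) ** transpose x) = trace (x ** transpose x) + (norm (x *v y))\<^sup>2 / 2"
    for x :: "real^'n^'n" and y
  proof -
    have "trace (x ** (?I + (1/2) *\<^sub>R outer y) ** transpose x) = trace (transpose x ** (x ** (?I + (1/2) *\<^sub>R outer y)))"
      by (rule trace_mul_sym)
    also have "\<dots> = trace (transpose x ** x) + (1/2) * trace ((transpose x ** x) ** outer y)"
      by (simp add: matrix_add_ldistrib trace_add trace_scaleR matrix_mul_assoc matrix_mult_scaleR)
    also have "trace (transpose x ** x) = trace (x ** transpose x)" by (rule trace_mul_sym)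
    finally show ?thesis
      using inner_conjugate[of y x "mat 1"]
      by (simp add: trace_mult_outer power2_norm_eq_inner)
  qed
  have factor: "ennreal (wishart_integrand ?r (?I + (1/2) *\<^sub>R outer y) x)
      = ennreal (wishart_integrand ?r ?I x) * ennreal (exp (- (norm (x *v y))\<^sup>2 / 2))" for x y
  proof -
    have "wishart_integrand ?r (?I + (1/2) *\<^sub>R outer y) x = wishart_integrand ?r ?I x * exp (- (norm (x *v y))\<^sup>2 / 2)"
      unfolding wishart_integrand_def tr by (simp add: mult.assoc flip: exp_add)
    then show ?thesis by (simp only: ennreal_mult'[OF wishart_integrand_nonneg])
  qed
  have "ennreal (wishart_integrand ?r ?I x) * (\<integral>\<^sup>+y. ennreal (exp (- (norm (x *v y))\<^sup>2 / 2)) \<partial>lborel)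
      = ennreal (sqrt (2 * pi) ^ CARD('n)) * ennreal (wishart_integrand q ?I x)" for x
  proof (cases "det x = 0")
    \<comment> \<open>\<open>0 powr a = 0\<close> for every real \<open>a\<close>, so both
      integrands vanish even when the exponent is 0, and the infinite Gaussian integral is
      multiplied by 0.\<close>
    case True
    then show ?thesis by (simp add: wishart_integrand_def)
  next
    case False
    have "wishart_integrand ?r ?I x = wishart_integrand q ?I x * \<bar>det x\<bar>"
    proof -
      have "2 * ?r - real CARD('n) = 1 + (2 * q - real CARD('n))" by simp
      then have "\<bar>det x\<bar> powr (2 * ?r - real CARD('n)) = \<bar>det x\<bar> * \<bar>det x\<bar> powr (2 * q - real CARD('n))"
        by (simp only: powr_mult_base[OF abs_ge_zero])
      then show ?thesis by (simp only: wishart_integrand_def mult_ac)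
    qed
    then have "ennreal (wishart_integrand ?r ?I x) * (\<integral>\<^sup>+y. ennreal (exp (- (norm (x *v y))\<^sup>2 / 2)) \<partial>lborel)
      = ennreal (wishart_integrand q ?I x) * (ennreal \<bar>det x\<bar> * (\<integral>\<^sup>+y. ennreal (exp (- (norm (x *v y))\<^sup>2 / 2)) \<partial>lborel))"
      by (simp only: ennreal_mult'[OF wishart_integrand_nonneg] mult.assoc)
    then show ?thesis by (simp only: nn_integral_gaussian_matrix[OF False] mult.commute)
  qed
  then have "(\<integral>\<^sup>+x. \<integral>\<^sup>+y. ennreal (wishart_integrand ?r (?I + (1/2) *\<^sub>R outer y) x) \<partial>lborel \<partial>lborel)
      = ennreal (sqrt (2 * pi) ^ CARD('n)) * wishart_integral q ?I"
    by (simp add: factor nn_integral_cmult wishart_integral_def)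
  moreover have "(\<integral>\<^sup>+x. \<integral>\<^sup>+y. ennreal (wishart_integrand ?r (?I + (1/2) *\<^sub>R outer y) x) \<partial>lborel \<partial>lborel)
      = (\<integral>\<^sup>+y. wishart_integral ?r (?I + (1/2) *\<^sub>R outer y) \<partial>lborel)"
    unfolding wishart_integral_def factor by (rule lborel_pair.Fubini') measurable
  \<comment> \<open>The scaling law at 1 + y y^T/2, whose determinant 1 + |y|^2/2 turns the
    remaining integral into a Student mass.\<close>
  moreover have "(\<integral>\<^sup>+y. wishart_integral ?r (?I + (1/2) *\<^sub>R outer y) \<partial>lborel)
      = (\<integral>\<^sup>+y. ennreal ((1 + (norm (y::real^'n))\<^sup>2 / 2) powr (- ?r)) \<partial>lborel) * wishart_integral ?r ?I"
    by (subst nn_integral_multc[symmetric])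
       (simp_all add: wishart_integral_pos_def[OF pos_def_add_outer[OF pos_def_mat_1]] det_mat_1_add_outer)
  moreover have "(\<integral>\<^sup>+y. ennreal ((1 + (norm (y::real^'n))\<^sup>2 / 2) powr (- ?r)) \<partial>lborel) = ennreal (student_mass ?r TYPE('n))"
    using student_moment0[OF r] by (subst nn_integral_eq_integral) (auto simp: has_bochner_integral_iff)
  ultimately show ?thesis by (simp only:)
qed

text \<open>For (n - 1)/2 < q \<le> n/2 the exponent 2q - n lies in (-1, 0] and the direct estimate
  fails near singular matrices. Raising q by 1/2 just leaves this range.\<close>

lemma wishart_integral_finite:
  assumes q: "q > (real CARD('n) - 1) / 2"
  shows "wishart_integral q (mat 1 :: real^'n^'n) < \<infinity>"
proof -
  have "q + 1/2 > real CARD('n) / 2" using q by (simp add: field_simps)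
  then have "wishart_integral (q + 1/2) (mat 1 :: real^'n^'n) < \<infinity>" by (rule wishart_integral_finite_large)
  then have "ennreal (sqrt (2 * pi) ^ CARD('n)) * wishart_integral q (mat 1 :: real^'n^'n) < \<infinity>"
    unfolding wishart_integral_recursion[OF q] by (simp add: ennreal_mult_less_top)
  then show ?thesis by (auto simp: ennreal_mult_less_top)
qed

text \<open>Otherwise the determinant would vanish almost everywhere. Its zero set is closed, and a
  closed set of full measure is everything, including the identity.\<close>

lemma wishart_integral_pos: "wishart_integral q (mat 1 :: real^'n^'n) > 0"
proof (rule ccontr)
  assume "\<not> wishart_integral q (mat 1 :: real^'n^'n) > 0"
  then have "AE x in lborel. ennreal (wishart_integrand q (mat 1 :: real^'n^'n) x) = 0"
    unfolding wishart_integral_def by (subst nn_integral_0_iff_AE[symmetric]) (auto simp: not_gr_zero)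
  then have "AE x in lebesgue. (x :: real^'n^'n) \<in> {x. det x = 0}"
    by (intro AE_completion) (auto simp: wishart_integrand_def elim!: eventually_mono)
  moreover have "closed {x :: real^'n^'n. det x = 0}"
    unfolding det_def by (intro closed_Collect_eq continuous_intros)
  ultimately have "(mat 1 :: real^'n^'n) \<in> {x. det x = 0}"
    by (rule mem_closed_if_AE_lebesgue[rotated])
  then show False by simp
qed

lemma matrix_add_rdistrib_real: "((a :: real^'n^'m) + b) ** c = a ** c + b ** c"
  by (simp add: vec_eq_iff matrix_matrix_mult_def sum.distrib algebra_simps)

lemma pos_def_add: "s \<in> pos_def \<Longrightarrow> t \<in> pos_def \<Longrightarrow> s + t \<in> pos_def"
  by (auto simp: pos_def_def sym_mat_def transpose_def vec_eq_iff matrix_vector_mult_add_rdistrib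
      inner_add_right add_pos_pos)

text \<open>The parameter \<open>t\<close> stands for the inverse of \<open>\<sigma>\<close>. At
  singular \<open>x\<close>, where the density is 0, the value \<open>mat 1\<close> keeps the map
  inside the cone.\<close>

definition wishart_law :: "real \<Rightarrow> real^'n^'n \<Rightarrow> (real^'n^'n) measure" where
  "wishart_law p t =
    distr (density lborel (\<lambda>x. ennreal (wishart_integrand p t x / enn2real (wishart_integral p t))))
      (restrict_space borel pos_def) (\<lambda>x. if det x \<noteq> 0 then transpose x ** x else mat 1)"

lemma wishart_integral_real:
  fixes t :: "real^'n^'n"
  assumes p: "p > (real CARD('n) - 1) / 2" and t: "t \<in> pos_def"
  shows "wishart_integral p t = ennreal (enn2real (wishart_integral p t))"
    and "enn2real (wishart_integral p t) > 0"
    and "enn2real (wishart_integral p t) = det t powr (- p) * enn2real (wishart_integral p (mat 1 :: real^'n^'n))"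
proof -
  have d: "det t powr (- p) > 0" using pos_def_det_pos[OF t] by simp
  show eq: "enn2real (wishart_integral p t) = det t powr (- p) * enn2real (wishart_integral p (mat 1 :: real^'n^'n))"
    using d by (simp add: wishart_integral_pos_def[OF t] enn2real_mult)
  have "enn2real (wishart_integral p (mat 1 :: real^'n^'n)) > 0"
    using wishart_integral_finite[OF p] wishart_integral_pos[of p, where 'n = 'n]
    by (simp add: enn2real_positive_iff)
  then show "enn2real (wishart_integral p t) > 0" using d eq by simp
  then show "wishart_integral p t = ennreal (enn2real (wishart_integral p t))"
    by (metis enn2real_top ennreal_enn2real_if less_irrefl)
qed

lemma gram_measurable[measurable]:
  "(\<lambda>x :: real^'n^'n. if det x \<noteq> 0 then transpose x ** x else mat 1) \<in> borel \<rightarrow>\<^sub>M restrict_space borel pos_def"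
proof (rule measurable_restrict_space2)
  show "(\<lambda>x :: real^'n^'n. if det x \<noteq> 0 then transpose x ** x else mat 1) \<in> space borel \<rightarrow> pos_def"
    using pos_def_transpose_mult pos_def_mat_1 by auto
  have [measurable]: "(\<lambda>x :: real^'n^'n. transpose x ** x) \<in> borel_measurable borel"
    unfolding matrix_matrix_mult_def transpose_def
    by (intro borel_measurable_continuous_onI) (simp add: continuous_intros)
  show "(\<lambda>x :: real^'n^'n. if det x \<noteq> 0 then transpose x ** x else mat 1) \<in> borel \<rightarrow>\<^sub>M borel"
    by measurable
qed

lemma prob_space_wishart_law:
  fixes t :: "real^'n^'n"
  assumes p: "p > (real CARD('n) - 1) / 2" and t: "t \<in> pos_def"
  shows "prob_space (wishart_law p t)"
proof -
  let ?Z = "enn2real (wishart_integral p t)"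
  note Z = wishart_integral_real[OF p t]
  have "(\<integral>\<^sup>+x. ennreal (wishart_integrand p t x / ?Z) \<partial>lborel) = (\<integral>\<^sup>+x. ennreal (1 / ?Z) * ennreal (wishart_integrand p t x) \<partial>lborel)"
    using Z(2) by (intro nn_integral_cong) (simp flip: ennreal_mult')
  also have "\<dots> = ennreal (1 / ?Z) * wishart_integral p t"
    by (simp add: nn_integral_cmult wishart_integral_def)
  also have "\<dots> = ennreal (1 / ?Z * ?Z)"
  proof -
    have "ennreal (1 / ?Z * ?Z) = ennreal (1 / ?Z) * ennreal ?Z" using Z(2) by (intro ennreal_mult') simp
    then show ?thesis by (simp only: Z(1)[symmetric])
  qed
  also have "\<dots> = 1" using Z(2) by simp
  finally have "prob_space (density lborel (\<lambda>x. ennreal (wishart_integrand p t x / ?Z)))"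
    by (intro prob_spaceI) (simp add: emeasure_density)
  then show ?thesis
    unfolding wishart_law_def by (rule prob_space.prob_space_distr) simp
qed

text \<open>Under u = x^T x the factor \<open>sqrt (det u) powr e\<close> becomes a power of |det x|
  and shifts the exponent by \<open>e / 2\<close>, while exp (- tr (s u)) shifts \<open>t\<close> by
  \<open>s\<close>. The case e = 0 gives the Laplace transform and e = 1 the mixture defining the
  density. Positive definiteness is asked of \<open>t + s\<close>, which admits the matrix
  \<open>s = outer x / 2\<close> that occurs there.\<close>

lemma wishart_law_integral:
  fixes t :: "real^'n^'n"
  assumes p: "p > (real CARD('n) - 1) / 2" and e: "e \<ge> 0" and t: "t \<in> pos_def" and ts: "t + s \<in> pos_def"
  shows "has_bochner_integral (wishart_law p t) (\<lambda>u. exp (- trace (s ** u)) * sqrt (det u) powr e)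
    (enn2real (wishart_integral (p + e / 2) (t + s)) / enn2real (wishart_integral p t))"
proof -
  let ?Z = "enn2real (wishart_integral p t)"
  let ?g = "\<lambda>u :: real^'n^'n. exp (- trace (s ** u)) * sqrt (det u) powr e"
  note Z = wishart_integral_real[OF p t]
  have p': "p + e / 2 > (real CARD('n) - 1) / 2" using p e by simp
  note Z' = wishart_integral_real[OF p' ts]
  have "(\<lambda>u :: real^'n^'n. trace (s ** u)) \<in> borel_measurable borel"
    unfolding trace_def matrix_matrix_mult_def
    by (intro borel_measurable_continuous_onI) (simp add: continuous_intros)
  then have g[measurable]: "?g \<in> borel_measurable borel" by measurable
  then have g'[measurable]: "?g \<in> borel_measurable (restrict_space borel pos_def)"
    by (rule measurable_restrict_space1)
  have "wishart_integrand p t x / ?Z * ?g (if det x \<noteq> 0 then transpose x ** x else mat 1)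
      = 1 / ?Z * wishart_integrand (p + e / 2) (t + s) x" for x
  proof (cases "det x = 0")
    case True
    then show ?thesis by (simp add: wishart_integrand_def)
  next
    case False
    have "trace (s ** (transpose x ** x)) = trace (x ** (s ** transpose x))"
      using trace_mul_sym[of "s ** transpose x" x] by (simp add: matrix_mul_assoc)
    then have tr: "trace (x ** (t + s) ** transpose x) = trace (x ** t ** transpose x) + trace (s ** (transpose x ** x))"
      by (simp add: matrix_add_ldistrib matrix_add_rdistrib_real trace_add matrix_mul_assoc)
    have "2 * (p + e / 2) - real CARD('n) = (2 * p - real CARD('n)) + e" by simp
    then have "\<bar>det x\<bar> powr (2 * (p + e / 2) - real CARD('n)) = \<bar>det x\<bar> powr (2 * p - real CARD('n)) * \<bar>det x\<bar> powr e"
      by (simp only: powr_add)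
    moreover have "sqrt (det (transpose x ** x)) = \<bar>det x\<bar>" by (simp add: det_mul)
    ultimately show ?thesis
      using False unfolding wishart_integrand_def tr by (simp add: exp_add exp_diff exp_minus field_simps)
  qed
  then have "ennreal (wishart_integrand p t x / ?Z) * ennreal (?g (if det x \<noteq> 0 then transpose x ** x else mat 1))
      = ennreal (1 / ?Z) * ennreal (wishart_integrand (p + e / 2) (t + s) x)" for x
    using Z(2) by (subst (1 2) ennreal_mult'[symmetric]) (simp_all add: wishart_integrand_nonneg del: times_divide_eq_left)
  moreover have "(\<integral>\<^sup>+u. ennreal (?g u) \<partial>wishart_law p t) = (\<integral>\<^sup>+x. ennreal (wishart_integrand p t x / ?Z) *
      ennreal (?g (if det x \<noteq> 0 then transpose x ** x else mat 1)) \<partial>lborel)"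
    unfolding wishart_law_def by (subst nn_integral_distr, simp, simp, subst nn_integral_density) simp_all
  ultimately have "(\<integral>\<^sup>+u. ennreal (?g u) \<partial>wishart_law p t) = ennreal (1 / ?Z) * wishart_integral (p + e / 2) (t + s)"
    by (simp add: nn_integral_cmult wishart_integral_def del: divide_ennreal_def)
  also have "\<dots> = ennreal (enn2real (wishart_integral (p + e / 2) (t + s)) / ?Z)"
    by (subst Z'(1)) (use Z(2) in \<open>simp flip: ennreal_mult'\<close>)
  finally show ?thesis
    using Z(2) by (intro has_bochner_integral_nn_integral) (auto simp: wishart_law_def)
qed

lemma is_wishart_wishart_law:
  fixes t :: "real^'n^'n"
  assumes p: "p > (real CARD('n) - 1) / 2" and t: "t \<in> pos_def" and st: "\<sigma> ** t = mat 1"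
  shows "is_wishart p \<sigma> (wishart_law p t)"
  unfolding is_wishart_def
proof (intro conjI ballI)
  show "prob_space (wishart_law p t)" by (rule prob_space_wishart_law[OF p t])
  show "sets (wishart_law p t) = sets (restrict_space borel pos_def)" by (simp add: wishart_law_def)
  fix s :: "real^'n^'n" assume s: "s \<in> pos_def"
  have ts: "t + s \<in> pos_def" using t s by (rule pos_def_add)
  have sp: "space (wishart_law p t) = pos_def" by (simp add: wishart_law_def space_restrict_space)
  have "(\<integral>u. exp (- trace (s ** u)) \<partial>wishart_law p t) = (\<integral>u. exp (- trace (s ** u)) * sqrt (det u) powr 0 \<partial>wishart_law p t)"
    by (intro Bochner_Integration.integral_cong) (auto simp: sp dest: pos_def_det_pos)
  also have "\<dots> = enn2real (wishart_integral p (t + s)) / enn2real (wishart_integral p t)"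
    using wishart_law_integral[OF p _ t ts, of 0] by (simp add: has_bochner_integral_iff)
  also have "\<dots> = det (t + s) powr (- p) / det t powr (- p)"
    using wishart_integral_real(2)[OF p pos_def_mat_1]
    by (simp add: wishart_integral_real(3)[OF p t] wishart_integral_real(3)[OF p ts])
  also have "\<dots> = (det \<sigma> * det (t + s)) powr (- p)"
  proof -
    have "det \<sigma> * det t = 1" using st by (metis det_I det_mul)
    then have "det \<sigma> = 1 / det t" using pos_def_det_pos[OF t] by (simp add: field_simps)
    then show ?thesis using pos_def_det_pos[OF t] pos_def_det_pos[OF ts] by (simp add: powr_divide)
  qed
  also have "det \<sigma> * det (t + s) = det (mat 1 + \<sigma> ** s)"
    by (simp add: det_mul[symmetric] matrix_add_ldistrib st)
  finally show "(\<integral>u. exp (- trace (s ** u)) \<partial>wishart_law p t) = det (mat 1 + \<sigma> ** s) powr (- p)" .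
qed

section \<open>Uniqueness of the Wishart distribution\<close>

text \<open>The functions whose integrals \<open>is_wishart\<close> prescribes. The case s = 0
  supplies the constants, prescribed because the measure is a probability; since 0 together with the
  cone is closed under addition, the span is an algebra.\<close>

inductive exp_span :: "(real^'n^'n \<Rightarrow> real) \<Rightarrow> bool" where
  exp: "s = 0 \<or> s \<in> pos_def \<Longrightarrow> exp_span (\<lambda>u. exp (- trace (s ** u)))"
| scale: "exp_span f \<Longrightarrow> exp_span (\<lambda>u. c * f u)"
| add: "exp_span f \<Longrightarrow> exp_span g \<Longrightarrow> exp_span (\<lambda>u. f u + g u)"

lemma exp_span_mult_exp:
  assumes g: "exp_span g" and s: "s = 0 \<or> s \<in> pos_def"
  shows "exp_span (\<lambda>u. exp (- trace (s ** u)) * g u)"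
  using g
proof induction
  case (exp t)
  have "s + t = 0 \<or> s + t \<in> pos_def" using s exp pos_def_add[of s t] by auto
  then have "exp_span (\<lambda>u. exp (- trace ((s + t) ** u)))" by (rule exp_span.exp)
  then show ?case by (simp add: matrix_add_rdistrib_real trace_add exp_diff exp_minus divide_inverse)
next
  case (scale f c)
  then show ?case using exp_span.scale[of "\<lambda>u. exp (- trace (s ** u)) * f u" c] by (simp add: mult_ac)
next
  case (add f g)
  then show ?case using exp_span.add by (fastforce simp: distrib_left)
qed

lemma exp_span_mult:
  assumes f: "exp_span f" and g: "exp_span g"
  shows "exp_span (\<lambda>u. f u * g u)"
  using f
proof induction
  case (exp s)
  then show ?case using exp_span_mult_exp[OF g] by blast
next
  case (scale f c)
  then show ?case using exp_span.scale[of "\<lambda>u. f u * g u" c] by (simp add: mult_ac)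
next
  case (add f f')
  then show ?case using exp_span.add by (fastforce simp: distrib_right)
qed

lemma exp_span_const: "exp_span (\<lambda>u. c)"
  using exp_span.scale[OF exp_span.exp[of 0], of c] by (simp add: trace_0[unfolded mat_0])

lemma exp_span_sum: "(\<And>i. i \<in> I \<Longrightarrow> exp_span (f i)) \<Longrightarrow> exp_span (\<lambda>u. \<Sum>i\<in>I. f i u)"
proof (induction I rule: infinite_finite_induct)
  case (insert i I)
  then have "exp_span (\<lambda>u. f i u + (\<Sum>i\<in>I. f i u))" by (intro exp_span.add) auto
  then show ?case using insert by simp
qed (simp_all add: exp_span_const)

text \<open>A chart of the cone whose coordinates are exponentials \<open>u \<mapsto> exp (- trace (s ** u))\<close> with
  \<open>s\<close> positive definite: it maps the cone into a compact cube, and its polynomials are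
  combinations of such exponentials.\<close>

definition exp_chart :: "real^'n^'n \<Rightarrow> real^'n^'n" where
  "exp_chart u = (\<chi> i j. exp (- trace ((mat 1 + 1 *\<^sub>R outer (axis i 1 + axis j 1)) ** u)))"

text \<open>Inverts - ln y_ij = tr u + u_ii + u_jj + 2 u_ij. On the diagonal the right-hand side is
  tr u + 4 u_kk, and summing over k gives (n + 4) tr u; so \<open>T\<close> recovers the trace,
  \<open>d\<close> the diagonal, and the last line all entries.\<close>

definition exp_chart_inv :: "real^'n^'n \<Rightarrow> real^'n^'n" where
  "exp_chart_inv y =
    (let T = - (\<Sum>k\<in>UNIV. ln (y $ k $ k)) / (real CARD('n) + 4); d = (\<lambda>i. (- ln (y $ i $ i) - T) / 4)
     in \<chi> i j. (- ln (y $ i $ j) - T - d i - d j) / 2)"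

lemma trace_outer_mult: "trace (outer y ** u) = y \<bullet> (u *v y)"
  by (subst trace_mul_sym) (rule trace_mult_outer)

lemma inner_axis_matrix: "axis i 1 \<bullet> (u *v axis j 1) = (u :: real^'n^'n) $ i $ j"
  by (simp add: inner_axis' matrix_vector_mult_basis column_def)

lemma exp_chart_inv:
  assumes u: "u \<in> (sym_mat :: (real^'n^'n) set)"
  shows "exp_chart_inv (exp_chart u) = u"
proof -
  have sym: "u $ j $ i = u $ i $ j" for i j
    using u unfolding sym_mat_def transpose_def by (auto simp: vec_eq_iff)
  have tr: "trace ((mat 1 + 1 *\<^sub>R outer (axis i 1 + axis j 1)) ** u) = trace u + u $ i $ i + u $ j $ j + 2 * u $ i $ j" for i j
    by (simp add: matrix_add_rdistrib_real trace_add trace_outer_mult matrix_vector_right_distrib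
        inner_add_left inner_add_right inner_axis_matrix sym[of j i])
  have y: "ln (exp_chart u $ i $ j) = - (trace u + u $ i $ i + u $ j $ j + 2 * u $ i $ j)" for i j
    by (simp only: exp_chart_def vec_lambda_beta tr ln_exp)
  have "(\<Sum>k\<in>UNIV. ln (exp_chart u $ k $ k)) = - (\<Sum>k\<in>(UNIV :: 'n set). trace u + 4 * u $ k $ k)"
    unfolding sum_negf[symmetric] y by (intro sum.cong) auto
  also have "\<dots> = - ((real CARD('n) + 4) * trace u)"
    by (simp add: sum.distrib trace_def distrib_right flip: sum_distrib_left)
  finally have T: "- (\<Sum>k\<in>UNIV. ln (exp_chart u $ k $ k)) / (real CARD('n) + 4) = trace u"
    by (simp add: add_eq_0_iff)
  show ?thesis
    unfolding exp_chart_inv_def Let_def T by (simp add: vec_eq_iff y field_simps)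
qed

lemma exp_chart_measurable[measurable]: "(exp_chart :: real^'n^'n \<Rightarrow> _) \<in> borel_measurable borel"
  unfolding exp_chart_def trace_def matrix_matrix_mult_def
  by (intro borel_measurable_continuous_onI) (simp add: continuous_intros)

lemma exp_chart_inv_measurable[measurable]: "(exp_chart_inv :: real^'n^'n \<Rightarrow> _) \<in> borel_measurable borel"
proof -
  have [measurable]: "(\<lambda>y :: real^'n^'n. y $ i $ j) \<in> borel_measurable borel" for i j
    by (intro borel_measurable_continuous_onI continuous_intros)
  have [measurable]: "(\<lambda>y :: real^'n^'n. exp_chart_inv y $ i $ j) \<in> borel_measurable borel" for i j
    unfolding exp_chart_inv_def Let_def vec_lambda_beta by measurable
  show ?thesis
    by (subst borel_measurable_euclidean_space) (auto simp: Basis_vec_def inner_axis)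
qed

lemma exp_span_chart: "exp_span (\<lambda>u. exp_chart u $ i $ j)"
  unfolding exp_chart_def vec_lambda_beta
  by (intro exp_span.exp disjI2 pos_def_add_outer pos_def_mat_1) simp

text \<open>With r the root of \<open>s\<close>, the trace is that of r u r, whose diagonal entries
  are values of the quadratic form of \<open>u\<close>. It bounds the exponentials by 1, which gives
  their integrability and puts the chart into the unit cube.\<close>

lemma trace_pos_def_mult_nonneg:
  fixes s u :: "real^'n^'n"
  assumes s: "s \<in> pos_def" and u: "u \<in> pos_def"
  shows "trace (s ** u) \<ge> 0"
proof -
  obtain r where r: "r \<in> pos_def" and rr: "r ** r = s" using pos_def_root[OF s] by metis
  have tr: "transpose r = r" using r by (simp add: pos_def_def sym_mat_def)
  have "trace (s ** u) = trace (r ** (r ** u))" by (simp only: rr[symmetric] matrix_mul_assoc)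
  also have "\<dots> = trace (transpose r ** u ** r)" using trace_mul_sym[of r "r ** u"] by (simp only: tr)
  also have "\<dots> \<ge> 0"
    unfolding trace_def
  proof (rule sum_nonneg)
    fix i :: 'n
    have "(r *v axis i 1) \<bullet> (u *v (r *v axis i 1)) \<ge> 0"
      using u unfolding pos_def_def by (cases "r *v axis i 1 = 0") (auto intro: less_imp_le)
    then show "(transpose r ** u ** r) $ i $ i \<ge> 0"
      using inner_conjugate[of "axis i 1" r u] by (simp only: inner_axis_matrix)
  qed
  finally show ?thesis .
qed

lemma exp_span_polynomial:
  assumes "real_polynomial_function (g :: real^'n^'n \<Rightarrow> real)"
  shows "exp_span (\<lambda>u. g (exp_chart u))"
  using assms
proof induction
  case (linear f)
  then interpret bounded_linear f .
  have "(\<lambda>u. f (exp_chart u)) = (\<lambda>u. \<Sum>b\<in>Basis. f b * (exp_chart u \<bullet> b))"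
  proof
    fix u :: "real^'n^'n"
    define y where "y = exp_chart u"
    have "f y = f (\<Sum>b\<in>Basis. (y \<bullet> b) *\<^sub>R b)" by (simp add: euclidean_representation)
    then have "f y = (\<Sum>b\<in>Basis. f b * (y \<bullet> b))" by (simp only: sum scaleR real_scaleR_def mult.commute)
    then show "f (exp_chart u) = (\<Sum>b\<in>Basis. f b * (exp_chart u \<bullet> b))" by (simp only: y_def)
  qed
  moreover have "exp_span (\<lambda>u. \<Sum>b\<in>Basis. f b * (exp_chart u \<bullet> b))"
    by (intro exp_span_sum exp_span.scale) (auto simp: Basis_vec_def inner_axis exp_span_chart)
  ultimately show ?case by presburger
qed (auto intro: exp_span_const exp_span.add exp_span_mult)

text \<open>Polynomials approximate a continuous function uniformly only on \<open>K\<close>, which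
  is enough as both measures are carried by \<open>K\<close>. Equality then passes from continuous
  functions to closed sets by dominated convergence.\<close>

lemma prob_measure_eqI_polynomial:
  fixes M N :: "'a::euclidean_space measure"
  assumes M: "prob_space M" "sets M = sets borel" and N: "prob_space N" "sets N = sets borel"
    and K: "compact K" "AE x in M. x \<in> K" "AE x in N. x \<in> K"
    and poly: "\<And>g. real_polynomial_function g \<Longrightarrow> (\<integral>x. g x \<partial>M) = (\<integral>x. g x \<partial>N)"
  shows "M = N"
proof -
  interpret M: prob_space M by fact
  interpret N: prob_space N by fact
  note [measurable_cong] = M(2) N(2)
  have spM: "space M = UNIV" "space N = UNIV" using M(2) N(2) by (auto dest: sets_eq_imp_space_eq)
  have bound: "\<exists>B. \<forall>x\<in>K. norm (f x) \<le> B" if "continuous_on UNIV f" for f :: "'a \<Rightarrow> real"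
    using compact_continuous_image[OF continuous_on_subset[OF that] K(1)] compact_imp_bounded
    by (force simp: bounded_iff)
  have int: "integrable M f" "integrable N f" if fc: "continuous_on UNIV f" for f :: "'a \<Rightarrow> real"
  proof -
    obtain B where B: "\<forall>x\<in>K. norm (f x) \<le> B" using bound[OF fc] by blast
    have [measurable]: "f \<in> borel_measurable borel" using fc by (rule borel_measurable_continuous_onI)
    show "integrable M f"
      using K(2) B by (intro M.integrable_const_bound[of _ B]) (auto elim!: eventually_mono)
    show "integrable N f"
      using K(3) B by (intro N.integrable_const_bound[of _ B]) (auto elim!: eventually_mono)
  qed
  have cont: "(\<integral>x. f x \<partial>M) = (\<integral>x. f x \<partial>N)" if f: "continuous_on UNIV f" for f :: "'a \<Rightarrow> real"
  proof (rule ccontr)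
    assume ne: "(\<integral>x. f x \<partial>M) \<noteq> (\<integral>x. f x \<partial>N)"
    \<comment> \<open>A third of the supposed gap, so that two approximation errors of at most
      \<open>d\<close> cannot fill it.\<close>
    define d where "d = \<bar>(\<integral>x. f x \<partial>M) - (\<integral>x. f x \<partial>N)\<bar> / 3"
    have d: "d > 0" using ne by (simp add: d_def)
    obtain g where g: "real_polynomial_function g" "\<And>x. x \<in> K \<Longrightarrow> \<bar>f x - g x\<bar> < d"
      using Stone_Weierstrass_real_polynomial_function[OF K(1) continuous_on_subset[OF f] d] by blast
    have gc: "continuous_on UNIV g"
      using g(1) by (simp add: continuous_on_polymonial_function real_polynomial_function_eq)
    have "\<bar>(\<integral>x. f x \<partial>M) - (\<integral>x. g x \<partial>M)\<bar> \<le> d"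
    proof -
      have "\<bar>\<integral>x. f x - g x \<partial>M\<bar> \<le> (\<integral>x. \<bar>f x - g x\<bar> \<partial>M)" by (rule integral_abs_bound)
      also have "\<dots> \<le> (\<integral>x. d \<partial>M)"
        using K(2) g(2) int[OF f] int[OF gc] by (intro integral_mono_AE) (auto elim!: eventually_mono dest!: g(2))
      finally show ?thesis using int[OF f] int[OF gc] by (simp add: M.prob_space N.prob_space)
    qed
    moreover have "\<bar>(\<integral>x. f x \<partial>N) - (\<integral>x. g x \<partial>N)\<bar> \<le> d"
    proof -
      have "\<bar>\<integral>x. f x - g x \<partial>N\<bar> \<le> (\<integral>x. \<bar>f x - g x\<bar> \<partial>N)" by (rule integral_abs_bound)
      also have "\<dots> \<le> (\<integral>x. d \<partial>N)"
        using K(3) g(2) int[OF f] int[OF gc] by (intro integral_mono_AE) (auto elim!: eventually_mono dest!: g(2))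
      finally show ?thesis using int[OF f] int[OF gc] by (simp add: M.prob_space N.prob_space)
    qed
    moreover have "\<bar>(\<integral>x. f x \<partial>M) - (\<integral>x. f x \<partial>N)\<bar>
        \<le> \<bar>(\<integral>x. f x \<partial>M) - (\<integral>x. g x \<partial>N)\<bar> + \<bar>(\<integral>x. f x \<partial>N) - (\<integral>x. g x \<partial>N)\<bar>"
      by linarith
    ultimately have "\<bar>(\<integral>x. f x \<partial>M) - (\<integral>x. f x \<partial>N)\<bar> \<le> d + d"
      unfolding poly[OF g(1)] by (meson add_mono order_trans)
    then show False using d by (simp add: d_def)
  qed
  show ?thesis
  proof (rule measure_eqI_generator_eq[where E = "{C. closed C}" and \<Omega> = UNIV and A = "\<lambda>_. UNIV"])
    show "Int_stable {C :: 'a set. closed C}" by (auto simp: Int_stable_def)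
    show "sets M = sigma_sets UNIV {C. closed C}" "sets N = sigma_sets UNIV {C. closed C}"
      using M(2) N(2) by (simp_all add: borel_eq_closed)
    show "emeasure M UNIV \<noteq> \<infinity>" using M.emeasure_space_1 spM by simp
    fix C :: "'a set" assume "C \<in> {C. closed C}"
    then have C: "closed C" by simp
    show "emeasure M C = emeasure N C"
    proof (cases "C = {}")
      case False
      \<comment> \<open>Continuous functions decreasing to the indicator of \<open>C\<close>. Since
        \<open>infdist x {} = 0\<close>, they would be constantly 1 for empty \<open>C\<close>,
        which is why that case is separate.\<close>
      define h where "h k x = max 0 (1 - real k * infdist x C)" for k x
      have hc: "continuous_on UNIV (h k)" for k unfolding h_def by (intro continuous_intros)
      have lim: "(\<lambda>k. h k x) \<longlonglongrightarrow> indicator C x" for x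
      proof (cases "x \<in> C")
        case True
        then show ?thesis by (simp add: h_def)
      next
        case xC: False
        then have "infdist x C > 0" using C False in_closed_iff_infdist_zero[OF C False, of x] infdist_nonneg[of x C] by force
        then obtain m where m: "real m * infdist x C > 1" using reals_Archimedean3 by blast
        have "\<forall>\<^sub>F k in sequentially. h k x = 0"
        proof (rule eventually_sequentiallyI)
          fix k assume "m \<le> k"
          then have "real m * infdist x C \<le> real k * infdist x C" by (intro mult_right_mono) (auto simp: infdist_nonneg)
          then show "h k x = 0" using m by (simp add: h_def)
        qed
        then show ?thesis using xC by (simp add: tendsto_eventually)
      qed
      have [measurable]: "h k \<in> borel_measurable borel" for k using hc by (rule borel_measurable_continuous_onI)
      have [measurable]: "C \<in> sets borel" using C by simp
      have nb: "norm (h k x) \<le> 1" for k x by (simp add: h_def infdist_nonneg)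
      have "(\<lambda>k. \<integral>x. h k x \<partial>M) \<longlonglongrightarrow> (\<integral>x. indicator C x \<partial>M)"
        by (rule integral_dominated_convergence[where w = "\<lambda>_. 1"]) (use lim nb in auto)
      moreover have "(\<lambda>k. \<integral>x. h k x \<partial>N) \<longlonglongrightarrow> (\<integral>x. indicator C x \<partial>N)"
        by (rule integral_dominated_convergence[where w = "\<lambda>_. 1"]) (use lim nb in auto)
      ultimately have "(\<integral>x. indicator C x \<partial>M) = (\<integral>x. indicator C x \<partial>N :: real)"
        unfolding cont[OF hc] by (rule LIMSEQ_unique)
      then show ?thesis by (simp add: M.emeasure_eq_measure N.emeasure_eq_measure spM)
    qed simp
  qed auto
qed

text \<open>Integrability belongs to the induction claim because additivity of the integral depends
  on it.\<close>

lemma exp_span_integral_eq: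
  assumes "is_wishart p \<sigma> M" "is_wishart p \<sigma> N" "exp_span h"
  shows "integrable M h \<and> integrable N h \<and> (\<integral>u. h u \<partial>M) = (\<integral>u. h u \<partial>N)"
  using assms(3)
proof induction
  case (exp s)
  have i: "integrable L (\<lambda>u. exp (- trace (s ** u)))" if L: "is_wishart p \<sigma> L" for L
  proof -
    interpret prob_space L using L by (simp add: is_wishart_def)
    have sets: "sets L = sets (restrict_space borel pos_def)" using L by (simp add: is_wishart_def)
    then have sp: "space L = pos_def" using sets_eq_imp_space_eq[OF sets] by (simp add: space_restrict_space)
    have "(\<lambda>u. exp (- trace (s ** u))) \<in> borel_measurable borel"
      unfolding trace_def matrix_matrix_mult_def
      by (intro borel_measurable_continuous_onI) (simp add: continuous_intros)
    then have "(\<lambda>u. exp (- trace (s ** u))) \<in> borel_measurable L"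
      unfolding measurable_cong_sets[OF sets refl] by (rule measurable_restrict_space1)
    then show ?thesis
      using exp by (intro integrable_const_bound[of _ 1] AE_I2)
        (auto simp: sp trace_pos_def_mult_nonneg trace_0[unfolded mat_0])
  qed
  moreover have "(\<integral>u. exp (- trace (s ** u)) \<partial>M) = (\<integral>u. exp (- trace (s ** u)) \<partial>N)"
  proof (cases "s = 0")
    case True
    interpret M: prob_space M using assms by (simp add: is_wishart_def)
    interpret N: prob_space N using assms by (simp add: is_wishart_def)
    show ?thesis using True M.prob_space N.prob_space by (simp add: trace_0[unfolded mat_0])
  next
    case False
    then show ?thesis using exp assms by (simp add: is_wishart_def)
  qed
  ultimately show ?case using assms by blast
qed auto

text \<open>The images of the two measures under the chart agree on polynomials, hence coincide. On
  the cone the chart has a measurable left inverse, so every measurable subset of the cone is a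
  preimage under the chart, and equality carries back.\<close>

lemma is_wishart_unique:
  fixes M N :: "(real^'n^'n) measure"
  assumes M: "is_wishart p \<sigma> M" and N: "is_wishart p \<sigma> N"
  shows "M = N"
proof -
  have sets: "sets L = sets (restrict_space borel pos_def)" if "is_wishart p \<sigma> L" for L
    using that by (simp add: is_wishart_def)
  have sp: "space L = pos_def" if "is_wishart p \<sigma> L" for L
    using sets_eq_imp_space_eq[OF sets[OF that]] by (simp add: space_restrict_space)
  have meas: "exp_chart \<in> L \<rightarrow>\<^sub>M borel" if "is_wishart p \<sigma> L" for L
    unfolding measurable_cong_sets[OF sets[OF that] refl] by (intro measurable_restrict_space1) simp
  define D where "D L = distr L borel (exp_chart :: real^'n^'n \<Rightarrow> _)" for L
  have cube: "AE x in D L. x \<in> cbox 0 (\<chi> i j. 1)" if L: "is_wishart p \<sigma> L" for L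
  proof -
    have "exp_chart u \<in> cbox 0 (\<chi> i j. 1)" if "u \<in> pos_def" for u :: "real^'n^'n"
      using trace_pos_def_mult_nonneg[OF pos_def_add_outer[OF pos_def_mat_1] that, of 1]
      by (auto simp: mem_box Basis_vec_def inner_axis exp_chart_def)
    then show ?thesis
      unfolding D_def by (subst AE_distr_iff[OF meas[OF L]]) (auto simp: sp[OF L])
  qed
  have "D M = D N"
  proof (rule prob_measure_eqI_polynomial[OF _ _ _ _ compact_cbox cube[OF M] cube[OF N]])
    show "prob_space (D M)" "prob_space (D N)"
      unfolding D_def using M N meas by (auto simp: is_wishart_def intro!: prob_space.prob_space_distr)
    show "sets (D M) = sets borel" "sets (D N) = sets borel" by (simp_all add: D_def)
    fix g :: "real^'n^'n \<Rightarrow> real" assume g: "real_polynomial_function g"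
    then have gm: "g \<in> borel_measurable borel"
      by (intro borel_measurable_continuous_onI)
         (simp add: continuous_on_polymonial_function real_polynomial_function_eq)
    show "(\<integral>x. g x \<partial>D M) = (\<integral>x. g x \<partial>D N)"
      unfolding D_def integral_distr[OF meas[OF M] gm] integral_distr[OF meas[OF N] gm]
      using exp_span_integral_eq[OF M N exp_span_polynomial[OF g]] by blast
  qed
  show ?thesis
  proof (rule measure_eqI)
    show "sets M = sets N" using sets[OF M] sets[OF N] by simp
    fix A assume "A \<in> sets M"
    then obtain B where B: "B \<in> sets borel" "A = pos_def \<inter> B"
      unfolding sets[OF M] sets_restrict_space by auto
    then have B': "exp_chart_inv -` B \<in> sets borel"
      using measurable_sets[OF exp_chart_inv_measurable B(1)] by simp
    have "emeasure (D L) (exp_chart_inv -` B) = emeasure L A" if L: "is_wishart p \<sigma> L" for L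
    proof -
      have "exp_chart -` (exp_chart_inv -` B) \<inter> space L = A"
        using B exp_chart_inv unfolding sp[OF L] pos_def_def by auto
      then show ?thesis unfolding D_def emeasure_distr[OF meas[OF L] B'] by simp
    qed
    then show "emeasure M A = emeasure N A" using M N \<open>D M = D N\<close> by metis
  qed
qed

section \<open>Density and score\<close>

lemma wishart_eq_law:
  fixes t :: "real^'n^'n"
  assumes "p > (real CARD('n) - 1) / 2" "t \<in> pos_def" "\<sigma> ** t = mat 1"
  shows "wishart p \<sigma> = wishart_law p t"
  unfolding wishart_def using is_wishart_wishart_law[OF assms] is_wishart_unique by blast

lemma outer_matrix_vector: "outer (a *v y) = a ** outer y ** transpose a"
proof -
  have "(a *v y) $ i * (a *v y) $ j = (a ** outer y ** transpose a) $ i $ j" for i j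
    unfolding matrix_vector_mult_def matrix_matrix_mult_def transpose_def outer_def vec_lambda_beta
    by (subst sum_product, subst sum.swap) (simp add: sum_distrib_right sum_distrib_left mult_ac)
  then show ?thesis by (simp add: outer_def[of "a *v y"] vec_eq_iff)
qed

lemma pos_def_transpose: "s \<in> pos_def \<Longrightarrow> transpose s = s"
  by (simp add: pos_def_def sym_mat_def)

lemma pos_def_square: "c \<in> pos_def \<Longrightarrow> c ** c \<in> pos_def"
  using pos_def_transpose_mult[of c] pos_def_det_pos[of c] by (simp add: pos_def_transpose)

lemma inner_square:
  assumes "r \<in> pos_def"
  shows "x \<bullet> ((r ** r) *v x) = (norm (r *v x))\<^sup>2"
  using inner_conjugate[of x r "mat 1"] pos_def_transpose[OF assms]
  by (simp add: power2_norm_eq_inner)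

lemma scaleR_matrix_mult: "(c *\<^sub>R (a :: real^'n^'m)) ** b = c *\<^sub>R (a ** b)"
  by (simp add: vec_eq_iff matrix_matrix_mult_def sum_distrib_left mult_ac)

lemma matrix_sub_rdistrib_real: "((a :: real^'n^'m) - b) ** c = a ** c - b ** c"
  by (simp add: vec_eq_iff matrix_matrix_mult_def sum_subtractf algebra_simps)

lemma det_add_outer:
  fixes r c :: "real^'n^'n"
  assumes r: "r \<in> pos_def" and c: "c \<in> pos_def" and cr: "c ** r = mat 1" and rc: "r ** c = mat 1"
  shows "det (c ** c + a *\<^sub>R outer x) = det (c ** c) * (1 + a * (norm (r *v x))\<^sup>2)"
proof -
  have "c ** outer (r *v x) ** c = (c ** r) ** outer x ** (r ** c)"
    by (simp add: outer_matrix_vector pos_def_transpose[OF r] matrix_mul_assoc)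
  then have "c ** (mat 1 + a *\<^sub>R outer (r *v x)) ** c = c ** c + a *\<^sub>R outer x"
    by (simp add: cr rc matrix_add_ldistrib matrix_add_rdistrib_real matrix_mult_scaleR scaleR_matrix_mult)
  then have "det (c ** c + a *\<^sub>R outer x) = det c * det (mat 1 + a *\<^sub>R outer (r *v x)) * det c"
    by (metis det_mul)
  then show ?thesis by (simp add: det_mat_1_add_outer det_mul mult_ac)
qed

text \<open>The mixture integral is the case e = 1 of \<open>wishart_law_integral\<close> at s = x
  x^T/2, and the determinant of t + s factors through 1 + x . (\<sigma> x)/2.\<close>

lemma model_density_eq:
  fixes \<sigma> :: "real^'n^'n"
  assumes p: "p > (real CARD('n) - 1) / 2" and \<sigma>: "\<sigma> \<in> pos_def"
  shows "model_density p \<sigma> x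
    = sqrt (det \<sigma>) / student_mass (p + 1/2) TYPE('n) * (1 + (x \<bullet> (\<sigma> *v x)) / 2) powr (- (p + 1/2))"
proof -
  obtain r c where r: "r \<in> pos_def" and c: "c \<in> pos_def" and rr: "r ** r = \<sigma>"
    and rc: "r ** c = mat 1" and cr: "c ** r = mat 1"
    using pos_def_root[OF \<sigma>] by metis
  let ?t = "c ** c" and ?s = "(1/2) *\<^sub>R outer x"
  let ?W = "\<lambda>q. enn2real (wishart_integral q (mat 1 :: real^'n^'n))"
  let ?m = "student_mass (p + 1/2) TYPE('n)"
  have t: "?t \<in> pos_def" using c by (rule pos_def_square)
  have ts: "?t + ?s \<in> pos_def" by (rule pos_def_add_outer[OF t]) simp
  have "\<sigma> ** ?t = r ** (r ** c) ** c" by (simp add: rr[symmetric] matrix_mul_assoc)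
  then have st: "\<sigma> ** ?t = mat 1" by (simp add: rc)
  have p': "p + 1 / 2 > (real CARD('n) - 1) / 2" using p by simp
  have p'': "p + 1 / 2 > real CARD('n) / 2" using p by (simp add: field_simps)
  note m = student_mass_pos[OF p'']
  have "(\<integral>u. exp (- (x \<bullet> (u *v x)) / 2) * sqrt (det u) \<partial>wishart p \<sigma>)
      = (\<integral>u. exp (- trace (?s ** u)) * sqrt (det u) powr 1 \<partial>wishart_law p ?t)"
    unfolding wishart_eq_law[OF p t st]
    by (intro Bochner_Integration.integral_cong)
       (auto simp: wishart_law_def space_restrict_space scaleR_matrix_mult trace_scaleR trace_outer_mult
         dest: pos_def_det_pos)
  also have "\<dots> = enn2real (wishart_integral (p + 1/2) (?t + ?s)) / enn2real (wishart_integral p ?t)"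
    using wishart_law_integral[OF p _ t ts, of 1] by (simp add: has_bochner_integral_iff)
  also have "\<dots> = (det (?t + ?s) powr (- (p + 1/2)) / det ?t powr (- p)) * (?W (p + 1/2) / ?W p)"
    unfolding wishart_integral_real(3)[OF p t] wishart_integral_real(3)[OF p' ts] by simp
  \<comment> \<open>Only this ratio of matrix integrals is needed, and the recursion at q = p
    supplies it.\<close>
  also have "?W (p + 1/2) / ?W p = sqrt (2 * pi) ^ CARD('n) / ?m"
  proof -
    have "enn2real (ennreal (sqrt (2 * pi) ^ CARD('n)) * wishart_integral p (mat 1 :: real^'n^'n))
        = enn2real (ennreal ?m * wishart_integral (p + 1/2) (mat 1 :: real^'n^'n))"
      by (simp only: wishart_integral_recursion[OF p])
    then have "sqrt (2 * pi) ^ CARD('n) * ?W p = ?m * ?W (p + 1/2)"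
      using m by (simp add: enn2real_mult)
    then show ?thesis
      using m wishart_integral_real(2)[OF p pos_def_mat_1] by (simp add: field_simps)
  qed
  also have "det (?t + ?s) = det ?t * (1 + (x \<bullet> (\<sigma> *v x)) / 2)"
    by (simp add: det_add_outer[OF r c cr rc] inner_square[OF r] flip: rr)
  also have "(det ?t * (1 + (x \<bullet> (\<sigma> *v x)) / 2)) powr (- (p + 1/2)) / det ?t powr (- p)
      = sqrt (det \<sigma>) * (1 + (x \<bullet> (\<sigma> *v x)) / 2) powr (- (p + 1/2))"
  proof -
    have dt: "det ?t > 0" using pos_def_det_pos[OF t] .
    have nn: "1 + (x \<bullet> (\<sigma> *v x)) / 2 > 0"
      by (simp add: inner_square[OF r] add_pos_nonneg flip: rr)
    have "det \<sigma> * det ?t = 1" using st by (metis det_I det_mul)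
    then have ds: "det \<sigma> = 1 / det ?t" using dt by (simp add: field_simps)
    have "det ?t powr (- (p + 1/2)) = det ?t powr (- p) * det ?t powr (- (1/2))"
      by (simp flip: powr_add)
    moreover have "det ?t powr (- (1/2)) = sqrt (det \<sigma>)"
      using dt powr_half_sqrt[of "det ?t"] by (simp only: ds powr_minus_divide real_sqrt_divide real_sqrt_one less_imp_le)
    ultimately show ?thesis using dt nn by (simp only: powr_mult less_imp_le) simp
  qed
  finally have *: "(\<integral>u. exp (- (x \<bullet> (u *v x)) / 2) * sqrt (det u) \<partial>wishart p \<sigma>)
     = sqrt (det \<sigma>) * (1 + (x \<bullet> (\<sigma> *v x)) / 2) powr (- (p + 1/2)) * (sqrt (2 * pi) ^ CARD('n) / ?m)" .
  have "(2 * pi) powr (real CARD('n) / 2) = sqrt (2 * pi) ^ CARD('n)"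
  proof -
    have "(2 * pi) powr (real CARD('n) / 2) = ((2 * pi) powr (1/2)) powr real CARD('n)"
      by (simp only: powr_powr) simp
    also have "(2 * pi) powr (1/2) = sqrt (2 * pi)" by (rule powr_half_sqrt) simp
    finally show ?thesis by (simp add: powr_realpow)
  qed
  then show ?thesis unfolding model_density_def * by simp
qed

text \<open>In the Leibniz sum every permutation other than the identity moves at least two points,
  so after one factor is differentiated an off-diagonal entry of the identity, that is 0,
  remains.\<close>

lemma has_derivative_det_mat_1: "(det has_derivative trace) (at (mat 1 :: real^'n^'n))"
proof -
  let ?P = "{p. p permutes (UNIV :: 'n set)}"
  have entry: "((\<lambda>A :: real^'n^'n. A $ i $ j) has_derivative (\<lambda>h. h $ i $ j)) F" for i j F
    by (intro bounded_linear.has_derivative[OF bounded_linear_vec_nth] bounded_linear_imp_has_derivative bounded_linear_vec_nth)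
  have "((\<lambda>A :: real^'n^'n. \<Sum>p\<in>?P. of_int (sign p) * (\<Prod>i\<in>UNIV. A $ i $ p i)) has_derivative
      (\<lambda>h. \<Sum>p\<in>?P. of_int (sign p) * (\<Sum>i\<in>UNIV. h $ i $ p i * (\<Prod>j\<in>UNIV - {i}. (mat 1 :: real^'n^'n) $ j $ p j)))) (at (mat 1))"
    by (intro has_derivative_sum has_derivative_mult_right has_derivative_prod entry)
  moreover have "(\<Sum>p\<in>?P. of_int (sign p) * (\<Sum>i\<in>UNIV. h $ i $ p i * (\<Prod>j\<in>UNIV - {i}. (mat 1 :: real^'n^'n) $ j $ p j)))
      = trace h" for h :: "real^'n^'n"
  proof -
    have "of_int (sign p) * (\<Sum>i\<in>UNIV. h $ i $ p i * (\<Prod>j\<in>UNIV - {i}. (mat 1 :: real^'n^'n) $ j $ p j))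
        = (if p = id then trace h else 0)" if p: "p permutes UNIV" for p
    proof (cases "p = id")
      case True
      have "(\<Prod>j\<in>UNIV - {i}. (mat 1 :: real^'n^'n) $ j $ id j) = 1" for i
        by (intro prod.neutral) (simp add: mat_def)
      then show ?thesis using True by (simp add: trace_def sign_id)
    next
      case False
      have "\<exists>j\<in>UNIV - {i}. (mat 1 :: real^'n^'n) $ j $ p j = 0" for i
      proof (rule ccontr)
        assume no: "\<not> ?thesis"
        have *: "p j = j" if j: "j \<noteq> i" for j
        proof -
          have "(mat 1 :: real^'n^'n) $ j $ p j \<noteq> 0" using no j by blast
          then show ?thesis by (auto simp: mat_def split: if_splits)
        qed
        moreover have "p i = i"
          using * p by (metis permutes_inv_eq permutes_univ)
        ultimately show False using False by (auto simp: fun_eq_iff) metis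
      qed
      then have "(\<Prod>j\<in>UNIV - {i}. (mat 1 :: real^'n^'n) $ j $ p j) = 0" for i
        by (intro prod_zero) auto
      then show ?thesis using False by (simp only: mult_zero_right sum.neutral_const if_False)
    qed
    then have "(\<Sum>p\<in>?P. of_int (sign p) * (\<Sum>i\<in>UNIV. h $ i $ p i * (\<Prod>j\<in>UNIV - {i}. (mat 1 :: real^'n^'n) $ j $ p j)))
        = (\<Sum>p\<in>?P. if p = id then trace h else 0)" by (intro sum.cong) auto
    also have "\<dots> = trace h" by (simp add: permutes_id)
    finally show ?thesis .
  qed
  ultimately show ?thesis unfolding det_def[abs_def] by simp
qed

text \<open>The factorisation det s = det \<sigma> det (t s) moves the base point to the
  identity.\<close>

lemma has_derivative_det:
  fixes \<sigma> t :: "real^'n^'n"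
  assumes ts: "t ** \<sigma> = mat 1" and st: "\<sigma> ** t = mat 1"
  shows "(det has_derivative (\<lambda>h. det \<sigma> * trace (t ** h))) (at \<sigma> within S)"
proof -
  have "bounded_linear (\<lambda>h :: real^'n^'n. t ** h)"
    using linear_congruence[of t "mat 1"] by (simp add: linear_conv_bounded_linear)
  then have "((\<lambda>s. t ** s) has_derivative (\<lambda>h. t ** h)) (at \<sigma> within S)"
    by (rule bounded_linear_imp_has_derivative)
  moreover have "(det has_derivative trace) (at (t ** \<sigma>))" unfolding ts by (rule has_derivative_det_mat_1)
  ultimately have "((\<lambda>s. det (t ** s)) has_derivative (\<lambda>h. trace (t ** h))) (at \<sigma> within S)"
    by (rule has_derivative_compose)
  then have "((\<lambda>s. det \<sigma> * det (t ** s)) has_derivative (\<lambda>h. det \<sigma> * trace (t ** h))) (at \<sigma> within S)"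
    by (rule has_derivative_mult_right)
  moreover have "det \<sigma> * det (t ** s) = det s" for s
  proof -
    have "det \<sigma> * det t = 1" using st by (metis det_I det_mul)
    then show ?thesis by (simp add: det_mul mult.assoc[symmetric])
  qed
  ultimately show ?thesis by simp
qed

lemma pos_def_perturb:
  fixes \<sigma> v :: "real^'n^'n"
  assumes \<sigma>: "\<sigma> \<in> pos_def" and v: "v \<in> sym_mat"
  obtains d where "d > 0" "\<And>a. \<bar>a\<bar> < d \<Longrightarrow> \<sigma> + a *\<^sub>R v \<in> pos_def"
proof -
  obtain r c where r: "r \<in> pos_def" and rr: "r ** r = \<sigma>" and cr: "c ** r = mat 1"
    using pos_def_root[OF \<sigma>] by metis
  obtain B where B: "B > 0" "\<And>x. norm (c *v x) \<le> norm x * B"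
    using bounded_linear.pos_bounded[OF matrix_vector_mul_bounded_linear[of c]] by blast
  obtain C where C: "C > 0" "\<And>x. norm (v *v x) \<le> norm x * C"
    using bounded_linear.pos_bounded[OF matrix_vector_mul_bounded_linear[of v]] by blast
  \<comment> \<open>Since |x| \<le> B |r x|, the form of \<open>\<sigma>\<close> is at least
    |x|^2/B^2, while that of \<open>v\<close> is at most C |x|^2 in absolute value.\<close>
  have "\<sigma> + a *\<^sub>R v \<in> pos_def" if a: "\<bar>a\<bar> < 1 / (B\<^sup>2 * C)" for a
  proof -
    have "x \<bullet> ((\<sigma> + a *\<^sub>R v) *v x) > 0" if x: "x \<noteq> 0" for x
    proof -
      have "norm x = norm (c *v (r *v x))" by (simp add: matrix_vector_mul_assoc cr)
      also have "\<dots> \<le> norm (r *v x) * B" by (rule B)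
      finally have "(norm x)\<^sup>2 \<le> (norm (r *v x) * B)\<^sup>2" by (intro power_mono) auto
      then have 1: "(norm x)\<^sup>2 / B\<^sup>2 \<le> x \<bullet> (\<sigma> *v x)"
        using B(1) by (simp add: inner_square[OF r] power_mult_distrib field_simps flip: rr)
      have "\<bar>x \<bullet> (v *v x)\<bar> \<le> norm x * norm (v *v x)" by (rule Cauchy_Schwarz_ineq2)
      also have "\<dots> \<le> norm x * (norm x * C)" by (intro mult_left_mono C) auto
      finally have 2: "\<bar>x \<bullet> (v *v x)\<bar> \<le> (norm x)\<^sup>2 * C" by (simp add: power2_eq_square mult_ac)
      have "\<bar>a * (x \<bullet> (v *v x))\<bar> \<le> \<bar>a\<bar> * ((norm x)\<^sup>2 * C)"
        unfolding abs_mult using 2 by (intro mult_left_mono) auto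
      also have "\<dots> < 1 / (B\<^sup>2 * C) * ((norm x)\<^sup>2 * C)"
        using a x C(1) by (intro mult_strict_right_mono) auto
      also have "\<dots> = (norm x)\<^sup>2 / B\<^sup>2" using B(1) C(1) by simp
      finally have "\<bar>a * (x \<bullet> (v *v x))\<bar> < x \<bullet> (\<sigma> *v x)" using 1 by simp
      then show ?thesis
        by (simp add: matrix_vector_mult_add_rdistrib inner_add_right scaleR_matrix_vector_assoc[symmetric])
    qed
    moreover have "\<sigma> + a *\<^sub>R v \<in> sym_mat"
      using \<sigma> v subspace_sym_mat by (auto simp: pos_def_def intro!: subspace_add subspace_scale)
    ultimately show ?thesis by (simp add: pos_def_def)
  qed
  moreover have "1 / (B\<^sup>2 * C) > 0" using B C by simp
  ultimately show ?thesis using that by blast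
qed

lemma sym_gradient_eqI:
  fixes \<sigma> g :: "real^'n^'n"
  assumes \<sigma>: "\<sigma> \<in> pos_def" and g: "g \<in> sym_mat"
    and D: "(F has_derivative (\<lambda>h. trace (g ** h))) (at \<sigma> within pos_def)"
  shows "sym_gradient F \<sigma> = g"
  unfolding sym_gradient_def
proof (rule the_equality)
  show "g \<in> sym_mat \<and> (F has_derivative (\<lambda>h. trace (g ** h))) (at \<sigma> within pos_def)" using g D by simp
  fix g' assume g': "g' \<in> sym_mat \<and> (F has_derivative (\<lambda>h. trace (g' ** h))) (at \<sigma> within pos_def)"
  define v where "v = g' - g"
  have v: "v \<in> sym_mat" unfolding v_def using g g' by (intro subspace_diff[OF subspace_sym_mat]) auto
  obtain d where d: "d > 0" "\<And>a. \<bar>a\<bar> < d \<Longrightarrow> \<sigma> + a *\<^sub>R v \<in> pos_def"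
    using pos_def_perturb[OF \<sigma> v] by blast
  have line: "((\<lambda>a. F (\<sigma> + a *\<^sub>R v)) has_derivative (\<lambda>a. trace (k ** (a *\<^sub>R v)))) (at 0)"
    if k: "(F has_derivative (\<lambda>h. trace (k ** h))) (at \<sigma> within pos_def)" for k
  proof -
    have "((\<lambda>a. \<sigma> + a *\<^sub>R v) has_derivative (\<lambda>a. a *\<^sub>R v)) (at 0 within ball 0 d)"
      by (auto intro!: derivative_eq_intros)
    moreover have "(F has_derivative (\<lambda>h. trace (k ** h))) (at (\<sigma> + 0 *\<^sub>R v) within (\<lambda>a. \<sigma> + a *\<^sub>R v) ` ball 0 d)"
      using k d(2) by (auto intro: has_derivative_subset)
    ultimately have "((\<lambda>a. F (\<sigma> + a *\<^sub>R v)) has_derivative (\<lambda>a. trace (k ** (a *\<^sub>R v)))) (at 0 within ball 0 d)"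
      using has_derivative_in_compose by fastforce
    then show ?thesis using d(1) by (simp add: at_within_open[of _ "ball 0 d"])
  qed
  have "(\<lambda>a. trace (g ** (a *\<^sub>R v))) = (\<lambda>a. trace (g' ** (a *\<^sub>R v)))"
    by (rule has_derivative_unique[OF line[OF D] line]) (use g' in simp)
  from fun_cong[OF this, of 1] have "trace (g ** v) = trace (g' ** v)" by simp
  then have "trace (transpose v ** v) = 0"
    using v by (simp add: v_def sym_mat_def matrix_sub_rdistrib_real trace_sub)
  then have "v = 0" by (simp only: trace_inner inner_eq_zero_iff)
  then show "g' = g" by (simp add: v_def)
qed

text \<open>The log density is half of ln det s, minus a constant, minus a multiple of the logarithm
  of a function affine in \<open>s\<close>. The last one contributes the outer product, because x .
  (h x) is the trace of \<open>outer x ** h\<close>.\<close>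

lemma score_eq:
  fixes \<sigma> t :: "real^'n^'n"
  assumes p: "p > (real CARD('n) - 1) / 2" and \<sigma>: "\<sigma> \<in> pos_def" and t: "t \<in> pos_def"
    and st: "\<sigma> ** t = mat 1" and ts: "t ** \<sigma> = mat 1"
  shows "score p x \<sigma> = (1/2) *\<^sub>R t - ((p + 1/2) / 2 / (1 + (x \<bullet> (\<sigma> *v x)) / 2)) *\<^sub>R outer x"
  unfolding score_def
proof (rule sym_gradient_eqI[OF \<sigma>])
  let ?a = "\<lambda>s. 1 + (x \<bullet> (s *v x)) / 2"
  let ?g = "(1/2) *\<^sub>R t - ((p + 1/2) / 2 / ?a \<sigma>) *\<^sub>R outer x"
  let ?m = "student_mass (p + 1/2) TYPE('n)"
  have "p + 1 / 2 > real CARD('n) / 2" using p by (simp add: field_simps)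
  then have m: "?m > 0" by (rule student_mass_pos)
  have "outer x \<in> sym_mat" by (simp add: sym_mat_def outer_def transpose_def vec_eq_iff)
  then show "?g \<in> sym_mat"
    using t subspace_sym_mat by (auto simp: pos_def_def intro!: subspace_diff subspace_scale)
  have a: "?a s > 0" if "s \<in> pos_def" for s
  proof -
    have "x \<bullet> (s *v x) \<ge> 0" using that by (cases "x = 0") (auto simp: pos_def_def intro: less_imp_le)
    then show ?thesis by simp
  qed
  have ln: "ln (model_density p s x) = 1/2 * ln (det s) - ln ?m - (p + 1/2) * ln (?a s)" if s: "s \<in> pos_def" for s
    using m a[OF s] pos_def_det_pos[OF s]
    by (simp add: model_density_eq[OF p s] ln_mult_pos ln_div ln_sqrt ln_powr) (simp add: algebra_simps)
  have D: "((\<lambda>s. 1/2 * ln (det s) - ln ?m - (p + 1/2) * ln (?a s)) has_derivative (\<lambda>h. trace (?g ** h))) (at \<sigma> within pos_def)"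
  proof -
    have "linear (\<lambda>s :: real^'n^'n. x \<bullet> (s *v x) / 2)"
      by (rule linearI) (simp_all add: matrix_vector_mult_add_rdistrib inner_add_right add_divide_distrib
          scaleR_matrix_vector_assoc[symmetric])
    then have "((\<lambda>s :: real^'n^'n. x \<bullet> (s *v x) / 2) has_derivative (\<lambda>s. x \<bullet> (s *v x) / 2)) (at \<sigma> within pos_def)"
      by (intro bounded_linear_imp_has_derivative) (simp add: linear_conv_bounded_linear)
    then have "((\<lambda>s. 1/2 * ln (det s) - ln ?m - (p + 1/2) * ln (?a s)) has_derivative
        (\<lambda>h. 1/2 * (det \<sigma> * trace (t ** h) * inverse (det \<sigma>)) - 0 - (p + 1/2) * ((0 + (x \<bullet> (h *v x)) / 2) * inverse (?a \<sigma>)))) (at \<sigma> within pos_def)"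
      using a[OF \<sigma>] pos_def_det_pos[OF \<sigma>]
      by (intro has_derivative_diff has_derivative_mult_right has_derivative_ln has_derivative_det[OF ts st]
          has_derivative_const has_derivative_add) auto
    moreover have "1/2 * (det \<sigma> * trace (t ** h) * inverse (det \<sigma>)) - 0 - (p + 1/2) * ((0 + (x \<bullet> (h *v x)) / 2) * inverse (?a \<sigma>))
        = trace (?g ** h)" for h
    proof -
      have "trace (?g ** h) = 1/2 * trace (t ** h) - (p + 1/2) / 2 / ?a \<sigma> * (x \<bullet> (h *v x))"
        by (simp only: matrix_sub_rdistrib_real trace_sub scaleR_matrix_mult trace_scaleR trace_outer_mult)
      moreover have "det \<sigma> * trace (t ** h) * inverse (det \<sigma>) = trace (t ** h)"
        using pos_def_det_pos[OF \<sigma>] by simp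
      ultimately show ?thesis by (simp only: divide_inverse mult_ac add_0 diff_zero)
    qed
    ultimately show ?thesis by (simp only:)
  qed
  show "((\<lambda>s. ln (model_density p s x)) has_derivative (\<lambda>h. trace (?g ** h))) (at \<sigma> within pos_def)"
    by (rule has_derivative_transform[OF \<sigma> ln D])
qed

section \<open>Fisher information\<close>

lemma matrix_sub_ldistrib_real: "(c :: real^'n^'m) ** (a - b) = c ** a - c ** b"
  by (simp add: vec_eq_iff matrix_matrix_mult_def sum_subtractf algebra_simps)

lemma has_bochner_integral_matrixI:
  fixes f :: "'a \<Rightarrow> real^'n^'m"
  assumes "\<And>i j. has_bochner_integral M (\<lambda>x. f x $ i $ j) (A $ i $ j)"
  shows "has_bochner_integral M f A"
proof -
  have exp: "B = (\<Sum>i\<in>UNIV. \<Sum>j\<in>UNIV. B $ i $ j *\<^sub>R axis i (axis j 1))" for B :: "real^'n^'m"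
    by (simp add: vec_eq_iff axis_def if_distrib[of "\<lambda>v. v $ _"] if_distrib[of "\<lambda>x. _ * x"] sum.If_cases cong: if_cong)
  have "has_bochner_integral M (\<lambda>x. \<Sum>i\<in>UNIV. \<Sum>j\<in>UNIV. f x $ i $ j *\<^sub>R axis i (axis j 1) :: real^'n^'m)
      (\<Sum>i\<in>UNIV. \<Sum>j\<in>UNIV. A $ i $ j *\<^sub>R axis i (axis j 1))"
    by (intro has_bochner_integral_sum has_bochner_integral_scaleR_left assms)
  then show ?thesis using exp by simp
qed

lemma student_quadratic_moment:
  fixes w :: "real^'n^'n"
  assumes r: "r > real CARD('n) / 2"
  shows "has_bochner_integral lborel (\<lambda>y::real^'n. (y \<bullet> (w *v y)) * (1 + (norm y)\<^sup>2 / 2) powr (- (r + 1)))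
    (student_mass r TYPE('n) / r * trace w)"
proof -
  have "has_bochner_integral lborel
      (\<lambda>y::real^'n. \<Sum>i\<in>UNIV. \<Sum>j\<in>UNIV. w $ i $ j * (y $ i * y $ j * (1 + (norm y)\<^sup>2 / 2) powr (- (r + 1))))
      (\<Sum>i\<in>UNIV. \<Sum>j\<in>UNIV. w $ i $ j * (student_mass r TYPE('n) / r * of_bool (i = j)))"
    by (intro has_bochner_integral_sum has_bochner_integral_mult_right student_moment2 r)
  moreover have "(\<Sum>i\<in>UNIV. \<Sum>j\<in>UNIV. w $ i $ j * (y $ i * y $ j * c)) = (y \<bullet> (w *v y)) * c" for y and c :: real
    by (simp add: inner_vec_def matrix_vector_mult_def sum_distrib_left sum_distrib_right mult_ac)
  moreover have "(\<Sum>i\<in>UNIV. \<Sum>j\<in>UNIV. w $ i $ j * (c * of_bool (i = j))) = c * trace w" for c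
    by (simp add: of_bool_def trace_def mult_delta_right sum.delta sum_distrib_left mult_ac)
  ultimately show ?thesis by (simp only:)
qed

lemma student_quartic_moment:
  fixes w :: "real^'n^'n"
  assumes r: "r > real CARD('n) / 2" and w: "w \<in> sym_mat"
  shows "has_bochner_integral lborel
    (\<lambda>y::real^'n. (y \<bullet> (w *v y)) * (y $ k * y $ l) * (1 + (norm y)\<^sup>2 / 2) powr (- (r + 2)))
    (student_mass r TYPE('n) / (r * (r + 1)) * (trace w * of_bool (k = l) + 2 * w $ k $ l))"
proof -
  have sym: "w $ l $ k = w $ k $ l"
    using w unfolding sym_mat_def transpose_def by (auto simp: vec_eq_iff)
  have "has_bochner_integral lborel
      (\<lambda>y::real^'n. \<Sum>i\<in>UNIV. \<Sum>j\<in>UNIV. w $ i $ j * (y $ i * y $ j * y $ k * y $ l * (1 + (norm y)\<^sup>2 / 2) powr (- (r + 2))))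
      (\<Sum>i\<in>UNIV. \<Sum>j\<in>UNIV. w $ i $ j * (student_mass r TYPE('n) / (r * (r + 1)) *
        (of_bool (i = j \<and> k = l) + of_bool (i = k \<and> j = l) + of_bool (i = l \<and> j = k))))"
    by (intro has_bochner_integral_sum has_bochner_integral_mult_right student_moment4 r)
  moreover have "(\<Sum>i\<in>UNIV. \<Sum>j\<in>UNIV. w $ i $ j * (y $ i * y $ j * y $ k * y $ l * c))
      = (y \<bullet> (w *v y)) * (y $ k * y $ l) * c" for y and c :: real
    by (simp add: inner_vec_def matrix_vector_mult_def sum_distrib_left sum_distrib_right mult_ac)
  moreover have "(\<Sum>i\<in>UNIV. \<Sum>j\<in>UNIV. w $ i $ j * (c *
        (of_bool (i = j \<and> k = l) + of_bool (i = k \<and> j = l) + of_bool (i = l \<and> j = k))))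
      = c * (trace w * of_bool (k = l) + 2 * w $ k $ l)" for c
  proof -
    \<comment> \<open>One double sum for each pairing: the first yields the trace, the other two
      yield w_kl and w_lk, equal by symmetry.\<close>
    have "(\<Sum>i\<in>UNIV. \<Sum>j\<in>UNIV. w $ i $ j * (c *
        (of_bool (i = j \<and> k = l) + of_bool (i = k \<and> j = l) + of_bool (i = l \<and> j = k))))
      = (\<Sum>i\<in>UNIV. \<Sum>j\<in>UNIV. (if j = i then c * of_bool (k = l) * w $ i $ i else 0))
      + (\<Sum>i\<in>UNIV. if i = k then (\<Sum>j\<in>UNIV. if j = l then c * w $ i $ j else 0) else 0)
      + (\<Sum>i\<in>UNIV. if i = l then (\<Sum>j\<in>UNIV. if j = k then c * w $ i $ j else 0) else 0)"
      unfolding sum.distrib[symmetric]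
    proof (rule sum.cong[OF refl])
      fix i
      have "(\<Sum>j\<in>UNIV. w $ i $ j * (c * (of_bool (i = j \<and> k = l) + of_bool (i = k \<and> j = l) + of_bool (i = l \<and> j = k))))
        = (\<Sum>j\<in>UNIV. (if j = i then c * of_bool (k = l) * w $ i $ i else 0)
           + (if i = k then (if j = l then c * w $ i $ j else 0) else 0)
           + (if i = l then (if j = k then c * w $ i $ j else 0) else 0))"
        by (intro sum.cong refl) (auto simp: algebra_simps)
      then show "(\<Sum>j\<in>UNIV. w $ i $ j * (c * (of_bool (i = j \<and> k = l) + of_bool (i = k \<and> j = l) + of_bool (i = l \<and> j = k))))
        = (\<Sum>j\<in>UNIV. (if j = i then c * of_bool (k = l) * w $ i $ i else 0))
           + (if i = k then \<Sum>j\<in>UNIV. if j = l then c * w $ i $ j else 0 else 0)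
           + (if i = l then \<Sum>j\<in>UNIV. if j = k then c * w $ i $ j else 0 else 0)"
        by (simp add: sum.distrib)
    qed
    then show ?thesis
      by (simp add: sym trace_def sum_distrib_left algebra_simps)
  qed
  ultimately show ?thesis by (simp only:)
qed

text \<open>With r = p + 1/2, \<open>Z y\<close> is twice the score at \<sigma> = 1. Expanding the
  product gives terms of degree 0, 2 and 4 in \<open>y\<close>, each with the exponent matching its
  moment formula.\<close>

lemma student_score_moment:
  fixes w :: "real^'n^'n"
  assumes r: "r > real CARD('n) / 2" and w: "w \<in> sym_mat"
  defines "Z \<equiv> \<lambda>y. mat 1 - (r / (1 + (norm y)\<^sup>2 / 2)) *\<^sub>R outer y"
  shows "has_bochner_integral lborel (\<lambda>y::real^'n. ((1 + (norm y)\<^sup>2 / 2) powr (- r) * trace (Z y ** w)) *\<^sub>R Z y)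
    ((student_mass r TYPE('n) / (r + 1)) *\<^sub>R ((2 * r) *\<^sub>R w - trace w *\<^sub>R mat 1))"
proof (rule has_bochner_integral_matrixI)
  fix k l :: 'n
  let ?m = "student_mass r TYPE('n)"
  let ?d = "(mat 1 :: real^'n^'n) $ k $ l"
  define \<phi> where "\<phi> q y = (1 + (norm y)\<^sup>2 / 2) powr (- q)" for q and y :: "real^'n"
  have r0: "r > 0" using r le_less_trans[of 0 "real CARD('n) / 2" r] by simp
  have d: "?d = of_bool (k = l)" by (simp add: mat_def)
  have "has_bochner_integral lborel (\<lambda>y. trace w * ?d * \<phi> r y - r * ?d * ((y \<bullet> (w *v y)) * \<phi> (r + 1) y)
      - r * trace w * (y $ k * y $ l * \<phi> (r + 1) y) + r\<^sup>2 * ((y \<bullet> (w *v y)) * (y $ k * y $ l) * \<phi> (r + 2) y))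
    (trace w * ?d * ?m - r * ?d * (?m / r * trace w) - r * trace w * (?m / r * of_bool (k = l))
      + r\<^sup>2 * (?m / (r * (r + 1)) * (trace w * of_bool (k = l) + 2 * w $ k $ l)))"
    unfolding \<phi>_def
    by (intro has_bochner_integral_add has_bochner_integral_diff has_bochner_integral_mult_right
        student_moment0 student_moment2 student_quadratic_moment student_quartic_moment r w)
  moreover have "trace w * ?d * \<phi> r y - r * ?d * ((y \<bullet> (w *v y)) * \<phi> (r + 1) y)
      - r * trace w * (y $ k * y $ l * \<phi> (r + 1) y) + r\<^sup>2 * ((y \<bullet> (w *v y)) * (y $ k * y $ l) * \<phi> (r + 2) y)
      = ((\<phi> r y * trace (Z y ** w)) *\<^sub>R Z y) $ k $ l" for y
  proof -
    define a where "a = 1 + (norm y)\<^sup>2 / 2"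
    have a: "a > 0" by (simp add: a_def add_pos_nonneg)
    have "a powr (- (r + 1)) = a powr (- r) * a powr (- 1)" "a powr (- (r + 2)) = a powr (- r) * a powr (- 2)"
      by (simp_all only: minus_add_distrib powr_add)
    then have \<phi>: "\<phi> (r + 1) y = \<phi> r y / a" "\<phi> (r + 2) y = \<phi> r y / a\<^sup>2"
      using a by (simp_all add: \<phi>_def powr_minus_divide flip: a_def)
    have tr: "trace (Z y ** w) = trace w - r / a * (y \<bullet> (w *v y))"
      by (simp add: Z_def matrix_sub_rdistrib_real trace_sub scaleR_matrix_mult trace_scaleR trace_outer_mult a_def)
    have Zkl: "Z y $ k $ l = ?d - r / a * (y $ k * y $ l)"
      by (simp add: Z_def outer_def a_def)
    show ?thesis
      unfolding \<phi> vector_scaleR_component Zkl tr using a by (simp add: power2_eq_square field_simps)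
  qed
  \<comment> \<open>The terms of degree 0 and 2 add up to - tr w times the mass on the diagonal; the
    quartic one contributes r/(r + 1) (tr w 1 + 2 w) times the mass.\<close>
  moreover have "trace w * ?d * ?m - r * ?d * (?m / r * trace w) - r * trace w * (?m / r * of_bool (k = l))
      + r\<^sup>2 * (?m / (r * (r + 1)) * (trace w * of_bool (k = l) + 2 * w $ k $ l))
      = ((?m / (r + 1)) *\<^sub>R ((2 * r) *\<^sub>R w - trace w *\<^sub>R mat 1)) $ k $ l"
  proof -
    define x where "x = ?m / (r + 1)"
    have m: "?m = x * (r + 1)" using r0 by (simp add: x_def)
    have "r * ?d * (?m / r * trace w) = ?d * ?m * trace w" "r * trace w * (?m / r * ?d) = trace w * ?m * ?d"
      "r\<^sup>2 * (?m / (r * (r + 1)) * y) = x * r * y" for y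
      using r0 by (simp_all add: x_def power2_eq_square)
    then show ?thesis
      unfolding d[symmetric] x_def[symmetric] by (simp only: m vector_scaleR_component vector_minus_component real_scaleR_def) (simp add: algebra_simps)
  qed
  ultimately show "has_bochner_integral lborel (\<lambda>y. (((1 + (norm y)\<^sup>2 / 2) powr (- r) * trace (Z y ** w)) *\<^sub>R Z y) $ k $ l)
      (((?m / (r + 1)) *\<^sub>R ((2 * r) *\<^sub>R w - trace w *\<^sub>R mat 1)) $ k $ l)"
    unfolding \<phi>_def by (simp only:)
qed

text \<open>By cyclicity of the trace, pairing the score with \<open>v\<close> is pairing
  \<open>Z y\<close> with w = c v c, up to the factor 1/2; this is the inner congruence. The outer
  one arises by taking the linear map A \<mapsto> c A c out of the integral.\<close>

lemma fisher_information_eq: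
  fixes \<sigma> c r v :: "real^'n^'n"
  assumes p: "p > (real CARD('n) - 1) / 2" and r: "r \<in> pos_def" and c: "c \<in> pos_def"
    and rc: "r ** c = mat 1" and cr: "c ** r = mat 1" and v: "v \<in> sym_mat"
  shows "fisher_information p (r ** r) v
    = c ** (((2 * p + 1) / (2 * (2 * p + 3))) *\<^sub>R (c ** v ** c)
         - (1 / (2 * (2 * p + 3)) * trace (c ** v ** c)) *\<^sub>R mat 1) ** c"
proof -
  let ?q = "p + 1/2" and ?\<sigma> = "r ** r" and ?t = "c ** c"
  let ?m = "student_mass ?q TYPE('n)"
  define w where "w = c ** v ** c"
  define Z where "Z y = mat 1 - (?q / (1 + (norm y)\<^sup>2 / 2)) *\<^sub>R outer y" for y :: "real^'n"
  have q: "?q > real CARD('n) / 2" using p by (simp add: field_simps)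
  then have q0: "?q > 0" using le_less_trans[of 0 "real CARD('n) / 2" ?q] by simp
  have m: "?m > 0" using student_mass_pos[OF q] .
  have \<sigma>: "?\<sigma> \<in> pos_def" and t: "?t \<in> pos_def" using r c by (simp_all add: pos_def_square)
  have "?\<sigma> ** ?t = r ** (r ** c) ** c" "?t ** ?\<sigma> = c ** (c ** r) ** r" by (simp_all add: matrix_mul_assoc)
  then have st: "?\<sigma> ** ?t = mat 1" "?t ** ?\<sigma> = mat 1" by (simp_all add: rc cr)
  have w: "w \<in> sym_mat"
    using congruence_sym_mat[of c] v pos_def_transpose[OF c] by (auto simp: w_def)
  have bl: "bounded_linear (\<lambda>A. c ** A ** c)"
    using linear_congruence[of c c] by (simp add: linear_conv_bounded_linear)
  define f where "f x = model_density p ?\<sigma> x *\<^sub>R tensor_sq (score p x ?\<sigma>) v" for x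
  \<comment> \<open>The Jacobian of x = c y cancels the factor \<open>sqrt (det \<sigma>)\<close> of
    the density.\<close>
  have dd: "det c * sqrt (det ?\<sigma>) = 1"
  proof -
    have "det r * det c = 1" using rc by (metis det_I det_mul)
    then show ?thesis using pos_def_det_pos[OF r] by (simp add: det_mul mult.commute)
  qed
  have quad: "(c *v y) \<bullet> (?\<sigma> *v (c *v y)) = (norm y)\<^sup>2" for y
    using inner_square[OF r, of "c *v y"] matrix_vector_mul_assoc[of r c y] by (simp only: rc matrix_vector_mul_lid)
  have sc: "score p (c *v y) ?\<sigma> = (1/2) *\<^sub>R (c ** Z y ** c)" for y
    unfolding score_eq[OF p \<sigma> t st] quad Z_def outer_matrix_vector pos_def_transpose[OF c]
    by (simp add: matrix_sub_ldistrib_real matrix_sub_rdistrib_real matrix_mult_scaleR scaleR_matrix_mult scaleR_diff_right)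
  have tr: "trace ((c ** Z y ** c) ** v) = trace (Z y ** w)" for y
    using trace_mul_sym[of c "Z y ** c ** v"] by (simp add: w_def matrix_mul_assoc)
  have fc: "det c *\<^sub>R f (c *v y)
      = (1 / (4 * ?m)) *\<^sub>R (c ** (((1 + (norm y)\<^sup>2 / 2) powr (- ?q) * trace (Z y ** w)) *\<^sub>R Z y) ** c)" for y
  proof -
    have "det c *\<^sub>R f (c *v y)
        = (det c * sqrt (det ?\<sigma>) * (1 / ?m * (1 + (norm y)\<^sup>2 / 2) powr (- ?q)) * (1/2 * trace (Z y ** w) * (1/2))) *\<^sub>R (c ** Z y ** c)"
      unfolding f_def model_density_eq[OF p \<sigma>] quad sc tensor_sq_def
      by (simp add: scaleR_matrix_mult trace_scaleR tr)
    then show ?thesis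
      unfolding dd by (simp add: matrix_mult_scaleR scaleR_matrix_mult)
  qed
  have "has_bochner_integral lborel (\<lambda>y. det c *\<^sub>R f (c *v y))
     ((1 / (4 * ?m)) *\<^sub>R (c ** ((?m / (?q + 1)) *\<^sub>R ((2 * ?q) *\<^sub>R w - trace w *\<^sub>R mat 1)) ** c))"
    unfolding fc Z_def
    by (intro has_bochner_integral_scaleR_right has_bochner_integral_bounded_linear[OF bl] student_score_moment q w)
  then have "(\<integral>y. det c *\<^sub>R f (c *v y) \<partial>lborel)
      = (1 / (4 * ?m)) *\<^sub>R (c ** ((?m / (?q + 1)) *\<^sub>R ((2 * ?q) *\<^sub>R w - trace w *\<^sub>R mat 1)) ** c)"
    by (rule has_bochner_integral_integral_eq)
  moreover have "fisher_information p ?\<sigma> v = (\<integral>y. det c *\<^sub>R f (c *v y) \<partial>lborel)"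
  proof -
    have [measurable]: "(outer :: real^'n \<Rightarrow> _) \<in> borel_measurable borel"
      unfolding outer_def by (intro borel_measurable_continuous_onI continuous_intros)
    have [measurable]: "(\<lambda>A :: real^'n^'n. trace (A ** v)) \<in> borel_measurable borel"
      unfolding trace_def matrix_matrix_mult_def
      by (intro borel_measurable_continuous_onI) (simp add: continuous_intros)
    have [measurable]: "f \<in> borel_measurable borel"
      unfolding f_def score_eq[OF p \<sigma> t st] model_density_eq[OF p \<sigma>] tensor_sq_def by measurable
    have "fisher_information p ?\<sigma> v = (\<integral>x. f x \<partial>density (distr lborel borel ((*v) c)) (\<lambda>_. ennreal (det c)))"
      unfolding fisher_information_def f_def[symmetric] by (subst lborel_matrix_vector[OF c]) simp
    also have "\<dots> = (\<integral>x. det c *\<^sub>R f x \<partial>distr lborel borel ((*v) c))"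
      using pos_def_det_pos[OF c] by (subst integral_density) auto
    also have "\<dots> = (\<integral>y. det c *\<^sub>R f (c *v y) \<partial>lborel)"
      by (subst integral_distr) auto
    finally show ?thesis .
  qed
  moreover have "(1 / (4 * ?m)) *\<^sub>R (c ** ((?m / (?q + 1)) *\<^sub>R ((2 * ?q) *\<^sub>R w - trace w *\<^sub>R mat 1)) ** c)
      = c ** (((2 * p + 1) / (2 * (2 * p + 3))) *\<^sub>R w - (1 / (2 * (2 * p + 3)) * trace w) *\<^sub>R mat 1) ** c"
  proof -
    \<comment> \<open>The 4 comes from the factor 1/2 in both occurrences of the score; the Student
      mass cancels the normalisation of the density.\<close>
    have "(1 / (4 * ?m)) * (?m / (?q + 1)) = 1 / (2 * (2 * p + 3))"
      using m q0 by (simp add: field_simps)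
    moreover have "(1 / (2 * (2 * p + 3)) * (2 * ?q)) *\<^sub>R w - (1 / (2 * (2 * p + 3)) * trace w) *\<^sub>R mat 1
        = (1 / (2 * (2 * p + 3))) *\<^sub>R ((2 * ?q) *\<^sub>R w - trace w *\<^sub>R mat 1)"
      by (simp only: scaleR_diff_right scaleR_scaleR)
    moreover have "(2 * p + 1) / (2 * (2 * p + 3)) = 1 / (2 * (2 * p + 3)) * (2 * ?q)" by (simp add: distrib_left add_divide_distrib)
    ultimately show ?thesis
      by (simp only: matrix_mult_scaleR scaleR_matrix_mult scaleR_scaleR)
  qed
  ultimately show ?thesis unfolding w_def by (simp only:)
qed

theorem corollary3p3:
  fixes p :: real
  assumes "p > (real CARD('n::finite) - 1) / 2"
  shows "(\<forall>\<sigma> \<in> (pos_def :: (real^'n^'n) set).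
            endo_det sym_mat (fisher_information p \<sigma>) =
              ((2 * p + 1) / (2 * (2 * p + 3))) ^ (CARD('n) * (CARD('n) + 1) div 2) *
              (1 - real CARD('n) / (2 * p + 1)) * det \<sigma> powi (- int CARD('n) - 1)) \<and>
         (jeffreys_measure p :: (real^'n^'n) measure) =
            density (subspace_lborel sym_mat)
              (\<lambda>\<sigma>. ennreal (sqrt
                (((2 * p + 1) / (2 * (2 * p + 3))) ^ (CARD('n) * (CARD('n) + 1) div 2) *
                 (1 - real CARD('n) / (2 * p + 1)) * det \<sigma> powi (- int CARD('n) - 1)) *
                indicator pos_def \<sigma>))"
proof -
  let ?n = "CARD('n)"
  let ?N = "?n * (?n + 1) div 2"
  let ?a = "(2 * p + 1) / (2 * (2 * p + 3))" and ?b = "1 / (2 * (2 * p + 3))"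
  have "p + 1 / 2 > real ?n / 2" using assms by (simp add: field_simps)
  then have p: "2 * p + 1 > 0" using le_less_trans[of 0 "real ?n / 2" "p + 1/2"] by simp
  have "?n * (?n + 1) \<ge> 1 * (1 + 1)" by (intro mult_mono) (auto simp: Suc_leI)
  then have N: "?N > 0" by simp
  \<comment> \<open>The factor 1 - n/(2p + 1) is the ratio of the eigenvalue a - n b on the identity
    to the eigenvalue a on the trace-zero matrices. Positivity of the dimension guards the truncated
    subtraction in the exponent.\<close>
  have ab: "?a ^ (?N - 1) * (?a - real ?n * ?b) = ?a ^ ?N * (1 - real ?n / (2 * p + 1))"
  proof -
    have "?a - real ?n * ?b = ?a * (1 - real ?n / (2 * p + 1))" using p by (simp add: right_diff_distrib)
    moreover have "?a ^ ?N = ?a ^ (?N - 1) * ?a" using N by (metis power_minus_mult)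
    ultimately show ?thesis by simp
  qed
  have main: "endo_det sym_mat (fisher_information p \<sigma>) =
      ?a ^ ?N * (1 - real ?n / (2 * p + 1)) * det \<sigma> powi (- int ?n - 1)"
    if \<sigma>: "\<sigma> \<in> pos_def" for \<sigma> :: "real^'n^'n"
  proof -
    obtain r c where r: "r \<in> pos_def" and c: "c \<in> pos_def" and rr: "r ** r = \<sigma>"
      and rc: "r ** c = mat 1" and cr: "c ** r = mat 1"
      using pos_def_root[OF \<sigma>] by metis
    obtain bs where bs: "is_basis_list (sym_mat :: (real^'n^'n) set) bs" using sym_mat_basis_list by blast
    define P where "P v = c ** v ** c" for v
    define S where "S v = ?a *\<^sub>R v - (?b * trace v) *\<^sub>R mat 1" for v :: "real^'n^'n"
    have P: "linear P" "P ` sym_mat \<subseteq> sym_mat"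
      using linear_congruence[of c c] congruence_sym_mat[of c] pos_def_transpose[OF c] by (simp_all add: P_def[abs_def])
    have S: "linear S" "S ` sym_mat \<subseteq> sym_mat"
    proof -
      show "linear S" unfolding S_def by (rule linear_trace_shift)
      show "S ` sym_mat \<subseteq> sym_mat"
        by (auto simp: S_def intro!: subspace_diff[OF subspace_sym_mat] subspace_scale[OF subspace_sym_mat] mat_1_sym_mat)
    qed
    have SP: "linear (S \<circ> P)" "(S \<circ> P) ` sym_mat \<subseteq> sym_mat"
      using P S by (auto intro: linear_compose)
    have "endo_det sym_mat (fisher_information p \<sigma>) = endo_det sym_mat (P \<circ> (S \<circ> P))"
      using fisher_information_eq[OF assms r c rc cr]
      by (intro endo_det_cong[OF bs]) (simp add: P_def S_def rr)
    also have "\<dots> = endo_det sym_mat P * (endo_det sym_mat S * endo_det sym_mat P)"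
      by (simp only: endo_det_compose[OF bs P SP] endo_det_compose[OF bs S P])
    also have "\<dots> = det c ^ (?n + 1) * (?a ^ ?N * (1 - real ?n / (2 * p + 1)) * det c ^ (?n + 1))"
      unfolding P_def[abs_def] S_def[abs_def] endo_det_congruence[OF c] endo_det_trace_shift ab by simp
    also have "\<dots> = ?a ^ ?N * (1 - real ?n / (2 * p + 1)) * (det c * det c) ^ (?n + 1)"
      by (simp only: power_mult_distrib mult_ac)
    \<comment> \<open>Each of the two congruences contributes (det c)^(n + 1), and (det c)^2 is the
      inverse of det \<sigma>.\<close>
    also have "(det c * det c) ^ (?n + 1) = det \<sigma> powi (- int ?n - 1)"
    proof -
      have "det r * det c = 1" using rc by (metis det_I det_mul)
      then have "(det c * det c) = inverse (det \<sigma>)"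
        using pos_def_det_pos[OF r] by (simp add: rr[symmetric] det_mul field_simps)
      moreover have "- int ?n - 1 = - int (?n + 1)" by simp
      ultimately show ?thesis by (simp only: power_int_minus power_int_of_nat power_inverse)
    qed
    finally show ?thesis .
  qed
  \<comment> \<open>The densities agree at all matrices, since the indicator makes both vanish off
    the cone.\<close>
  have dens: "(\<lambda>\<sigma>. ennreal (sqrt (endo_det sym_mat (fisher_information p \<sigma>)) * indicator pos_def \<sigma>))
      = (\<lambda>\<sigma> :: real^'n^'n. ennreal (sqrt (?a ^ ?N * (1 - real ?n / (2 * p + 1)) * det \<sigma> powi (- int ?n - 1)) * indicator pos_def \<sigma>))"
    by (rule ext) (auto simp: indicator_def main)
  show ?thesis unfolding jeffreys_measure_def dens by (intro conjI ballI main refl)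
qed

end
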